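(* Let $\mathcal{G}=(H,\sigma,\alpha,h_0)$ be a rooted combinatorial map whose underlying graph $G=(V,E)$ has at least one edge, let $v_0$ be the root-vertex and $T_G(x,y)$ the Tutte polynomial of $G$. Then: 1. The $v_0$-connected orientations are in bijection with the connected subgraphs, counted by $T_G(1,2)$. 2. The strongly connected orientations are in bijection with the external subgraphs, counted by $T_G(0,2)$. 3. The outdegree sequences are in bijection with the minimal orientations, which are in bijection with the forests, counted by $T_G(2,1)$. 4. The acyclic orientations are in bijection with the internal forests, counted by $T_G(2,0)$. 5. The $v_0$-connected outdegree sequences are in bijection with the $v_0$-connected minimal orientations, which are in bijection with the spanning trees, counted by $T_G(1,1)$. 6. The strongly connected outdegree sequences are in bijection with the strongly connected minimal orientations, which are in bijection with the external spanning trees, counted by $T_G(0,1)$. 7. The $v_0$-connected acyclic orientations are in bijection with the internal spanning trees, counted by $T_G(1,0)$.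
   Context: Tutte polynomial: $T_G(x,y)=\sum_{S\subseteq E}(x-1)^{c(S)-1}(y-1)^{|S|+c(S)-|V|}$, $c(S)$ the number of components of $(V,S)$. A rooted combinatorial map is $\mathcal{G}=(H,\sigma,\alpha,h_0)$ with $H$ a finite set of half-edges, $\sigma$ a permutation, $\alpha$ a fixed-point-free involution, $\langle\sigma,\alpha\rangle$ transitive on $H$, root $h_0$; its underlying graph $G=(V,E)$ has the cycles of $\sigma$ as vertices and pairs $\{h,\alpha(h)\}$ as edges; $v_0$ is the vertex containing $h_0$. Subgraphs are spanning, identified with edge sets. An orientation assigns to each edge $\{h,h'\}$ an ordered pair $(h,h')$ (tail $h$, head $h'$); it is $v_0$-connected if all vertices are reachable from $v_0$ by directed paths, strongly connected if all vertices are mutually reachable, acyclic if it has no directed cycle. The outdegree sequence maps each vertex to its number of incident tails; reachability depends only on the outdegree sequence, so an outdegree sequence is called $v_0$-connected (resp. strongly connected) if its orientations are. For a spanning tree $T$: edges in $T$ are internal, others external; the motion function $t(h)=\sigma\alpha(h)$ if the edge of $h$ is internal, $\sigma(h)$ otherwise, is a cyclic permutation of $H$; the $(\mathcal{G},T)$-order on $H$ is $h_0<t(h_0)<\dots<t^{|H|-1}(h_0)$, edges compared via their smaller half-edge. Fundamental cycle of external $e$: the set of $e'$ with $T-e'+e$ a spanning tree; fundamental cocycle of internal $e$: the set of $e'$ with $T-e+e'$ a spanning tree; an edge is $(\mathcal{G},T)$-active if minimal in its fundamental cycle/cocycle. $T$ is internal (resp. external) if it has no external (resp. internal) active edge. $[T^-,T^+]$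 is the set of subgraphs obtained from $T$ by removing some internal active edges and adding some external active edges; every subgraph lies in exactly one tree-interval, and $S\in[T^-,T^+]$ is called internal (resp. external) if $T$ is. $\Phi(S)$ for $S\in[T^-,T^+]$: for $e=\{h_1,h_2\}$ with $h_1<h_2$, $\Phi(S)(e)=(h_1,h_2)$ if either ($e\in T$ and its fundamental cocycle contains no edge of $S\triangle T$) or ($e\notin T$ and its fundamental cycle contains some edge of $S\triangle T$); otherwise $(h_2,h_1)$; $\Phi$ is a bijection from subgraphs to orientations. An orientation $\mathcal{O}$ is minimal if, with $T$ the tree such that $\Phi^{-1}(\mathcal{O})\in[T^-,T^+]$, no $\mathcal{O}$-directed cycle has as smallest half-edge (in $(\mathcal{G},T)$-order) a tail. *)

theory Defs
  imports
    "Graph_Theory.Digraph_Component"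
    "HOL-Combinatorics.Orbits"
    "HOL-Library.FuncSet"
begin

record 'h rooted_map =
  half_edges :: "'h set"
  vertex_perm :: "'h \<Rightarrow> 'h"  \<comment> \<open>the permutation \<open>\<sigma>\<close>\<close>
  edge_inv :: "'h \<Rightarrow> 'h"  \<comment> \<open>the involution \<open>\<alpha>\<close>\<close>
  root_half_edge :: 'h

inductive_set perm_group :: "('a \<Rightarrow> 'a) set \<Rightarrow> ('a \<Rightarrow> 'a) set"
  for A :: "('a \<Rightarrow> 'a) set" where
  one: "id \<in> perm_group A"
| gen: "f \<in> A \<Longrightarrow> g \<in> perm_group A \<Longrightarrow> f \<circ> g \<in> perm_group A"
| gen_inv: "f \<in> A \<Longrightarrow> g \<in> perm_group A \<Longrightarrow> inv f \<circ> g \<in> perm_group A"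

definition is_rooted_map :: "'h rooted_map \<Rightarrow> bool" where
  "is_rooted_map M \<longleftrightarrow>
     finite (half_edges M) \<and>
     vertex_perm M permutes half_edges M \<and>
     edge_inv M permutes half_edges M \<and>
     (\<forall>h\<in>half_edges M. edge_inv M (edge_inv M h) = h \<and> edge_inv M h \<noteq> h) \<and>
     (\<forall>h\<in>half_edges M. \<forall>h'\<in>half_edges M.
        \<exists>g\<in>perm_group {vertex_perm M, edge_inv M}. g h = h') \<and>
     root_half_edge M \<in> half_edges M"

definition vertex_of :: "'h rooted_map \<Rightarrow> 'h \<Rightarrow> 'h set" where
  "vertex_of M h = orbit (vertex_perm M) h"

definition vertices :: "'h rooted_map \<Rightarrow> 'h set set" where
  "vertices M = vertex_of M ` half_edges M"

definition edge_of :: "'h rooted_map \<Rightarrow> 'h \<Rightarrow> 'h set" where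
  "edge_of M h = {h, edge_inv M h}"

definition edges :: "'h rooted_map \<Rightarrow> 'h set set" where
  "edges M = edge_of M ` half_edges M"

definition root_vertex :: "'h rooted_map \<Rightarrow> 'h set" where
  "root_vertex M = vertex_of M (root_half_edge M)"

definition subgraphs :: "'h rooted_map \<Rightarrow> 'h set set set" where
  "subgraphs M = Pow (edges M)"

text \<open>
  The undirected multigraph \<open>(V, S)\<close> is represented by a bidirected digraph whose arcs are the
  half-edges lying on an edge of \<open>S\<close>; an arc \<open>h\<close> goes from the vertex of \<open>h\<close> to that of \<open>\<alpha> h\<close>.
  As it is symmetric, its strong components are the components of \<open>(V, S)\<close>.
\<close>

definition subgraph_digraph :: "'h rooted_map \<Rightarrow> 'h set set \<Rightarrow> ('h set, 'h) pre_digraph" where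
  "subgraph_digraph M S =
     \<lparr> verts = vertices M,
       arcs = {h \<in> half_edges M. edge_of M h \<in> S},
       tail = vertex_of M,
       head = (\<lambda>h. vertex_of M (edge_inv M h)) \<rparr>"

definition num_components :: "'h rooted_map \<Rightarrow> 'h set set \<Rightarrow> nat" where
  "num_components M S = card (pre_digraph.sccs_verts (subgraph_digraph M S))"

definition connected_subgraph :: "'h rooted_map \<Rightarrow> 'h set set \<Rightarrow> bool" where
  "connected_subgraph M S \<longleftrightarrow> S \<in> subgraphs M \<and> connected (subgraph_digraph M S)"

text \<open>
  Distinctness of the edges rules out the closed walk \<open>h, \<alpha> h\<close>, which is a cycle of the
  bidirected digraph but not of the undirected graph. Loops and pairs of parallel edges are cycles.
\<close>

definition forest_subgraph :: "'h rooted_map \<Rightarrow> 'h set set \<Rightarrow> bool" where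
  "forest_subgraph M S \<longleftrightarrow> S \<in> subgraphs M \<and>
     \<not> (\<exists>p. pre_digraph.cycle (subgraph_digraph M S) p \<and> distinct (map (edge_of M) p))"

definition span_tree :: "'h rooted_map \<Rightarrow> 'h set set \<Rightarrow> bool" where
  "span_tree M T \<longleftrightarrow> connected_subgraph M T \<and> forest_subgraph M T"

text \<open>
  The natural-number subtractions do not truncate on a rooted map: \<open>c(S) \<ge> 1\<close> since there is a
  vertex, and \<open>|S| + c(S) \<ge> |V|\<close>.
\<close>

definition tutte :: "'h rooted_map \<Rightarrow> 'a :: comm_ring_1 \<Rightarrow> 'a \<Rightarrow> 'a" where
  "tutte M x y = (\<Sum>S\<in>subgraphs M.
     (x - 1) ^ (num_components M S - 1) *
     (y - 1) ^ (card S + num_components M S - card (vertices M)))"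

definition orientations :: "'h rooted_map \<Rightarrow> ('h set \<Rightarrow> 'h \<times> 'h) set" where
  "orientations M = PiE (edges M) (\<lambda>e. {(h, edge_inv M h) | h. h \<in> e})"

definition oriented_graph ::
    "'h rooted_map \<Rightarrow> ('h set \<Rightarrow> 'h \<times> 'h) \<Rightarrow> ('h set, 'h set) pre_digraph" where
  "oriented_graph M Or =
     \<lparr> verts = vertices M,
       arcs = edges M,
       tail = (\<lambda>e. vertex_of M (fst (Or e))),
       head = (\<lambda>e. vertex_of M (snd (Or e))) \<rparr>"

definition root_connected :: "'h rooted_map \<Rightarrow> ('h set \<Rightarrow> 'h \<times> 'h) \<Rightarrow> bool" where
  "root_connected M Or \<longleftrightarrow>
     (\<forall>v\<in>vertices M. reachable (oriented_graph M Or) (root_vertex M) v)"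

definition strongly_connected_or :: "'h rooted_map \<Rightarrow> ('h set \<Rightarrow> 'h \<times> 'h) \<Rightarrow> bool" where
  "strongly_connected_or M Or \<longleftrightarrow> strongly_connected (oriented_graph M Or)"

definition directed_cycle :: "'h rooted_map \<Rightarrow> ('h set \<Rightarrow> 'h \<times> 'h) \<Rightarrow> 'h set list \<Rightarrow> bool" where
  "directed_cycle M Or p \<longleftrightarrow> pre_digraph.cycle (oriented_graph M Or) p"

definition acyclic_or :: "'h rooted_map \<Rightarrow> ('h set \<Rightarrow> 'h \<times> 'h) \<Rightarrow> bool" where
  "acyclic_or M Or \<longleftrightarrow> \<not> (\<exists>p. directed_cycle M Or p)"

definition outdegree :: "'h rooted_map \<Rightarrow> ('h set \<Rightarrow> 'h \<times> 'h) \<Rightarrow> ('h set \<Rightarrow> nat)" where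
  "outdegree M Or = restrict (out_degree (oriented_graph M Or)) (vertices M)"

definition outdegree_seqs :: "'h rooted_map \<Rightarrow> ('h set \<Rightarrow> nat) set" where
  "outdegree_seqs M = outdegree M ` orientations M"

definition root_connected_seq :: "'h rooted_map \<Rightarrow> ('h set \<Rightarrow> nat) \<Rightarrow> bool" where
  "root_connected_seq M d \<longleftrightarrow> d \<in> outdegree_seqs M \<and>
     (\<forall>Or\<in>orientations M. outdegree M Or = d \<longrightarrow> root_connected M Or)"

definition strongly_connected_seq :: "'h rooted_map \<Rightarrow> ('h set \<Rightarrow> nat) \<Rightarrow> bool" where
  "strongly_connected_seq M d \<longleftrightarrow> d \<in> outdegree_seqs M \<and>
     (\<forall>Or\<in>orientations M. outdegree M Or = d \<longrightarrow> strongly_connected_or M Or)"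

definition motion :: "'h rooted_map \<Rightarrow> 'h set set \<Rightarrow> 'h \<Rightarrow> 'h" where
  "motion M T h = (if edge_of M h \<in> T then vertex_perm M (edge_inv M h) else vertex_perm M h)"

text \<open>
  The \<open>(M, T)\<close>-order compares half-edges by their rank in \<open>h\<^sub>0, t h\<^sub>0, t (t h\<^sub>0), \<dots>\<close>.
\<close>

definition rank :: "'h rooted_map \<Rightarrow> 'h set set \<Rightarrow> 'h \<Rightarrow> nat" where
  "rank M T h = (LEAST n. (motion M T ^^ n) (root_half_edge M) = h)"

definition smallest_half_edge :: "'h rooted_map \<Rightarrow> 'h set set \<Rightarrow> 'h set \<Rightarrow> 'h" where
  "smallest_half_edge M T A = arg_min_on (rank M T) A"

definition edge_le :: "'h rooted_map \<Rightarrow> 'h set set \<Rightarrow> 'h set \<Rightarrow> 'h set \<Rightarrow> bool" where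
  "edge_le M T e e' \<longleftrightarrow>
     rank M T (smallest_half_edge M T e) \<le> rank M T (smallest_half_edge M T e')"

text \<open>
  The order of insertion and removal makes \<open>e\<close> belong to its own fundamental cycle or cocycle.
\<close>

definition fund_cycle :: "'h rooted_map \<Rightarrow> 'h set set \<Rightarrow> 'h set \<Rightarrow> 'h set set" where
  "fund_cycle M T e = {e' \<in> edges M. span_tree M (insert e T - {e'})}"

definition fund_cocycle :: "'h rooted_map \<Rightarrow> 'h set set \<Rightarrow> 'h set \<Rightarrow> 'h set set" where
  "fund_cocycle M T e = {e' \<in> edges M. span_tree M (insert e' (T - {e}))}"

definition internal_active :: "'h rooted_map \<Rightarrow> 'h set set \<Rightarrow> 'h set set" where
  "internal_active M T = {e \<in> T. \<forall>e'\<in>fund_cocycle M T e. edge_le M T e e'}"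

definition external_active :: "'h rooted_map \<Rightarrow> 'h set set \<Rightarrow> 'h set set" where
  "external_active M T = {e \<in> edges M - T. \<forall>e'\<in>fund_cycle M T e. edge_le M T e e'}"

definition tree_interval :: "'h rooted_map \<Rightarrow> 'h set set \<Rightarrow> 'h set set set" where
  "tree_interval M T =
     {T - A \<union> B | A B. A \<subseteq> internal_active M T \<and> B \<subseteq> external_active M T}"

definition tree_of :: "'h rooted_map \<Rightarrow> 'h set set \<Rightarrow> 'h set set" where
  "tree_of M S = (THE T. span_tree M T \<and> S \<in> tree_interval M T)"

definition internal_tree :: "'h rooted_map \<Rightarrow> 'h set set \<Rightarrow> bool" where
  "internal_tree M T \<longleftrightarrow> span_tree M T \<and> external_active M T = {}"

definition external_tree :: "'h rooted_map \<Rightarrow> 'h set set \<Rightarrow> bool" where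
  "external_tree M T \<longleftrightarrow> span_tree M T \<and> internal_active M T = {}"

definition internal_subgraph :: "'h rooted_map \<Rightarrow> 'h set set \<Rightarrow> bool" where
  "internal_subgraph M S \<longleftrightarrow> S \<in> subgraphs M \<and> internal_tree M (tree_of M S)"

definition external_subgraph :: "'h rooted_map \<Rightarrow> 'h set set \<Rightarrow> bool" where
  "external_subgraph M S \<longleftrightarrow> S \<in> subgraphs M \<and> external_tree M (tree_of M S)"

definition Phi :: "'h rooted_map \<Rightarrow> 'h set set \<Rightarrow> ('h set \<Rightarrow> 'h \<times> 'h)" where
  "Phi M S = (\<lambda>e\<in>edges M.
     let T = tree_of M S;
         D = (S - T) \<union> (T - S);
         h1 = smallest_half_edge M T e;
         h2 = edge_inv M h1
     in if (e \<in> T \<and> fund_cocycle M T e \<inter> D = {}) \<or> (e \<notin> T \<and> fund_cycle M T e \<inter> D \<noteq> {})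
        then (h1, h2) else (h2, h1))"

definition minimal_or :: "'h rooted_map \<Rightarrow> ('h set \<Rightarrow> 'h \<times> 'h) \<Rightarrow> bool" where
  "minimal_or M Or \<longleftrightarrow>
     (let T = tree_of M (inv_into (subgraphs M) (Phi M) Or)
      in \<not> (\<exists>p. directed_cycle M Or p \<and>
               smallest_half_edge M T (\<Union>(set p)) \<in> (\<lambda>e. fst (Or e)) ` set p))"

end

theory Submission
  imports Defs
begin

text \<open>
  Deleting an edge \<open>k\<close> of a spanning tree \<open>T\<close> cuts the tour of \<open>T\<close> into two intervals, one for each
  component of \<open>T - k\<close>. Hence an internal and an external edge can be exchanged if and only if their
  half-edges alternate along the tour. Run the tour backwards: an edge is active if and only if all
  spanning trees that agree with \<open>T\<close> on the edges met earlier agree with \<open>T\<close> on this edge as well.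
  So \<open>T\<close> is found by a sequence of decisions, each one either forced (at an active edge) or answered
  by \<open>S\<close>, and therefore every \<open>S\<close> lies in exactly one tree-interval.

  In \<open>\<Phi>(S)\<close> with \<open>S \<in> [T\<^sup>-, T\<^sup>+]\<close>, the fundamental cocycle of each removed internal edge is a cut
  directed towards the root, and the fundamental cycle of each added external edge is a directed
  cycle. These two facts yield the connectivity properties of \<open>\<Phi>(S)\<close>. They also show that, in a
  backward tour, the decision at a non-active edge can be recovered from its orientation and from
  reachability in the minor of the edges not met so far, which proves that \<open>\<Phi>\<close> is injective. As
  reachability only depends on outdegrees, the tours of two orientations with equal outdegrees agree
  up to the first edge where the orientations differ; in one of them that edge is flipped. In a
  minimal orientation a flipped edge lies in a directed cut, which is determined by the outdegrees,
  so minimal orientations are determined by their outdegrees; in a non-minimal one, reversing a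
  directed cycle makes the sequence of flipped edges lexicographically smaller.
\<close>

section \<open>Connectivity and spanning trees\<close>

text \<open>The direction of the tour matters. The predecessor of a half-edge \<open>y\<close> is
  \<open>inv \<sigma> y\<close> or its partner, according to whether the edge of
  \<open>inv \<sigma> y\<close> is internal. Going backwards from \<open>h0\<close>, the tour is
  thus determined by the decisions made so far, and an edge is met first at its larger half-edge. Of
  two alternating edges, the one with the smaller first half-edge also has the smaller second one.
  So when an active edge is met, the other edges of its fundamental cycle or cocycle have all been
  decided, whereas a non-active edge still has an undecided exchange partner. The orientation of an
  edge only tells whether the edge is flipped against the default of its kind, not whether it is
  internal. The missing bit comes from four statements on reachability in the minor: the two on
  unflipped edges give opposite answers for internal and external edges, and so do the two on
  flipped edges. Surjectivity of \<open>Phi M\<close> needs no inverse construction, since subgraphs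
  and orientations are equally many.\<close>

locale rmap =
  fixes M :: "'h rooted_map"
  assumes rooted_map: "is_rooted_map M"
begin

abbreviation "H \<equiv> half_edges M"
abbreviation "\<sigma> \<equiv> vertex_perm M"
abbreviation "\<alpha> \<equiv> edge_inv M"
abbreviation "h0 \<equiv> root_half_edge M"
abbreviation "vt \<equiv> vertex_of M"
abbreviation "eo \<equiv> edge_of M"
abbreviation "V \<equiv> vertices M"
abbreviation "E \<equiv> edges M"

lemma finite_H [simp]: "finite H"
  and perm_\<sigma>: "\<sigma> permutes H"
  and perm_\<alpha>: "\<alpha> permutes H"
  and root_in_H [simp]: "h0 \<in> H"
  and \<alpha>_\<alpha> [simp]: "h \<in> H \<Longrightarrow> \<alpha> (\<alpha> h) = h"
  and \<alpha>_neq: "h \<in> H \<Longrightarrow> \<alpha> h \<noteq> h"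
  and transitive: "h \<in> H \<Longrightarrow> h' \<in> H \<Longrightarrow> \<exists>g\<in>perm_group {\<sigma>, \<alpha>}. g h = h'"
  using rooted_map unfolding is_rooted_map_def by blast+

lemma \<sigma>_in_H [simp]: "\<sigma> h \<in> H \<longleftrightarrow> h \<in> H"
  and \<alpha>_in_H [simp]: "\<alpha> h \<in> H \<longleftrightarrow> h \<in> H"
  using perm_\<sigma> perm_\<alpha> by (auto simp: permutes_in_image)

lemma permutation_\<sigma>: "permutation \<sigma>"
  using finite_H perm_\<sigma> unfolding permutation_permutes by blast

lemma vt_\<sigma> [simp]: "vt (\<sigma> h) = vt h"
  unfolding vertex_of_def by (rule permutation_orbit_step[OF permutation_\<sigma>])

lemma vt_eq_iff: "vt h = vt h' \<longleftrightarrow> h' \<in> orbit \<sigma> h"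
  unfolding vertex_of_def
  by (metis cyclic_on_orbit' orbit_cyclic_eq3 permutation_\<sigma> permutation_self_in_orbit)

lemma vt_eqD: "vt h = vt h' \<Longrightarrow> \<exists>n. h' = (\<sigma> ^^ n) h"
  unfolding vt_eq_iff orbit_altdef by auto

lemma vt_invariant:
  assumes "vt h = vt h'" and "\<And>x. x \<in> H \<Longrightarrow> P (\<sigma> x) = P x" and "h \<in> H"
  shows "P h = P h'"
proof -
  obtain n where n: "h' = (\<sigma> ^^ n) h" using vt_eqD[OF assms(1)] by blast
  have "(\<sigma> ^^ n) h \<in> H \<and> P ((\<sigma> ^^ n) h) = P h" for n
    by (induction n) (use assms in auto)
  then show ?thesis using n by simp
qed

lemma vt_in_V [simp]: "h \<in> H \<Longrightarrow> vt h \<in> V"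
  unfolding vertices_def by simp

lemma V_E: assumes "u \<in> V" obtains h where "h \<in> H" "u = vt h"
  using assms unfolding vertices_def by blast

lemma finite_V [simp]: "finite V"
  unfolding vertices_def by simp

lemma root_in_V [simp]: "root_vertex M \<in> V"
  unfolding root_vertex_def by simp

lemma eo_\<alpha> [simp]: "h \<in> H \<Longrightarrow> eo (\<alpha> h) = eo h"
  unfolding edge_of_def by auto

lemma eo_eq_iff: "h \<in> H \<Longrightarrow> eo h' = eo h \<longleftrightarrow> h' = h \<or> h' = \<alpha> h"
  unfolding edge_of_def by (auto simp: doubleton_eq_iff)

lemma eo_in_E [simp]: "h \<in> H \<Longrightarrow> eo h \<in> E"
  unfolding edges_def by simp

lemma E_E: assumes "e \<in> E" obtains h where "h \<in> H" "e = eo h"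
  using assms unfolding edges_def by blast

lemma finite_E [simp]: "finite E"
  unfolding edges_def by simp

lemma E_half: assumes "e \<in> E" and "h \<in> e" shows "h \<in> H" "e = eo h"
  using assms unfolding edges_def edge_of_def by auto

text \<open>A set of half-edges serves as a set of arcs: \<open>h\<close> leads from its vertex to
  the vertex of its partner. One relation then covers the undirected subgraphs (both halves of each
  edge), the orientations (their tails) and the minors, where some edges are contracted and the
  others are directed.\<close>

definition reach :: "'h set \<Rightarrow> ('h set \<times> 'h set) set" where
  "reach X = ((\<lambda>h. (vt h, vt (\<alpha> h))) ` X)\<^sup>*"

definition darts :: "'h set set \<Rightarrow> 'h set" where
  "darts S = {h \<in> H. eo h \<in> S}"

lemma darts_subset [simp]: "darts S \<subseteq> H"
  unfolding darts_def by auto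

lemma in_darts: "h \<in> darts S \<longleftrightarrow> h \<in> H \<and> eo h \<in> S"
  unfolding darts_def by auto

abbreviation "linked X x y \<equiv> (vt x, vt y) \<in> reach X"

lemma reach_refl [simp]: "(u, u) \<in> reach X"
  unfolding reach_def by simp

lemma reach_trans [trans]: "(u, w) \<in> reach X \<Longrightarrow> (w, x) \<in> reach X \<Longrightarrow> (u, x) \<in> reach X"
  unfolding reach_def by (rule rtrancl_trans)

lemma reach_step: "h \<in> X \<Longrightarrow> linked X h (\<alpha> h)"
  unfolding reach_def by blast

lemma reach_mono: "X \<subseteq> Y \<Longrightarrow> (u, w) \<in> reach X \<Longrightarrow> (u, w) \<in> reach Y"
  unfolding reach_def by (meson image_mono rtrancl_mono subsetD)

lemma reach_subst:
  assumes "(u, w) \<in> reach X" and "\<And>h. h \<in> X \<Longrightarrow> linked Y h (\<alpha> h)"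
  shows "(u, w) \<in> reach Y"
  using assms(1) unfolding reach_def
proof (induction rule: rtrancl_induct)
  case (step y z)
  then show ?case using assms(2) unfolding reach_def by (auto intro: rtrancl_trans)
qed simp

text \<open>The form in which cuts are used: \<open>P\<close> stands for a set of half-edges that is
  a union of vertices (invariance under \<sigma>) and that no arc of \<open>X\<close> leaves, so a
  walk that starts in it stays in it.\<close>

lemma reach_closed:
  assumes "linked X x y" and "P x"
    and \<sigma>: "\<And>h. h \<in> H \<Longrightarrow> P (\<sigma> h) = P h"
    and X: "\<And>h. h \<in> X \<Longrightarrow> P h \<Longrightarrow> P (\<alpha> h)"
    and "X \<subseteq> H" "x \<in> H" "y \<in> H"
  shows "P y"
proof -
  have "\<forall>h\<in>H. vt h = w \<longrightarrow> P h" if "(vt x, w) \<in> reach X" for w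
    using that unfolding reach_def
  proof (induction rule: rtrancl_induct)
    case base
    then show ?case using assms(2,6) vt_invariant[of x _ P] \<sigma> by metis
  next
    case (step y z)
    then obtain h where h: "h \<in> X" "y = vt h" "z = vt (\<alpha> h)" by auto
    then have "P (\<alpha> h)" using step.IH X assms(5) by auto
    moreover have "\<alpha> h \<in> H" using h assms(5) by auto
    ultimately show ?case using vt_invariant[of "\<alpha> h" _ P] \<sigma> h by metis
  qed
  then show ?thesis using assms by blast
qed

lemma reach_sym:
  assumes "(u, w) \<in> reach X" and "\<And>h. h \<in> X \<Longrightarrow> \<alpha> h \<in> X" and "X \<subseteq> H"
  shows "(w, u) \<in> reach X"
proof -
  have "sym ((\<lambda>h. (vt h, vt (\<alpha> h))) ` X)"
    using assms(2,3) unfolding sym_def by (force simp: image_iff)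
  then show ?thesis using assms(1) unfolding reach_def by (meson sym_rtrancl symD)
qed

lemma reach_darts_sym: "(u, w) \<in> reach (darts S) \<Longrightarrow> (w, u) \<in> reach (darts S)"
  by (rule reach_sym) (auto simp: in_darts)

lemma reach_in_V: "(u, w) \<in> reach X \<Longrightarrow> X \<subseteq> H \<Longrightarrow> u \<in> V \<Longrightarrow> w \<in> V"
  unfolding reach_def by (induction rule: rtrancl_induct) auto

section \<open>Connectivity and cycles of the digraphs in terms of \<open>reach\<close>\<close>

lemma reachable_conv:
  assumes "wf_digraph G"
  shows "u \<rightarrow>\<^sup>*\<^bsub>G\<^esub> w \<longleftrightarrow> u \<in> verts G \<and> (u, w) \<in> (arcs_ends G)\<^sup>*"
proof -
  interpret wf_digraph G by fact
  have "(u, w) \<in> (arcs_ends G)\<^sup>* \<Longrightarrow> u \<in> verts G \<Longrightarrow> u \<rightarrow>\<^sup>*\<^bsub>G\<^esub> w"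
    by (induction rule: rtrancl_induct) (auto intro: reachable_adj_trans)
  then show ?thesis by (auto intro: reachable_rtranclI elim: reachable_in_vertsE)
qed

lemma wf_subgraph: "wf_digraph (subgraph_digraph M S)"
  by unfold_locales (auto simp: subgraph_digraph_def)

lemma arcs_ends_subgraph: "arcs_ends (subgraph_digraph M S) = (\<lambda>h. (vt h, vt (\<alpha> h))) ` darts S"
  by (auto simp: arcs_ends_conv subgraph_digraph_def darts_def)

lemma reachable_subgraph:
  "u \<rightarrow>\<^sup>*\<^bsub>subgraph_digraph M S\<^esub> w \<longleftrightarrow> u \<in> V \<and> (u, w) \<in> reach (darts S)"
  unfolding reachable_conv[OF wf_subgraph] arcs_ends_subgraph reach_def
  by (simp add: subgraph_digraph_def)

definition conn :: "'h set set \<Rightarrow> bool" where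
  "conn S \<longleftrightarrow> (\<forall>u\<in>V. \<forall>w\<in>V. (u, w) \<in> reach (darts S))"

lemma connected_subgraph_iff: "connected_subgraph M S \<longleftrightarrow> S \<subseteq> E \<and> conn S"
proof -
  let ?G = "subgraph_digraph M S"
  \<comment> \<open>Connectedness is tested on the symmetrized digraph; the arcs are symmetric
    already, so symmetrizing adds nothing.\<close>
  have sym: "\<And>h. h \<in> darts S \<Longrightarrow> \<alpha> h \<in> darts S" by (auto simp: in_darts)
  have "parcs (mk_symmetric ?G) = arcs_ends ?G \<union> (arcs_ends ?G)\<inverse>"
    by (auto simp: mk_symmetric_def arcs_ends_conv)
  moreover have "(arcs_ends ?G)\<inverse> \<subseteq> arcs_ends ?G"
    unfolding arcs_ends_subgraph using sym by (force simp: image_iff in_darts)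
  ultimately have parcs: "parcs (mk_symmetric ?G) = arcs_ends ?G" by blast
  then have 1: "arcs_ends (mk_symmetric ?G) = arcs_ends ?G"
    using parcs by (simp add: arcs_ends_conv)
  have 2: "verts (mk_symmetric ?G) = V" by (simp add: mk_symmetric_def subgraph_digraph_def)
  have 3: "wf_digraph (with_proj (mk_symmetric ?G))"
    using 2 parcs by unfold_locales (auto simp: arcs_ends_subgraph in_darts)
  show ?thesis
    unfolding connected_subgraph_def subgraphs_def connected_def strongly_connected_def conn_def
      reachable_conv[OF 3] 1 2 arcs_ends_subgraph reach_def
    using root_in_V by blast
qed

text \<open>Every edge is a bridge. In contrast to the absence of cycles, this can be handled by
  counting components.\<close>

definition acyc :: "'h set set \<Rightarrow> bool" where
  "acyc S \<longleftrightarrow> (\<forall>h\<in>darts S. \<not> linked (darts (S - {eo h})) (\<alpha> h) h)"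

lemma acycD:
  "acyc S \<Longrightarrow> h \<in> H \<Longrightarrow> eo h \<in> S \<Longrightarrow> \<not> linked (darts (S - {eo h})) (\<alpha> h) h"
  unfolding acyc_def by (simp add: in_darts)

lemma rtrancl_awalk:
  assumes "wf_digraph G" and "Z \<subseteq> arcs G" and "(u, w) \<in> ((\<lambda>e. (tail G e, head G e)) ` Z)\<^sup>*" and "u \<in> verts G"
  obtains p where "pre_digraph.apath G u p w" "set p \<subseteq> Z"
proof -
  interpret wf_digraph G by fact
  from assms(3) have "\<exists>p. awalk u p w \<and> set p \<subseteq> Z"
  proof (induction rule: rtrancl_induct)
    case base
    then show ?case using assms(4) by (auto intro: exI[of _ "[]"] simp: awalk_Nil_iff)
  next
    case (step y z)
    then obtain p e where p: "awalk u p y" "set p \<subseteq> Z" "e \<in> Z" "y = tail G e" "z = head G e" by auto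
    then have "awalk u (p @ [e]) z" using assms(2) by (auto simp: awalk_Cons_iff awalk_Nil_iff)
    then show ?case using p by (intro exI[of _ "p @ [e]"]) auto
  qed
  then obtain p where "awalk u p w" "set p \<subseteq> Z" by blast
  then show thesis
    using that[of "awalk_to_apath p"] apath_awalk_to_apath awalk_to_apath_subset by blast
qed

lemma awalk_rtrancl:
  assumes "wf_digraph G" and "pre_digraph.awalk G u p w"
  shows "(u, w) \<in> ((\<lambda>e. (tail G e, head G e)) ` set p)\<^sup>*"
proof -
  interpret wf_digraph G by fact
  show ?thesis using assms(2)
  proof (induction p arbitrary: u)
    case Nil
    then show ?case by (simp add: awalk_Nil_iff)
  next
    case (Cons e p)
    then have *: "tail G e = u" "awalk (head G e) p w" by (simp_all add: awalk_Cons_iff)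
    have "(head G e, w) \<in> ((\<lambda>e. (tail G e, head G e)) ` set (e # p))\<^sup>*"
      by (rule rtrancl_mono[THEN subsetD, OF _ Cons.IH[OF *(2)]]) auto
    moreover have "(u, head G e) \<in> (\<lambda>e. (tail G e, head G e)) ` set (e # p)"
      using *(1) by simp
    ultimately show ?case by (rule converse_rtrancl_into_rtrancl[rotated])
  qed
qed

text \<open>A second arc on the edge of the first arc \<open>h\<close> would start or end at the
  vertex of \<open>h\<close>, which a path does not visit again. Hence closing a path by an edge
  that is not on it gives a cycle in the undirected sense.\<close>

lemma apath_distinct_edges:
  assumes "pre_digraph.apath (subgraph_digraph M S) u p w"
  shows "distinct (map eo p)"
proof -
  interpret wf_digraph "subgraph_digraph M S" by (rule wf_subgraph)
  let ?G = "subgraph_digraph M S"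
  have G: "tail ?G h = vt h" "head ?G h = vt (\<alpha> h)" "h \<in> arcs ?G \<longleftrightarrow> h \<in> darts S" for h
    by (simp_all add: subgraph_digraph_def darts_def)
  show ?thesis using assms
  proof (induction p arbitrary: u)
    case (Cons h p)
    from Cons.prems[unfolded apath_Cons_iff G]
    have h: "h \<in> darts S" "u = vt h" "apath (vt (\<alpha> h)) p w"
      "vt h \<notin> set (awalk_verts (vt (\<alpha> h)) p)"
      by blast+
    have aw: "awalk (vt (\<alpha> h)) p w" using h(3) by (rule awalkI_apath)
    have "eo h \<notin> eo ` set p"
    proof
      assume "eo h \<in> eo ` set p"
      then obtain x where x: "x \<in> set p" "eo x = eo h" by auto
      have "x = h \<or> x = \<alpha> h" using x(2) h(1) eo_eq_iff by (simp add: in_darts)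
      then show False
        using awalk_verts_arc1[OF x(1), of "vt (\<alpha> h)"] awalk_verts_arc2[OF aw x(1)] h(1,4)
        unfolding G by (auto simp: in_darts)
    qed
    then show ?case using Cons.IH[OF h(3)] by simp
  qed simp
qed

lemma forest_subgraph_iff: "forest_subgraph M S \<longleftrightarrow> S \<subseteq> E \<and> acyc S"
proof -
  let ?G = "subgraph_digraph M S"
  interpret wf_digraph ?G by (rule wf_subgraph)
  have ends: "(\<lambda>e. (tail ?G e, head ?G e)) = (\<lambda>h. (vt h, vt (\<alpha> h)))"
    and [simp]: "tail ?G = vt" "head ?G h = vt (\<alpha> h)" "arcs ?G = darts S" "verts ?G = V" for h
    by (auto simp: subgraph_digraph_def darts_def)
  have "(\<exists>p. cycle p \<and> distinct (map eo p)) \<longleftrightarrow>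
      (\<exists>h\<in>darts S. linked (darts (S - {eo h})) (\<alpha> h) h)"
  proof
    assume "\<exists>p. cycle p \<and> distinct (map eo p)"
    then obtain p u where p: "awalk u p u" "p \<noteq> []" "distinct (map eo p)"
      unfolding cycle_def by blast
    then obtain h q where q: "p = h # q" by (cases p) auto
    have *: "h \<in> darts S" "u = vt h" "awalk (vt (\<alpha> h)) q (vt h)"
      using p(1) q by (auto simp: awalk_Cons_iff)
    have "set q \<subseteq> darts S" using *(3) by (auto simp: awalk_def)
    moreover have "eo h \<notin> eo ` set q" using p(3) q by simp
    ultimately have "set q \<subseteq> darts (S - {eo h})" unfolding darts_def by blast
    moreover have "linked (set q) (\<alpha> h) h"
      using awalk_rtrancl[OF wf_subgraph *(3)] unfolding reach_def ends .
    ultimately have "linked (darts (S - {eo h})) (\<alpha> h) h"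
      by (rule reach_mono)
    then show "\<exists>h\<in>darts S. linked (darts (S - {eo h})) (\<alpha> h) h" using *(1) by blast
  next
    assume "\<exists>h\<in>darts S. linked (darts (S - {eo h})) (\<alpha> h) h"
    then obtain h where h: "h \<in> darts S" "linked (darts (S - {eo h})) (\<alpha> h) h" by blast
    have sub: "darts (S - {eo h}) \<subseteq> arcs ?G" by (auto simp: in_darts)
    obtain q where q: "apath (vt (\<alpha> h)) q (vt h)" "set q \<subseteq> darts (S - {eo h})"
      using rtrancl_awalk[OF wf_subgraph sub, of "vt (\<alpha> h)" "vt h"] h unfolding reach_def ends
      by (auto simp: in_darts)
    then have "awalk (vt h) (h # q) (vt h)" "distinct (tl (awalk_verts (vt h) (h # q)))"
      using h(1) by (auto simp: apath_def awalk_Cons_iff)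
    moreover have "distinct (map eo (h # q))"
      using apath_distinct_edges[OF q(1)] q(2) by (auto simp: in_darts)
    ultimately show "\<exists>p. cycle p \<and> distinct (map eo p)" unfolding cycle_def by blast
  qed
  then show ?thesis unfolding forest_subgraph_def acyc_def subgraphs_def by auto
qed

lemma span_tree_iff: "span_tree M T \<longleftrightarrow> T \<subseteq> E \<and> conn T \<and> acyc T"
  unfolding span_tree_def connected_subgraph_iff forest_subgraph_iff by auto

section \<open>Counting components\<close>

definition component :: "'h set set \<Rightarrow> 'h set \<Rightarrow> 'h set set" where
  "component S u = {w. (u, w) \<in> reach (darts S)}"

lemma component_eq_iff: "component S u = component S w \<longleftrightarrow> (u, w) \<in> reach (darts S)"
  unfolding component_def by (auto intro: reach_trans reach_darts_sym)

lemma num_components_eq: "num_components M S = card (component S ` V)"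
proof -
  interpret wf_digraph "subgraph_digraph M S" by (rule wf_subgraph)
  have in_V: "u \<in> V \<Longrightarrow> (u, w) \<in> reach (darts S) \<Longrightarrow> w \<in> V" for u w
    by (rule reach_in_V[OF _ darts_subset])
  have "X \<in> sccs_verts \<longleftrightarrow> X \<in> component S ` V" for X
  proof
    assume X: "X \<in> sccs_verts"
    then obtain u where u: "u \<in> X" unfolding in_sccs_verts_conv_reachable by blast
    have "u \<in> V" using X u unfolding in_sccs_verts_conv_reachable reachable_subgraph by blast
    moreover have "X = component S u"
      using X u in_V unfolding in_sccs_verts_conv_reachable reachable_subgraph component_def
      by (blast dest: reach_darts_sym)
    ultimately show "X \<in> component S ` V" by blast
  next
    assume "X \<in> component S ` V"
    then obtain u where u: "u \<in> V" "X = component S u" by blast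
    have "u \<in> X" using u by (simp add: component_def)
    moreover have "x \<in> X \<Longrightarrow> y \<in> X \<longleftrightarrow> x \<in> V \<and> (x, y) \<in> reach (darts S)" for x y
      using u in_V unfolding component_def by (blast intro: reach_trans dest: reach_darts_sym)
    ultimately show "X \<in> sccs_verts"
      unfolding in_sccs_verts_conv_reachable reachable_subgraph by blast
  qed
  then have "sccs_verts = component S ` V" by blast
  then show ?thesis unfolding num_components_def by simp
qed

lemma conn_iff_num_components: "conn S \<longleftrightarrow> num_components M S = 1"
proof
  assume "conn S"
  have "component S u = component S (root_vertex M)" if "u \<in> V" for u
    using \<open>conn S\<close>[unfolded conn_def, rule_format, OF that root_in_V] unfolding component_eq_iff .
  then have "component S ` V = (\<lambda>_. component S (root_vertex M)) ` V" by (rule image_cong[OF refl])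
  then have "component S ` V = {component S (root_vertex M)}"
    using root_in_V by (simp only: image_constant[OF root_in_V])
  then show "num_components M S = 1" unfolding num_components_eq by simp
next
  assume "num_components M S = 1"
  then obtain c where "component S ` V = {c}" unfolding num_components_eq by (rule card_1_singletonE)
  then have "component S u = c" if "u \<in> V" for u using that by auto
  then show "conn S" unfolding conn_def component_eq_iff[symmetric] by simp
qed

lemma num_components_empty: "num_components M {} = card V"
proof -
  have "reach (darts {}) = Id" by (simp add: darts_def reach_def)
  then have "inj_on (component {}) V" by (auto simp: inj_on_def component_eq_iff)
  then show ?thesis unfolding num_components_eq by (rule card_image)
qed

lemma darts_insert: "h \<in> H \<Longrightarrow> darts (insert (eo h) S) = insert h (insert (\<alpha> h) (darts S))"
  unfolding darts_def using eo_eq_iff by auto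

text \<open>A walk can be shortened until it uses the new edge at most once, in one of its two
  directions.\<close>

lemma reach_insert_iff:
  assumes "h \<in> H"
  shows "(u, w) \<in> reach (darts (insert (eo h) S)) \<longleftrightarrow>
    (u, w) \<in> reach (darts S) \<or>
    ((u, vt h) \<in> reach (darts S) \<and> (vt (\<alpha> h), w) \<in> reach (darts S)) \<or>
    ((u, vt (\<alpha> h)) \<in> reach (darts S) \<and> (vt h, w) \<in> reach (darts S))" (is "?L \<longleftrightarrow> ?R u w")
proof
  assume ?L
  then show "?R u w" unfolding reach_def[of "darts (insert (eo h) S)"]
  proof (induction rule: rtrancl_induct)
    case base
    then show ?case by simp
  next
    case (step y z)
    then have "(y, z) = (vt h, vt (\<alpha> h)) \<or> (y, z) = (vt (\<alpha> h), vt h) \<or> (y, z) \<in> reach (darts S)"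
      unfolding darts_insert[OF assms] using assms reach_step by auto
    then show ?case using step.IH
      by (elim disjE) (auto intro: reach_trans)
  qed
next
  have sub: "darts S \<subseteq> darts (insert (eo h) S)" by (auto simp: in_darts)
  have "linked (darts (insert (eo h) S)) h (\<alpha> h)"
    using assms by (intro reach_step) (simp add: in_darts)
  moreover assume "?R u w"
  ultimately show ?L using reach_mono[OF sub] by (meson reach_trans reach_darts_sym)
qed

lemma num_components_insert_same:
  assumes "h \<in> H" and "linked (darts S) h (\<alpha> h)"
  shows "num_components M (insert (eo h) S) = num_components M S"
proof -
  have "component (insert (eo h) S) u = component S u" for u
    unfolding component_def reach_insert_iff[OF assms(1)]
    using assms(2) by (blast intro: reach_trans dest: reach_darts_sym)
  then show ?thesis unfolding num_components_eq by simp
qed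

lemma num_components_insert_diff:
  assumes "h \<in> H" and "\<not> linked (darts S) h (\<alpha> h)"
  shows "num_components M S = Suc (num_components M (insert (eo h) S))"
proof -
  let ?a = "component S (vt h)" and ?b = "component S (vt (\<alpha> h))" and ?S = "insert (eo h) S"
  have neq: "?a \<noteq> ?b" using assms(2) by (simp add: component_eq_iff)
  \<comment> \<open>\<open>f\<close> merges the two components that the new edge joins. It is
    injective once \<open>?b\<close> is dropped, so exactly one component disappears.\<close>
  define f where "f X = (if X = ?a \<or> X = ?b then ?a \<union> ?b else X)" for X
  have "component ?S u = f (component S u)" for u
  proof (cases "(u, vt h) \<in> reach (darts S) \<or> (u, vt (\<alpha> h)) \<in> reach (darts S)")
    case True
    then have "component S u = ?a \<or> component S u = ?b" by (simp add: component_eq_iff)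
    then have "f (component S u) = ?a \<union> ?b" by (auto simp: f_def)
    moreover have "component ?S u = ?a \<union> ?b"
      unfolding component_def reach_insert_iff[OF assms(1)] using True
      by (blast intro: reach_trans reach_darts_sym)
    ultimately show ?thesis by simp
  next
    case False
    then have "component S u \<noteq> ?a" "component S u \<noteq> ?b" by (simp_all add: component_eq_iff)
    moreover have "component ?S u = component S u"
      unfolding component_def reach_insert_iff[OF assms(1)] using False by blast
    ultimately show ?thesis by (simp add: f_def)
  qed
  then have "component ?S ` V = f ` (component S ` V)" by (auto simp: image_image)
  moreover have "f ` (component S ` V) = f ` (component S ` V - {?b})"
  proof -
    have "f ?b = f ?a" "?a \<in> component S ` V - {?b}" using assms(1) neq by (simp_all add: f_def)
    then have "f x \<in> f ` (component S ` V - {?b})" if "x \<in> component S ` V" for x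
      using that by (cases "x = ?b") auto
    then show ?thesis by blast
  qed
  moreover have "inj_on f (component S ` V - {?b})"
  proof -
    have "?a \<union> ?b \<noteq> component S u" for u
    proof
      assume "?a \<union> ?b = component S u"
      moreover have "vt h \<in> ?a" "vt (\<alpha> h) \<in> ?b" by (simp_all add: component_def)
      ultimately have "vt h \<in> component S u" "vt (\<alpha> h) \<in> component S u" by blast+
      then have *: "(u, vt h) \<in> reach (darts S)" "(u, vt (\<alpha> h)) \<in> reach (darts S)"
        unfolding component_def by blast+
      show False using assms(2) reach_trans[OF reach_darts_sym[OF *(1)] *(2)] by (rule notE)
    qed
    then show ?thesis by (auto simp: inj_on_def f_def split: if_splits)
  qed
  ultimately have "num_components M ?S = card (component S ` V - {?b})"
    unfolding num_components_eq by (simp add: card_image)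
  moreover have "?b \<in> component S ` V" using assms(1) by simp
  ultimately show ?thesis unfolding num_components_eq by (metis card_Suc_Diff1 finite_V finite_imageI)
qed

lemma finite_subgraph [simp]: "S \<subseteq> E \<Longrightarrow> finite S"
  using finite_E by (rule finite_subset[rotated])

lemma num_components_rank: "S \<subseteq> E \<Longrightarrow> card V \<le> num_components M S + card S"
proof (induction "card S" arbitrary: S)
  case 0
  then show ?case using num_components_empty by (simp add: card_eq_0_iff)
next
  case (Suc n)
  then obtain e where e: "e \<in> S" by fastforce
  then obtain h where h: "h \<in> H" "e = eo h" using Suc.prems by (meson E_E subsetD)
  have fin: "finite S" using Suc.prems by simp
  have "card V \<le> num_components M (S - {e}) + card (S - {e})"
    using Suc e fin by (intro Suc.hyps) auto
  moreover have "num_components M (S - {e}) \<le> Suc (num_components M (insert (eo h) (S - {e})))"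
    using num_components_insert_same[OF h(1)] num_components_insert_diff[OF h(1)]
    by (metis le_SucI order_refl)
  moreover have "insert (eo h) (S - {e}) = S" using e h by auto
  moreover have "card S = Suc (card (S - {e}))" using e fin by (metis card_Suc_Diff1)
  ultimately show ?case by simp
qed

lemma acyc_subset: "acyc S \<Longrightarrow> S' \<subseteq> S \<Longrightarrow> acyc S'"
  unfolding acyc_def
proof
  fix h assume *: "\<forall>h\<in>darts S. \<not> linked (darts (S - {eo h})) (\<alpha> h) h" "S' \<subseteq> S" "h \<in> darts S'"
  have "darts (S' - {eo h}) \<subseteq> darts (S - {eo h})" "h \<in> darts S" using * by (auto simp: in_darts)
  then show "\<not> linked (darts (S' - {eo h})) (\<alpha> h) h" using * reach_mono by blast
qed

text \<open>The equality case of \<open>num_components_rank\<close>: an edge lowers the number of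
  components exactly if its ends are not yet joined by the other edges.\<close>

lemma acyc_iff_rank:
  assumes "S \<subseteq> E" shows "acyc S \<longleftrightarrow> num_components M S + card S = card V"
proof
  show "acyc S \<Longrightarrow> num_components M S + card S = card V" using assms
  proof (induction "card S" arbitrary: S)
    case 0
    then show ?case using num_components_empty by (simp add: card_eq_0_iff)
  next
    case (Suc n)
    then obtain e where e: "e \<in> S" by fastforce
    then obtain h where h: "h \<in> H" "e = eo h" using Suc.prems by (meson E_E subsetD)
    have fin: "finite S" using Suc.prems by simp
    have "num_components M (S - {e}) + card (S - {e}) = card V"
      using Suc e fin acyc_subset[of S "S - {e}"] by (intro Suc.hyps) auto
    moreover have "\<not> linked (darts (S - {e})) h (\<alpha> h)"
      using Suc.prems(1) e h reach_darts_sym unfolding acyc_def by (metis in_darts)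
    then have "num_components M (S - {e}) = Suc (num_components M (insert (eo h) (S - {e})))"
      using num_components_insert_diff[OF h(1)] by blast
    moreover have "insert (eo h) (S - {e}) = S" using e h by auto
    moreover have "card S = Suc (card (S - {e}))" using e fin by (metis card_Suc_Diff1)
    ultimately show ?case by simp
  qed
next
  assume eq: "num_components M S + card S = card V"
  show "acyc S" unfolding acyc_def
  proof (rule ballI, rule notI)
    fix h assume h: "h \<in> darts S" "linked (darts (S - {eo h})) (\<alpha> h) h"
    then have "num_components M (insert (eo h) (S - {eo h})) = num_components M (S - {eo h})"
      by (intro num_components_insert_same) (auto simp: in_darts dest: reach_darts_sym)
    moreover have "insert (eo h) (S - {eo h}) = S" using h by (auto simp: in_darts)
    moreover have "card S = Suc (card (S - {eo h}))"
      using h assms by (metis card_Suc_Diff1 finite_subgraph in_darts)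
    moreover have "card V \<le> num_components M (S - {eo h}) + card (S - {eo h})"
      using assms by (intro num_components_rank) auto
    ultimately show False using eq by simp
  qed
qed

text \<open>With the number of edges fixed, an exchange of edges only has to preserve connectivity;
  no cycles need to be inspected.\<close>

lemma span_tree_iff_card: "span_tree M T \<longleftrightarrow> T \<subseteq> E \<and> conn T \<and> Suc (card T) = card V"
  unfolding span_tree_iff using acyc_iff_rank[of T] conn_iff_num_components[of T] by auto

lemma num_components_Diff_acyc:
  assumes "T \<subseteq> E" "acyc T" "A \<subseteq> T"
  shows "num_components M (T - A) = num_components M T + card A"
proof -
  have "acyc (T - A)" using assms(2) by (rule acyc_subset) auto
  then have "num_components M (T - A) + card (T - A) = num_components M T + card T"
    using assms acyc_iff_rank[of T] acyc_iff_rank[of "T - A"] by fastforce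
  moreover have "card T = card (T - A) + card A"
    using assms by (metis card_Diff_subset card_mono finite_subgraph finite_subset le_add_diff_inverse2)
  ultimately show ?thesis by simp
qed

lemma num_components_Un_same:
  assumes "B \<subseteq> E" and "\<And>h. h \<in> darts B \<Longrightarrow> linked (darts S) h (\<alpha> h)"
  shows "num_components M (S \<union> B) = num_components M S"
proof -
  have "reach (darts (S \<union> B)) = reach (darts S)"
  proof (intro equalityI subrelI)
    show "(x, y) \<in> reach (darts S)" if "(x, y) \<in> reach (darts (S \<union> B))" for x y
      using that by (rule reach_subst) (use assms(2) reach_step in \<open>auto simp: in_darts\<close>)
    show "(x, y) \<in> reach (darts (S \<union> B))" if "(x, y) \<in> reach (darts S)" for x y
      using _ that by (rule reach_mono) (auto simp: in_darts)
  qed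
  then show ?thesis unfolding num_components_eq component_def by simp
qed

section \<open>The tour of a spanning tree\<close>

lemma motion_in_H [simp]: "motion M F h \<in> H \<longleftrightarrow> h \<in> H"
  unfolding motion_def by simp

lemma motion_permutes: "motion M F permutes H"
proof (rule bij_imp_permutes)
  have "inj_on (motion M F) H"
  proof (rule inj_onI)
    fix x y assume xy: "x \<in> H" "y \<in> H" "motion M F x = motion M F y"
    \<comment> \<open>The motion is \<sigma> after the involution that swaps the halves of the edges
      in \<open>F\<close>.\<close>
    define g where "g h = (if eo h \<in> F then \<alpha> h else h)" for h
    have "motion M F h = \<sigma> (g h)" for h by (simp add: motion_def g_def)
    then have "g x = g y" using xy(3) permutes_inj[OF perm_\<sigma>] by (simp add: inj_eq)
    moreover have "g (g h) = h" if "h \<in> H" for h using that by (simp add: g_def)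
    ultimately show "x = y" using xy(1,2) by metis
  qed
  moreover have "motion M F ` H \<subseteq> H" by auto
  ultimately show "bij_betw (motion M F) H H"
    using endo_inj_surj[OF finite_H] by (intro bij_betw_imageI) blast+
next
  fix x assume x: "x \<notin> H"
  then have "\<sigma> x = x" "\<alpha> x = x" using perm_\<sigma> perm_\<alpha> by (auto simp: permutes_not_in)
  then show "motion M F x = x" unfolding motion_def by simp
qed

lemma permutation_motion: "permutation (motion M F)"
  using motion_permutes finite_H unfolding permutation_permutes by blast

lemma orbit_motion_refl: "x \<in> orbit (motion M F) x"
  by (rule permutation_self_in_orbit[OF permutation_motion])

lemma orbit_motion_sym: "y \<in> orbit (motion M F) x \<Longrightarrow> x \<in> orbit (motion M F) y"
  by (rule orbit_swap[OF orbit_motion_refl])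

lemma motion_reach:
  assumes "h \<in> H" shows "linked (darts F) h (motion M F h)"
  using assms reach_step[of h "darts F"] by (auto simp: motion_def in_darts)

lemma orbit_motion_reach:
  assumes "h \<in> H" and "y \<in> orbit (motion M F) h"
  shows "y \<in> H \<and> linked (darts F) h y"
  using assms(2)
proof induction
  case base
  then show ?case using assms(1) motion_reach by simp
next
  case (step y)
  then show ?case using motion_reach[of y F] by (auto intro: reach_trans)
qed

text \<open>Adding an edge exchanges the successors of its two half-edges. If it joins two
  components, this splices two cycles of the motion: after \<open>a\<close> comes the old successor
  of \<open>\<alpha> a\<close>, and the old cycle of \<open>\<alpha> a\<close> never meets
  \<open>a\<close>, so it is run through unchanged until it returns to
  \<open>\<alpha> a\<close>.\<close>

lemma merge_orbits:
  assumes a: "a \<in> H" "eo a \<notin> F" and sep: "\<not> linked (darts F) a (\<alpha> a)"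
    and y: "y \<in> orbit (motion M F) (\<alpha> a)"
  shows "y \<in> orbit (motion M (insert (eo a) F)) a"
proof -
  let ?p = "motion M F" and ?p' = "motion M (insert (eo a) F)"
  have pa: "?p' a = ?p (\<alpha> a)" using a by (simp add: motion_def)
  have same: "?p' x = ?p x" if "x \<in> H" "x \<noteq> a" "x \<noteq> \<alpha> a" for x
    using that a eo_eq_iff[of a x] by (simp add: motion_def)
  from y have "y \<in> orbit ?p' a \<and> y \<in> orbit ?p (\<alpha> a)"
  proof induction
    case base
    then show ?case using orbit.base[of ?p' a] pa orbit.base[of ?p] by simp
  next
    case (step y)
    have y: "y \<in> H" "linked (darts F) (\<alpha> a) y"
      using orbit_motion_reach[of "\<alpha> a"] step a by auto
    have "y \<noteq> a" using y(2) sep reach_darts_sym by blast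
    have "?p y \<in> orbit ?p' a"
    proof (cases "y = \<alpha> a")
      case True
      then show ?thesis using orbit.base[of ?p' a] pa by simp
    next
      case False
      then show ?thesis using orbit.step[of y ?p' a] step same[OF y(1) \<open>y \<noteq> a\<close>] by simp
    qed
    then show ?case using step orbit.step by metis
  qed
  then show ?thesis by blast
qed

text \<open>Induction over the edges. Without edges the motion is \<sigma>, whose cycles are the
  vertices; each further edge of a forest joins two components and splices their cycles. For a
  spanning tree the motion is therefore a single cycle.\<close>

lemma motion_orbit:
  assumes "F \<subseteq> E" "acyc F" "x \<in> H" "y \<in> H" "linked (darts F) x y"
  shows "y \<in> orbit (motion M F) x"
  using assms
proof (induction "card F" arbitrary: F x y)
  case 0
  then have F: "F = {}" by (simp add: card_eq_0_iff)
  then have "motion M F = \<sigma>" by (auto simp: motion_def)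
  moreover have "vt x = vt y" using 0 F by (simp add: darts_def reach_def)
  ultimately show ?case unfolding vt_eq_iff by simp
next
  case (Suc n)
  then obtain e where e: "e \<in> F" by fastforce
  then obtain a where a: "a \<in> H" "e = eo a" using Suc.prems by (meson E_E subsetD)
  define F' where "F' = F - {e}"
  have fin: "finite F" using Suc.prems by simp
  have F': "F = insert (eo a) F'" "eo a \<notin> F'" using e a by (auto simp: F'_def)
  have IH: "y \<in> orbit (motion M F') x" if "x \<in> H" "y \<in> H" "linked (darts F') x y" for x y
    using Suc.prems(1,2) Suc.hyps(2) that e fin acyc_subset[of F F']
    by (intro Suc.hyps(1)) (auto simp: F'_def)
  have sep: "\<not> linked (darts F') (\<alpha> a) a"
    using Suc.prems(2) e a unfolding acyc_def F'_def by (metis in_darts)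
  let ?p = "motion M F'" and ?p' = "motion M F"
  have *: "y \<in> orbit ?p' a" if "y \<in> H" "linked (darts F') (\<alpha> a) y" for y
    using merge_orbits[of a F' y] IH[of "\<alpha> a" y] a F' sep reach_darts_sym that by auto
  have **: "y \<in> orbit ?p' (\<alpha> a)" if "y \<in> H" "linked (darts F') a y" for y
    using merge_orbits[of "\<alpha> a" F' y] IH[of a y] a F' sep that by auto
  have ab: "\<alpha> a \<in> orbit ?p' a" using * a by simp
  have from_a: "y \<in> orbit ?p' a"
    if "y \<in> H" "linked (darts F') a y \<or> linked (darts F') (\<alpha> a) y" for y
    using that * ** ab orbit_trans by metis
  show ?case
  proof (cases "linked (darts F') a x \<or> linked (darts F') (\<alpha> a) x")
    case True
    then have "x \<in> orbit ?p' a" using from_a Suc.prems by blast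
    moreover have "linked (darts F') a y \<or> linked (darts F') (\<alpha> a) y"
      using True Suc.prems(5) unfolding F'(1) reach_insert_iff[OF a(1)]
      by (blast intro: reach_trans)
    then have "y \<in> orbit ?p' a" using from_a Suc.prems by blast
    ultimately show ?thesis using orbit_motion_sym orbit_trans by metis
  next
    case False
    then have "\<not> linked (darts F') x a" "\<not> linked (darts F') x (\<alpha> a)"
      using reach_darts_sym by blast+
    then have xy: "linked (darts F') x y"
      using Suc.prems(5) unfolding F'(1) reach_insert_iff[OF a(1)] by blast
    \<comment> \<open>The component of \<open>x\<close> contains neither half of the new edge, so
      the motion is unchanged on it.\<close>
    have same: "?p' z = ?p z" if "z \<in> orbit ?p x" for z
    proof -
      have "z \<noteq> a" "z \<noteq> \<alpha> a"
        using orbit_motion_reach[OF Suc.prems(3) that] False reach_darts_sym by auto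
      then show ?thesis using eo_eq_iff[OF a(1), of z] F' by (simp add: motion_def)
    qed
    have "orbit ?p' x = orbit ?p x" using orbit_motion_refl same by (rule orbit_cong)
    then show ?thesis using IH Suc.prems xy by blast
  qed
qed

end

locale tour = rmap M for M :: "'h rooted_map" +
  fixes T :: "'h set set"
  assumes tree: "span_tree M T"
begin

lemma T_E: "T \<subseteq> E" and T_conn: "conn T" and T_acyc: "acyc T"
  using tree unfolding span_tree_iff by auto

abbreviation "t \<equiv> motion M T"
abbreviation "rk \<equiv> rank M T"
abbreviation "N \<equiv> card H"

section \<open>Positions and ranks along the tour\<close>

definition pos :: "nat \<Rightarrow> 'h" where "pos i = (t ^^ i) h0"

lemma pos_0 [simp]: "pos 0 = h0" and pos_Suc: "pos (Suc i) = t (pos i)"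
  by (simp_all add: pos_def)

lemma pos_in_H [simp]: "pos i \<in> H"
  by (induction i) (simp_all add: pos_Suc)

lemma orbit_root: "orbit t h0 = H"
proof
  show "orbit t h0 \<subseteq> H" using orbit_motion_reach[OF root_in_H] by blast
  show "H \<subseteq> orbit t h0"
    using motion_orbit[OF T_E T_acyc root_in_H] T_conn unfolding conn_def by (simp add: subset_iff)
qed

lemma rk_funpow_dist: "rk h = funpow_dist t h0 h"
  unfolding rank_def funpow_dist_def ..

lemma N_eq: "N = funpow_dist1 t h0 h0"
  and pos_inj: "inj_on pos {0..<N}" and pos_image: "pos ` {0..<N} = H"
proof -
  let ?m = "funpow_dist1 t h0 h0"
  have inj: "inj_on pos {0..<?m}" and img: "pos ` {0..<?m} = H"
    using inj_on_funpow_dist1[OF orbit_motion_refl, of T h0]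
      orbit_conv_funpow_dist1[OF orbit_motion_refl, of T h0] orbit_root
    unfolding pos_def by auto
  show "N = ?m" using card_image[OF inj] img by simp
  then show "inj_on pos {0..<N}" "pos ` {0..<N} = H" using inj img by simp_all
qed

text \<open>The starting point of the reverse tour; it also lets a walk continue from the end of the
  tour to its beginning.\<close>

lemma pos_N [simp]: "pos N = h0"
  unfolding N_eq pos_def by (rule funpow_dist1_prop[OF orbit_motion_refl])

lemma N_pos [simp]: "0 < N"
  unfolding N_eq by simp

lemma pos_rk [simp]: "h \<in> H \<Longrightarrow> pos (rk h) = h"
  unfolding pos_def rk_funpow_dist orbit_root[symmetric] by (rule funpow_dist_prop)

lemma rk_le: "pos i = h \<Longrightarrow> rk h \<le> i"
  unfolding pos_def rank_def by (rule Least_le)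

lemma rk_less_N [simp]: "h \<in> H \<Longrightarrow> rk h < N"
  using pos_image rk_le by (metis atLeastLessThan_iff imageE le_less_trans)

lemma rk_pos [simp]: "i < N \<Longrightarrow> rk (pos i) = i"
  using inj_onD[OF pos_inj pos_rk[OF pos_in_H, of i]] rk_less_N[OF pos_in_H, of i] by simp

lemma pos_eqD: "pos i = h \<Longrightarrow> i < N \<Longrightarrow> rk h = i"
  by auto

lemma rk_eq_iff [simp]: "h \<in> H \<Longrightarrow> h' \<in> H \<Longrightarrow> rk h = rk h' \<longleftrightarrow> h = h'"
  by (metis pos_rk)

definition low :: "'h \<Rightarrow> bool" where "low h \<longleftrightarrow> rk h < rk (\<alpha> h)"

lemma low_\<alpha>: "h \<in> H \<Longrightarrow> low (\<alpha> h) \<longleftrightarrow> \<not> low h"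
  using \<alpha>_neq unfolding low_def by (auto simp: not_less le_less)

lemma low_cases:
  assumes "e \<in> E" obtains h where "h \<in> H" "e = eo h" "low h"
  using assms by (metis E_E \<alpha>_in_H eo_\<alpha> low_\<alpha>)

lemma low_eq: "h \<in> H \<Longrightarrow> low h \<Longrightarrow> low h' \<Longrightarrow> eo h' = eo h \<Longrightarrow> h' = h"
  using eo_eq_iff low_\<alpha> by blast

lemma vt_t: "vt (t h) = (if eo h \<in> T then vt (\<alpha> h) else vt h)"
  by (simp add: motion_def)

text \<open>
  For the first half-edge \<open>k\<close> of an internal edge, \<open>inside k\<close> holds for the half-edges at the
  component of \<open>T - k\<close> that does not contain the root.
\<close>

definition inside :: "'h \<Rightarrow> 'h \<Rightarrow> bool" where
  "inside k h \<longleftrightarrow> rk k < rk h \<and> rk h \<le> rk (\<alpha> k)"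

lemma reach_pos:
  assumes "i \<le> j" and "\<And>m. i \<le> m \<Longrightarrow> m < j \<Longrightarrow> eo (pos m) \<noteq> e"
  shows "linked (darts (T - {e})) (pos i) (pos j)"
  using assms
proof (induction j rule: dec_induct)
  case base
  then show ?case by simp
next
  case (step j)
  then have "linked (darts (T - {e})) (pos i) (pos j)" "eo (pos j) \<noteq> e" by auto
  moreover have "linked (darts (T - {e})) (pos j) (t (pos j))" if "eo (pos j) \<noteq> e"
    using that reach_step[of "pos j" "darts (T - {e})"] by (auto simp: vt_t in_darts)
  ultimately show ?case unfolding pos_Suc by (blast intro: reach_trans)
qed

context
  fixes k assumes k: "k \<in> H" "eo k \<in> T" "low k"
begin

text \<open>As \<open>k\<close> is internal, the position after \<open>k\<close> is at the vertex of
  \<open>\<alpha> k\<close>; from there up to \<open>rk (\<alpha> k)\<close> the tour does not use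
  the edge of \<open>k\<close> and so stays in one component of \<open>T - {eo k}\<close>.\<close>

lemma inside_reach:
  assumes "h \<in> H" "inside k h" shows "linked (darts (T - {eo k})) (\<alpha> k) h"
proof -
  have "linked (darts (T - {eo k})) (pos (Suc (rk k))) (pos (rk h))"
  proof (rule reach_pos)
    show "Suc (rk k) \<le> rk h" using assms by (simp add: inside_def)
    fix m assume m: "Suc (rk k) \<le> m" "m < rk h"
    then have "m < N" using rk_less_N[OF assms(1)] by simp
    then have "pos m \<noteq> k" "pos m \<noteq> \<alpha> k"
      using m assms pos_eqD[of m k] pos_eqD[of m "\<alpha> k"] unfolding inside_def by linarith+
    then show "eo (pos m) \<noteq> eo k" using k by (simp add: eo_eq_iff)
  qed
  then show ?thesis using k assms by (simp add: pos_Suc vt_t)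
qed

lemma not_inside_reach:
  assumes "h \<in> H" "\<not> inside k h" shows "linked (darts (T - {eo k})) k h"
proof -
  have kN: "rk (\<alpha> k) < N" "rk k < rk (\<alpha> k)" using k by (auto simp: low_def)
  \<comment> \<open>After \<open>\<alpha> k\<close> the tour is again at the vertex of
    \<open>k\<close>. The positions up to \<open>k\<close> belong to the same stretch, because it
    runs on through \<open>pos N = h0\<close> to the beginning.\<close>
  have *: "linked (darts (T - {eo k})) k (pos j)" if "rk (\<alpha> k) < j" "j \<le> N" for j
  proof -
    have "linked (darts (T - {eo k})) (pos (Suc (rk (\<alpha> k)))) (pos j)"
    proof (rule reach_pos)
      show "Suc (rk (\<alpha> k)) \<le> j" using that by simp
      fix m assume m: "Suc (rk (\<alpha> k)) \<le> m" "m < j"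
      then have "m < N" using that by simp
      then have "pos m \<noteq> k" "pos m \<noteq> \<alpha> k"
        using m kN pos_eqD[of m k] pos_eqD[of m "\<alpha> k"] by linarith+
      then show "eo (pos m) \<noteq> eo k" using k by (simp add: eo_eq_iff)
    qed
    then show ?thesis using k by (simp add: pos_Suc vt_t)
  qed
  show ?thesis
  proof (cases "rk (\<alpha> k) < rk h")
    case True
    then show ?thesis using *[of "rk h"] assms(1) less_imp_le[OF rk_less_N[OF assms(1)]] by simp
  next
    case False
    then have le: "rk h \<le> rk k" using assms(2) by (simp add: inside_def)
    have "linked (darts (T - {eo k})) (pos 0) (pos (rk h))"
    proof (rule reach_pos)
      fix m assume m: "m < rk h"
      then have "m < N" using rk_less_N[OF assms(1)] by simp
      then have "pos m \<noteq> k" "pos m \<noteq> \<alpha> k"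
        using m kN le pos_eqD[of m k] pos_eqD[of m "\<alpha> k"] by linarith+
      then show "eo (pos m) \<noteq> eo k" using k by (simp add: eo_eq_iff)
    qed simp
    then show ?thesis using *[of N] kN assms(1) by (auto intro: reach_trans)
  qed
qed

lemma inside_iff:
  assumes "h \<in> H" shows "inside k h \<longleftrightarrow> linked (darts (T - {eo k})) (\<alpha> k) h"
proof -
  have "\<not> linked (darts (T - {eo k})) (\<alpha> k) k"
    using acycD[OF T_acyc k(1,2)] .
  then have "\<not> linked (darts (T - {eo k})) (\<alpha> k) h" if "linked (darts (T - {eo k})) k h"
  proof (intro notI)
    assume "linked (darts (T - {eo k})) (\<alpha> k) h"
    from reach_trans[OF this reach_darts_sym[OF that]]
    show False using \<open>\<not> linked (darts (T - {eo k})) (\<alpha> k) k\<close> by contradiction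
  qed
  then show ?thesis using inside_reach[OF assms] not_inside_reach[OF assms] by blast
qed

lemma inside_\<sigma>: "h \<in> H \<Longrightarrow> inside k (\<sigma> h) \<longleftrightarrow> inside k h"
  by (simp add: inside_iff)

lemma inside_\<alpha>: "h \<in> H \<Longrightarrow> eo h \<in> T \<Longrightarrow> eo h \<noteq> eo k \<Longrightarrow> inside k (\<alpha> h) \<longleftrightarrow> inside k h"
proof -
  assume h: "h \<in> H" "eo h \<in> T" "eo h \<noteq> eo k"
  then have step: "linked (darts (T - {eo k})) h (\<alpha> h)"
    by (intro reach_step) (simp add: in_darts)
  have "\<alpha> h \<in> H" using h by simp
  show ?thesis unfolding inside_iff[OF h(1)] inside_iff[OF \<open>\<alpha> h \<in> H\<close>]
    by (rule iffI) (erule reach_trans[OF _ reach_darts_sym[OF step]], erule reach_trans[OF _ step])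
qed

lemma inside_self [simp]: "\<not> inside k k" "inside k (\<alpha> k)"
  using k by (auto simp: inside_def low_def)

text \<open>The number of edges does not change, so only connectivity is at stake: the new edge must
  join the two sides of \<open>k\<close>. If it does not, \<open>inside k\<close> is closed under
  all arcs of the new graph.\<close>

lemma exchange_iff:
  assumes f: "f \<in> H" "eo f \<notin> T"
  shows "span_tree M (insert (eo f) (T - {eo k})) \<longleftrightarrow> inside k f \<noteq> inside k (\<alpha> f)"
proof
  let ?T = "insert (eo f) (T - {eo k})"
  assume cross: "inside k f \<noteq> inside k (\<alpha> f)"
  have sub: "darts (T - {eo k}) \<subseteq> darts ?T" by (auto simp: in_darts)
  have f': "linked (darts ?T) f (\<alpha> f)" using f by (intro reach_step) (simp add: in_darts)
  have "linked (darts ?T) k (\<alpha> k)"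
  proof (cases "inside k f")
    case True
    then have "linked (darts ?T) (\<alpha> k) f" "linked (darts ?T) k (\<alpha> f)"
      using cross f inside_reach[of f] not_inside_reach[of "\<alpha> f"] reach_mono[OF sub] by auto
    then show ?thesis using f' by (blast intro: reach_trans reach_darts_sym)
  next
    case False
    then have "linked (darts ?T) (\<alpha> k) (\<alpha> f)" "linked (darts ?T) k f"
      using cross f inside_reach[of "\<alpha> f"] not_inside_reach[of f] reach_mono[OF sub] by auto
    then show ?thesis using f' by (blast intro: reach_trans reach_darts_sym)
  qed
  then have "linked (darts ?T) k h" if "h \<in> H" for h
    using inside_reach[OF that] not_inside_reach[OF that] reach_mono[OF sub]
    by (blast intro: reach_trans)
  then have "conn ?T" unfolding conn_def by (metis V_E reach_trans reach_darts_sym)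
  moreover have "?T \<subseteq> E" using T_E f by auto
  moreover have "card ?T = card T"
    using f k finite_subgraph[OF T_E] card_Suc_Diff1[of T "eo k"] by (simp del: card_Diff_insert card_Diff_singleton)
  ultimately show "span_tree M ?T" using tree unfolding span_tree_iff_card by simp
next
  let ?T = "insert (eo f) (T - {eo k})"
  assume st: "span_tree M ?T"
  show "inside k f \<noteq> inside k (\<alpha> f)"
  proof
    assume eq: "inside k f = inside k (\<alpha> f)"
    have "linked (darts ?T) (\<alpha> k) k"
      using st k(1) unfolding span_tree_iff conn_def by simp
    then have "inside k k"
    proof (rule reach_closed[where P = "inside k" and X = "darts ?T"])
      fix h assume h: "h \<in> darts ?T" "inside k h"
      then have "h = f \<or> h = \<alpha> f \<or> eo h \<in> T \<and> eo h \<noteq> eo k"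
        using eo_eq_iff[OF f(1), of h] by (auto simp: in_darts)
      then show "inside k (\<alpha> h)" using h eq f inside_\<alpha>[of h] by (auto simp: in_darts)
    qed (use k inside_\<sigma> in simp_all)
    then show False by simp
  qed
qed

end

text \<open>Two positions of the tour are joined by the internal half-edges between them. An edge
  with both halves in the window from \<open>i\<close> to \<open>j\<close> is passed back and forth
  and can be skipped, so \<open>R\<close> only has to account for internal edges with exactly one
  half in the window, in the direction in which the tour passes them. Walks in orientations and
  minors are built from this.\<close>

lemma path:
  assumes "i \<le> j" and "j < N"
    and "\<And>h. h \<in> H \<Longrightarrow> eo h \<in> T \<Longrightarrow> i \<le> rk h \<Longrightarrow> rk h < j \<Longrightarrow> rk (\<alpha> h) < i \<or> j \<le> rk (\<alpha> h) \<Longrightarrow>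
      (vt h, vt (\<alpha> h)) \<in> R\<^sup>*"
  shows "(vt (pos i), vt (pos j)) \<in> R\<^sup>*"
  using assms
proof (induction "j - i" arbitrary: i rule: less_induct)
  case less
  show ?case
  proof (cases "i = j")
    case True
    then show ?thesis by simp
  next
    case False
    then have ij: "i < j" using less.prems by simp
    let ?x = "pos i"
    have x: "rk ?x = i" using ij less.prems by simp
    show ?thesis
    proof (cases "eo ?x \<in> T")
      case ext: False
      have "(vt (pos (Suc i)), vt (pos j)) \<in> R\<^sup>*"
      proof (rule less.hyps)
        fix h assume h: "h \<in> H" "eo h \<in> T" "Suc i \<le> rk h" "rk h < j" "rk (\<alpha> h) < Suc i \<or> j \<le> rk (\<alpha> h)"
        have "\<alpha> h \<noteq> ?x" using ext h(1,2) eo_\<alpha> by metis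
        then have "rk (\<alpha> h) \<noteq> i" using h x by (metis \<alpha>_in_H pos_in_H rk_eq_iff)
        then show "(vt h, vt (\<alpha> h)) \<in> R\<^sup>*" using h by (intro less.prems(3)) auto
      qed (use ij less.prems in auto)
      then show ?thesis using ext by (simp add: pos_Suc vt_t)
    next
      case int: True
      show ?thesis
      proof (cases "i < rk (\<alpha> ?x) \<and> rk (\<alpha> ?x) < j")
        case True
        let ?m = "rk (\<alpha> ?x)"
        have "low ?x" using True x by (simp add: low_def)
        \<comment> \<open>The tour leaves along \<open>?x\<close> and returns along its partner at
          position \<open>?m\<close>, so one step later it is back at the vertex of
          \<open>?x\<close>. No other internal edge has exactly one half in between, hence the
          shorter window cuts no edge that the longer one does not cut.\<close>
        have "(vt (pos (Suc ?m)), vt (pos j)) \<in> R\<^sup>*"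
        proof (rule less.hyps)
          fix h assume h: "h \<in> H" "eo h \<in> T" "Suc ?m \<le> rk h" "rk h < j" "rk (\<alpha> h) < Suc ?m \<or> j \<le> rk (\<alpha> h)"
          have "h \<noteq> ?x" "h \<noteq> \<alpha> ?x" using h x True by auto
          then have "eo h \<noteq> eo ?x" by (simp add: eo_eq_iff)
          then have "inside ?x (\<alpha> h) = inside ?x h"
            using h int \<open>low ?x\<close> by (intro inside_\<alpha>) auto
          moreover have "\<not> inside ?x h" using h by (simp add: inside_def)
          moreover have "rk (\<alpha> h) \<noteq> i" using h x \<open>h \<noteq> \<alpha> ?x\<close> by (metis \<alpha>_\<alpha> \<alpha>_in_H pos_in_H rk_eq_iff)
          ultimately have "rk (\<alpha> h) < i \<or> j \<le> rk (\<alpha> h)" using h(5) x by (auto simp: inside_def)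
          then show "(vt h, vt (\<alpha> h)) \<in> R\<^sup>*" using h True by (intro less.prems(3)) auto
        qed (use True ij less.prems in auto)
        moreover have "vt (pos (Suc ?m)) = vt ?x" using int by (simp add: pos_Suc vt_t)
        ultimately show ?thesis by simp
      next
        case False
        have "rk (\<alpha> ?x) \<noteq> i" using x \<alpha>_neq[OF pos_in_H, of i] by (metis \<alpha>_in_H pos_in_H rk_eq_iff)
        then have cross: "rk (\<alpha> ?x) < i \<or> j \<le> rk (\<alpha> ?x)" using False by auto
        have "(vt (pos (Suc i)), vt (pos j)) \<in> R\<^sup>*"
        proof (rule less.hyps)
          fix h assume h: "h \<in> H" "eo h \<in> T" "Suc i \<le> rk h" "rk h < j" "rk (\<alpha> h) < Suc i \<or> j \<le> rk (\<alpha> h)"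
          have "rk (\<alpha> h) \<noteq> i"
          proof
            assume "rk (\<alpha> h) = i"
            then have "h = \<alpha> ?x" using h x by (metis \<alpha>_\<alpha> \<alpha>_in_H pos_in_H rk_eq_iff)
            then show False using cross h by auto
          qed
          then show "(vt h, vt (\<alpha> h)) \<in> R\<^sup>*" using h by (intro less.prems(3)) auto
        qed (use ij less.prems in auto)
        moreover have "(vt ?x, vt (\<alpha> ?x)) \<in> R\<^sup>*"
          using x int ij cross by (intro less.prems(3)) auto
        ultimately show ?thesis using int by (simp add: pos_Suc vt_t)
      qed
    qed
  qed
qed

lemma path_reach:
  assumes "x \<in> H" "y \<in> H" "rk x \<le> rk y"
    and "\<And>h. h \<in> H \<Longrightarrow> eo h \<in> T \<Longrightarrow> rk x \<le> rk h \<Longrightarrow> rk h < rk y \<Longrightarrow>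
      rk (\<alpha> h) < rk x \<or> rk y \<le> rk (\<alpha> h) \<Longrightarrow> linked X h (\<alpha> h)"
  shows "linked X x y"
  using path[of "rk x" "rk y" "(\<lambda>h. (vt h, vt (\<alpha> h))) ` X"] assms unfolding reach_def by simp

lemma path_reach_rev:
  assumes "x \<in> H" "y \<in> H" "rk x \<le> rk y"
    and "\<And>h. h \<in> H \<Longrightarrow> eo h \<in> T \<Longrightarrow> rk x \<le> rk h \<Longrightarrow> rk h < rk y \<Longrightarrow>
      rk (\<alpha> h) < rk x \<or> rk y \<le> rk (\<alpha> h) \<Longrightarrow> linked X (\<alpha> h) h"
  shows "linked X y x"
  using path[of "rk x" "rk y" "((\<lambda>h. (vt h, vt (\<alpha> h))) ` X)\<inverse>"] assms
  unfolding reach_def by (simp add: rtrancl_converse)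

section \<open>Crossing edges, fundamental cycles and fundamental cocycles\<close>

definition cross :: "'h \<Rightarrow> 'h \<Rightarrow> bool" where
  "cross k f \<longleftrightarrow> rk k < rk f \<and> rk f < rk (\<alpha> k) \<and> rk (\<alpha> k) < rk (\<alpha> f) \<or>
    rk f < rk k \<and> rk k < rk (\<alpha> f) \<and> rk (\<alpha> f) < rk (\<alpha> k)"

text \<open>Links alternation along the tour, which is symmetric in the two edges, with the
  component picture of \<open>exchange_iff\<close>.\<close>

lemma cross_iff_inside:
  assumes "k \<in> H" "low k" "f \<in> H" "low f" "eo f \<noteq> eo k"
  shows "cross k f \<longleftrightarrow> inside k f \<noteq> inside k (\<alpha> f)"
proof -
  have "f \<noteq> k" "f \<noteq> \<alpha> k" using assms(5) eo_eq_iff[OF assms(1), of f] by blast+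
  moreover from this have "\<alpha> f \<noteq> k" "\<alpha> f \<noteq> \<alpha> k" using assms(1,3) \<alpha>_\<alpha> by metis+
  ultimately have "rk f \<noteq> rk k" "rk f \<noteq> rk (\<alpha> k)" "rk (\<alpha> f) \<noteq> rk k" "rk (\<alpha> f) \<noteq> rk (\<alpha> k)"
    using assms by simp_all
  then show ?thesis using assms(2,4) unfolding cross_def inside_def low_def by linarith
qed

lemma not_span_insert: "f \<in> H \<Longrightarrow> eo f \<notin> T \<Longrightarrow> \<not> span_tree M (insert (eo f) T)"
  using tree T_E finite_subgraph[of T] unfolding span_tree_iff_card by auto

lemma not_span_remove: "e \<in> T \<Longrightarrow> \<not> span_tree M (T - {e})"
  using tree T_E finite_subgraph[of T] card_Suc_Diff1[of T e] unfolding span_tree_iff_card by auto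

lemma fund_cocycle_eq:
  assumes k: "k \<in> H" "eo k \<in> T" "low k"
  shows "e \<in> fund_cocycle M T (eo k) \<longleftrightarrow>
    e = eo k \<or> (\<exists>f. f \<in> H \<and> e = eo f \<and> low f \<and> eo f \<notin> T \<and> cross k f)"
proof (cases "e \<in> E - T")
  case False
  then have "e \<in> fund_cocycle M T (eo k) \<longleftrightarrow> e = eo k"
  proof (cases "e \<in> T")
    case True
    then have "insert e (T - {eo k}) = (if e = eo k then T else T - {eo k})" using k by auto
    then show ?thesis using True tree T_E not_span_remove[OF k(2)] unfolding fund_cocycle_def by (auto simp del: set_eq_iff)
  next
    case False
    then show ?thesis using \<open>e \<notin> E - T\<close> k T_E unfolding fund_cocycle_def by blast
  qed
  then show ?thesis using False by auto
next
  case True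
  then obtain f where f: "f \<in> H" "e = eo f" "low f" using low_cases by blast
  moreover have "eo f \<notin> T" "eo f \<noteq> eo k" using True f k by auto
  ultimately have "e \<in> fund_cocycle M T (eo k) \<longleftrightarrow> cross k f"
    using exchange_iff[OF k f(1)] cross_iff_inside[OF k(1,3), of f] True
    unfolding fund_cocycle_def by simp
  moreover have "(\<exists>f'. f' \<in> H \<and> e = eo f' \<and> low f' \<and> eo f' \<notin> T \<and> cross k f') \<longleftrightarrow> cross k f"
    using f \<open>eo f \<notin> T\<close> low_eq[OF f(1,3)] by metis
  ultimately show ?thesis using \<open>eo f \<noteq> eo k\<close> f(2) by blast
qed

lemma fund_cycle_eq:
  assumes f: "f \<in> H" "eo f \<notin> T" "low f"
  shows "e \<in> fund_cycle M T (eo f) \<longleftrightarrow>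
    e = eo f \<or> (\<exists>k. k \<in> H \<and> e = eo k \<and> low k \<and> eo k \<in> T \<and> cross k f)"
proof (cases "e \<in> T")
  case False
  have "insert (eo f) T - {e} = (if e = eo f then T else insert (eo f) T)" using False f by auto
  then have "e \<in> fund_cycle M T (eo f) \<longleftrightarrow> e = eo f"
    using False f tree not_span_insert[OF f(1,2)] unfolding fund_cycle_def by auto
  then show ?thesis using False by auto
next
  case True
  then obtain k where k: "k \<in> H" "e = eo k" "low k" using T_E low_cases by blast
  have *: "insert (eo f) T - {e} = insert (eo f) (T - {eo k})" "eo f \<noteq> eo k" using True f k by auto
  have "e \<in> fund_cycle M T (eo f) \<longleftrightarrow> cross k f"
    using exchange_iff[of k f] cross_iff_inside[of k f] k True f *
    unfolding fund_cycle_def by simp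
  moreover have "(\<exists>k'. k' \<in> H \<and> e = eo k' \<and> low k' \<and> eo k' \<in> T \<and> cross k' f) \<longleftrightarrow> cross k f"
    using k True low_eq[OF k(1,3)] by metis
  ultimately show ?thesis using *(2) k(2) by metis
qed

lemma smallest_half_edge_eo:
  assumes "h \<in> H" "low h" shows "smallest_half_edge M T (eo h) = h"
proof -
  have "arg_min_on rk {h, \<alpha> h} \<in> {h, \<alpha> h}" "\<not> (\<exists>y\<in>{h, \<alpha> h}. rk y < rk (arg_min_on rk {h, \<alpha> h}))"
    using arg_min_if_finite[of "{h, \<alpha> h}" rk] by auto
  then show ?thesis using assms(2) unfolding smallest_half_edge_def edge_of_def low_def by auto
qed

lemma internal_active_iff:
  assumes k: "k \<in> H" "low k"
  shows "eo k \<in> internal_active M T \<longleftrightarrow> eo k \<in> T \<and>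
    (\<forall>f. f \<in> H \<longrightarrow> low f \<longrightarrow> eo f \<notin> T \<longrightarrow> cross k f \<longrightarrow> rk k < rk f)"
proof -
  have "edge_le M T (eo k) (eo f) \<longleftrightarrow> rk k < rk f" if "f \<in> H" "low f" "eo k \<in> T" "eo f \<notin> T" for f
    using that k le_less[of "rk k" "rk f"] by (auto simp: edge_le_def smallest_half_edge_eo)
  moreover have "edge_le M T (eo k) (eo k)" by (simp add: edge_le_def)
  ultimately show ?thesis
    using fund_cocycle_eq[OF k(1) _ k(2)] unfolding internal_active_def by auto
qed

lemma external_active_iff:
  assumes f: "f \<in> H" "low f"
  shows "eo f \<in> external_active M T \<longleftrightarrow> eo f \<notin> T \<and>
    (\<forall>k. k \<in> H \<longrightarrow> low k \<longrightarrow> eo k \<in> T \<longrightarrow> cross k f \<longrightarrow> rk f < rk k)"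
proof -
  have "edge_le M T (eo f) (eo k) \<longleftrightarrow> rk f < rk k" if "k \<in> H" "low k" "eo k \<in> T" "eo f \<notin> T" for k
    using that f le_less[of "rk f" "rk k"] by (auto simp: edge_le_def smallest_half_edge_eo)
  moreover have "edge_le M T (eo f) (eo f)" by (simp add: edge_le_def)
  ultimately show ?thesis
    using fund_cycle_eq[OF f(1) _ f(2)] f unfolding external_active_def by auto
qed

lemma chord_crossing:
  assumes f: "f \<in> H" "low f" "eo f \<notin> T"
    and x: "x \<in> H" "eo x \<in> T" "rk f \<le> rk x" "rk x < rk (\<alpha> f)" "rk (\<alpha> x) < rk f \<or> rk (\<alpha> f) \<le> rk (\<alpha> x)"
  shows "low x \<and> cross x f \<and> rk f < rk x \<or> low (\<alpha> x) \<and> cross (\<alpha> x) f \<and> rk (\<alpha> x) < rk f"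
proof -
  have "x \<noteq> f" "\<alpha> x \<noteq> \<alpha> f" using x(1,2) f eo_\<alpha> by metis+
  then have "rk f < rk x" "rk (\<alpha> f) \<noteq> rk (\<alpha> x)" using x(1,3) f(1) by (auto simp: le_less)
  then show ?thesis using x(1,4,5) by (auto simp: low_def cross_def)
qed

text \<open>The tree path between the ends of an external edge \<open>f\<close>. The internal edges
  with exactly one half between \<open>f\<close> and \<open>\<alpha> f\<close> are those that cross
  \<open>f\<close>; the tour passes the ones that start after \<open>f\<close> at their smaller half
  and the ones that start before \<open>f\<close> at their larger half, which gives the
  directions.\<close>

lemma chord_path:
  assumes f: "f \<in> H" "low f" "eo f \<notin> T"
    and "\<And>k. k \<in> H \<Longrightarrow> low k \<Longrightarrow> eo k \<in> T \<Longrightarrow> cross k f \<Longrightarrow> rk f < rk k \<Longrightarrow> linked X k (\<alpha> k)"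
    and "\<And>k. k \<in> H \<Longrightarrow> low k \<Longrightarrow> eo k \<in> T \<Longrightarrow> cross k f \<Longrightarrow> rk k < rk f \<Longrightarrow> linked X (\<alpha> k) k"
  shows "linked X f (\<alpha> f)"
proof (rule path_reach)
  fix x assume x: "x \<in> H" "eo x \<in> T" "rk f \<le> rk x" "rk x < rk (\<alpha> f)" "rk (\<alpha> x) < rk f \<or> rk (\<alpha> f) \<le> rk (\<alpha> x)"
  then show "linked X x (\<alpha> x)" using chord_crossing[OF f x] assms(4)[of x] assms(5)[of "\<alpha> x"] by auto
qed (use f in \<open>auto simp: low_def\<close>)

lemma chord_path_rev:
  assumes f: "f \<in> H" "low f" "eo f \<notin> T"
    and "\<And>k. k \<in> H \<Longrightarrow> low k \<Longrightarrow> eo k \<in> T \<Longrightarrow> cross k f \<Longrightarrow> rk f < rk k \<Longrightarrow> linked X (\<alpha> k) k"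
    and "\<And>k. k \<in> H \<Longrightarrow> low k \<Longrightarrow> eo k \<in> T \<Longrightarrow> cross k f \<Longrightarrow> rk k < rk f \<Longrightarrow> linked X k (\<alpha> k)"
  shows "linked X (\<alpha> f) f"
proof (rule path_reach_rev)
  fix x assume x: "x \<in> H" "eo x \<in> T" "rk f \<le> rk x" "rk x < rk (\<alpha> f)" "rk (\<alpha> x) < rk f \<or> rk (\<alpha> f) \<le> rk (\<alpha> x)"
  then show "linked X (\<alpha> x) x" using chord_crossing[OF f x] assms(4)[of x] assms(5)[of "\<alpha> x"] by auto
qed (use f in \<open>auto simp: low_def\<close>)

lemma internal_active_sub: "internal_active M T \<subseteq> T"
  and external_active_sub: "external_active M T \<subseteq> E - T"
  unfolding internal_active_def external_active_def by auto

section \<open>Activity and the reverse tour\<close>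

definition act :: "'h set \<Rightarrow> bool" where
  "act e \<longleftrightarrow> e \<in> internal_active M T \<or> e \<in> external_active M T"

text \<open>\<open>top u\<close>: \<open>u\<close> is the half of its edge that a tour in reverse direction meets first.\<close>

definition top :: "'h \<Rightarrow> bool" where "top u \<longleftrightarrow> rk (\<alpha> u) < rk u"

lemma top_iff: "u \<in> H \<Longrightarrow> top u \<longleftrightarrow> low (\<alpha> u)"
  by (simp add: top_def low_def)

text \<open>The larger half \<open>u\<close> marks the moment at which the reverse tour meets the
  edge. If the edge is active, each edge of the other kind that crosses it has its larger half at a
  rank above \<open>rk u\<close>, so \<open>T'\<close> treats it as \<open>T\<close> does: an
  internal edge is then the only way for \<open>T'\<close> to cross its cut, and an external edge
  would close a cycle with the path from \<open>chord_path\<close>.\<close>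

lemma act_iff:
  assumes u: "u \<in> H" "top u"
  shows "act (eo u) \<longleftrightarrow> (\<forall>T'. span_tree M T' \<longrightarrow>
    (\<forall>h\<in>H. rk u < rk h \<longrightarrow> (eo h \<in> T' \<longleftrightarrow> eo h \<in> T)) \<longrightarrow> (eo u \<in> T' \<longleftrightarrow> eo u \<in> T))"
proof
  let ?l = "\<alpha> u"
  have l: "?l \<in> H" "low ?l" "eo ?l = eo u" "\<alpha> ?l = u" using u by (simp_all add: top_iff)
  assume act: "act (eo u)"
  show "\<forall>T'. span_tree M T' \<longrightarrow>
    (\<forall>h\<in>H. rk u < rk h \<longrightarrow> (eo h \<in> T' \<longleftrightarrow> eo h \<in> T)) \<longrightarrow> (eo u \<in> T' \<longleftrightarrow> eo u \<in> T)"
  proof (intro allI impI)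
    fix T' assume T': "span_tree M T'" and agree: "\<forall>h\<in>H. rk u < rk h \<longrightarrow> (eo h \<in> T' \<longleftrightarrow> eo h \<in> T)"
    show "eo u \<in> T' \<longleftrightarrow> eo u \<in> T"
    proof (cases "eo u \<in> T")
      case True
      then have act: "eo ?l \<in> internal_active M T"
        using act l external_active_sub unfolding act_def by auto
      have T: "eo ?l \<in> T" using True l by simp
      have "eo u \<in> T'"
      proof (rule ccontr)
        assume nT': "eo u \<notin> T'"
        have "linked (darts T') (\<alpha> ?l) ?l" using T' l u unfolding span_tree_iff conn_def by simp
        then have "inside ?l ?l"
        proof (rule reach_closed[where P = "inside ?l" and X = "darts T'"])
          show "inside ?l (\<alpha> ?l)" by (rule inside_self(2)[OF l(1) T l(2)])
          show "inside ?l (\<sigma> h) = inside ?l h" if "h \<in> H" for h by (rule inside_\<sigma>[OF l(1) T l(2) that])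
          fix h assume h: "h \<in> darts T'" "inside ?l h"
          show "inside ?l (\<alpha> h)"
          proof (rule ccontr)
            assume no: "\<not> inside ?l (\<alpha> h)"
            have hT': "h \<in> H" "eo h \<in> T'" "eo h \<noteq> eo ?l" using h nT' l by (auto simp: in_darts)
            have "eo h \<notin> T" using inside_\<alpha>[OF l(1) T l(2) hT'(1) _ hT'(3)] no h by blast
            have "h \<noteq> u" "h \<noteq> \<alpha> u" using hT'(3) l by auto
            obtain f where f: "f \<in> H" "low f" "eo f = eo h" "f = h \<or> f = \<alpha> h"
              using hT'(1) low_\<alpha> by (metis \<alpha>_in_H eo_\<alpha>)
            have "\<alpha> f = (if f = h then \<alpha> h else h)" using f(4) hT'(1) by auto
            then have "inside ?l f \<noteq> inside ?l (\<alpha> f)" using f(4) no h(2) by (auto split: if_splits)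
            then have "cross ?l f"
              using cross_iff_inside[OF l(1,2) f(1,2)] f(3) hT'(3) by simp
            moreover from this have "rk ?l < rk f"
              using act internal_active_iff[OF l(1,2)] f \<open>eo h \<notin> T\<close> by auto
            ultimately have "rk u < rk (\<alpha> f)" using l by (auto simp: cross_def)
            then have "eo (\<alpha> f) \<in> T' \<longleftrightarrow> eo (\<alpha> f) \<in> T" using agree f(1) \<alpha>_in_H by blast
            then show False using f hT' \<open>eo h \<notin> T\<close> by simp
          qed
        qed (use l u in auto)
        then show False using inside_self(1)[OF l(1) T l(2)] by blast
      qed
      then show ?thesis using True by simp
    next
      case False
      then have act: "eo ?l \<in> external_active M T"
        using act l internal_active_sub unfolding act_def by auto
      have nT: "eo ?l \<notin> T" using False l by simp
      have "linked (darts (T' - {eo u})) ?l (\<alpha> ?l)"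
      proof (rule chord_path[OF l(1,2) nT])
        fix k assume k: "k \<in> H" "low k" "eo k \<in> T" "cross k ?l" "rk ?l < rk k"
        then have "rk u < rk (\<alpha> k)" using l by (auto simp: cross_def)
        then have "eo (\<alpha> k) \<in> T'" using agree k(1,3) \<alpha>_in_H eo_\<alpha> by metis
        then show "linked (darts (T' - {eo u})) k (\<alpha> k)"
          using k False by (intro reach_step) (auto simp: in_darts)
      next
        fix k assume k: "k \<in> H" "low k" "eo k \<in> T" "cross k ?l" "rk k < rk ?l"
        then show "linked (darts (T' - {eo u})) (\<alpha> k) k"
          using act external_active_iff[OF l(1,2)] by fastforce
      qed
      then have "linked (darts (T' - {eo u})) ?l u" using l by simp
      moreover have "u \<in> darts T' \<Longrightarrow> \<not> linked (darts (T' - {eo u})) ?l u"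
        using T' unfolding span_tree_iff acyc_def by blast
      ultimately show ?thesis using u(1) False by (auto simp: in_darts)
    qed
  qed
next
  let ?l = "\<alpha> u"
  have l: "?l \<in> H" "low ?l" "eo ?l = eo u" "\<alpha> ?l = u" using u by (simp_all add: top_iff)
  assume *: "\<forall>T'. span_tree M T' \<longrightarrow>
    (\<forall>h\<in>H. rk u < rk h \<longrightarrow> (eo h \<in> T' \<longleftrightarrow> eo h \<in> T)) \<longrightarrow> (eo u \<in> T' \<longleftrightarrow> eo u \<in> T)"
  show "act (eo u)"
  proof (rule ccontr)
    assume nact: "\<not> act (eo u)"
    \<comment> \<open>A crossing edge that violates minimality has both halves at ranks below
      \<open>rk u\<close>. Exchanging it with the edge of \<open>u\<close> gives a spanning tree
      that agrees with \<open>T\<close> on all half-edges of larger rank.\<close>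
    obtain e where e: "e \<in> H" "low e" "rk e < rk ?l" "rk (\<alpha> e) < rk u"
      and st: "span_tree M (if eo u \<in> T then insert (eo e) (T - {eo u}) else insert (eo u) (T - {eo e}))"
      and mem: "eo e \<in> T \<longleftrightarrow> eo u \<notin> T"
    proof (cases "eo u \<in> T")
      case True
      then obtain f where f: "f \<in> H" "low f" "eo f \<notin> T" "cross ?l f" "\<not> rk ?l < rk f"
        using nact internal_active_iff[OF l(1,2)] l(3) unfolding act_def by auto
      have "eo f \<noteq> eo ?l" using f(3) True l(3) by auto
      then have "span_tree M (insert (eo f) (T - {eo u}))"
        using exchange_iff[of ?l f] cross_iff_inside[of ?l f] l True f by simp
      then show thesis using that[of f] f l True by (auto simp: cross_def)
    next
      case False
      then obtain k where k: "k \<in> H" "low k" "eo k \<in> T" "cross k ?l" "\<not> rk ?l < rk k"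
        using nact external_active_iff[OF l(1,2)] l(3) unfolding act_def by auto
      have "eo ?l \<noteq> eo k" using k(3) False l(3) by auto
      then have "span_tree M (insert (eo u) (T - {eo k}))"
        using exchange_iff[of k ?l] cross_iff_inside[of k ?l] l False k by simp
      then show thesis using that[of k] k l False by (auto simp: cross_def)
    qed
    have "eo h \<noteq> eo u" "eo h \<noteq> eo e" if "h \<in> H" "rk u < rk h" for h
    proof -
      have "h \<noteq> u" "h \<noteq> \<alpha> u" "h \<noteq> e" "h \<noteq> \<alpha> e" using that e u l by (auto simp: top_def low_def)
      then show "eo h \<noteq> eo u" "eo h \<noteq> eo e" using u e by (simp_all add: eo_eq_iff)
    qed
    then show False using *[rule_format, OF st] mem by (auto split: if_splits)
  qed
qed

end

section \<open>Tree intervals\<close>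

context rmap
begin

text \<open>The reverse tours of the two trees coincide, with the same decisions, as long as they
  are above position \<open>m\<close>. Quantifying over half-edges that are above \<open>m\<close>
  in either tour makes the relation symmetric.\<close>

definition agree :: "'h set set \<Rightarrow> 'h set set \<Rightarrow> nat \<Rightarrow> bool" where
  "agree T T' m \<longleftrightarrow> (\<forall>h\<in>H. m < rank M T h \<or> m < rank M T' h \<longrightarrow>
     rank M T h = rank M T' h \<and> (eo h \<in> T \<longleftrightarrow> eo h \<in> T'))"

lemma tourI: "span_tree M T \<Longrightarrow> tour M T"
  by unfold_locales

lemma agree_sym: "agree T T' m \<Longrightarrow> agree T' T m"
  unfolding agree_def by metis

lemma agree_mono: "agree T T' m \<Longrightarrow> m \<le> m' \<Longrightarrow> agree T T' m'"
  unfolding agree_def by (meson le_less_trans)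

lemma agree_top:
  assumes "span_tree M T" "span_tree M T'" "agree T T' m" "h \<in> H" "m < rank M T h" "tour.top M T h"
  shows "tour.top M T' h"
proof -
  interpret T: tour M T using assms(1) by (rule tourI)
  interpret T': tour M T' using assms(2) by (rule tourI)
  have eq: "rank M T h = rank M T' h" using assms(3-5) unfolding agree_def by blast
  have "\<alpha> h \<in> H" using assms(4) by simp
  then have "m < rank M T' (\<alpha> h) \<longrightarrow> rank M T (\<alpha> h) = rank M T' (\<alpha> h)"
    using assms(3) unfolding agree_def by blast
  then show ?thesis using assms(5,6) eq unfolding T.top_def T'.top_def by (cases "m < rank M T' (\<alpha> h)") auto
qed

text \<open>By \<open>act_iff\<close>, activity depends only on the decisions made up to and
  including the edge itself, and these are shared.\<close>

lemma agree_act: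
  assumes "span_tree M T" "span_tree M T'" "agree T T' m" "h \<in> H" "m < rank M T h" "tour.top M T h"
  shows "tour.act M T (eo h) \<longleftrightarrow> tour.act M T' (eo h)"
proof -
  interpret T: tour M T using assms(1) by (rule tourI)
  interpret T': tour M T' using assms(2) by (rule tourI)
  have eq: "rank M T h = rank M T' h" "eo h \<in> T \<longleftrightarrow> eo h \<in> T'"
    using assms(3-5) unfolding agree_def by blast+
  have "agree T T' (rank M T h)" using agree_mono[OF assms(3)] assms(5) by simp
  then have "(\<forall>x\<in>H. T.rk h < T.rk x \<longrightarrow> (eo x \<in> T'' \<longleftrightarrow> eo x \<in> T)) \<longleftrightarrow>
      (\<forall>x\<in>H. T'.rk h < T'.rk x \<longrightarrow> (eo x \<in> T'' \<longleftrightarrow> eo x \<in> T'))" for T''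
    unfolding agree_def eq(1) by metis
  then show ?thesis
    unfolding T.act_iff[OF assms(4,6)] T'.act_iff[OF assms(4) agree_top[OF assms]] using eq(2) by simp
qed

lemma not_act_agree:
  assumes "span_tree M T" "span_tree M T'" "agree T T' m" "u \<in> H" "rank M T u = m" "tour.top M T u"
    and "(eo u \<in> T) \<noteq> (eo u \<in> T')"
  shows "\<not> tour.act M T (eo u)"
proof -
  interpret T: tour M T using assms(1) by (rule tourI)
  have "\<forall>h\<in>H. T.rk u < T.rk h \<longrightarrow> (eo h \<in> T' \<longleftrightarrow> eo h \<in> T)"
    using assms(3,5) unfolding agree_def by metis
  then show ?thesis using T.act_iff[OF assms(4,6)] assms(2,7) by metis
qed

text \<open>One step of the reverse tour: it meets the edge of \<open>inv \<sigma> y\<close>, whose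
  kind decides on which half the tour stands.\<close>

lemma motion_pred:
  assumes "x \<in> H" "motion M T x = y"
  shows "x = (if eo (inv \<sigma> y) \<in> T then \<alpha> (inv \<sigma> y) else inv \<sigma> y)"
proof -
  have "inv \<sigma> (\<sigma> z) = z" for z using permutes_inverses(2)[OF perm_\<sigma>] .
  then have "inv \<sigma> y = (if eo x \<in> T then \<alpha> x else x)" using assms(2) by (auto simp: motion_def)
  then show ?thesis using assms(1) by (auto split: if_splits)
qed

text \<open>\<open>\<Delta>\<close> may be any set that covers the differences of the two trees; it
  is later enlarged by edges with different orientations. Both tours meet the first edge of
  \<open>\<Delta>\<close> at the same position \<open>m\<close> and through the same
  \<open>g\<close>, the image of the common next position under \<open>inv \<sigma>\<close>; they
  stand on \<open>\<alpha> g\<close> if the edge is internal and on \<open>g\<close> if it is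
  external.\<close>

lemma first_diff:
  assumes span: "span_tree M T" "span_tree M T'"
    and sub: "\<And>e. e \<in> E \<Longrightarrow> e \<notin> \<Delta> \<Longrightarrow> e \<in> T \<longleftrightarrow> e \<in> T'" and "\<exists>e\<in>E. e \<in> \<Delta>"
  obtains g m u u' where "g \<in> H" "eo g \<in> \<Delta>" "agree T T' m"
    "u = (if eo g \<in> T then \<alpha> g else g)" "u' = (if eo g \<in> T' then \<alpha> g else g)"
    "rank M T u = m" "rank M T' u' = m" "tour.top M T u" "tour.top M T' u'"
    "\<forall>h\<in>H. m < rank M T h \<longrightarrow> eo h \<notin> \<Delta>"
proof -
  interpret T: tour M T using span(1) by (rule tourI)
  interpret T': tour M T' using span(2) by (rule tourI)
  let ?I = "{i. i < T.N \<and> eo (T.pos i) \<in> \<Delta>}"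
  define m where "m = Max ?I"
  obtain x where "x \<in> H" "eo x \<in> \<Delta>" using assms(4) E_E by metis
  then have "T.rk x \<in> ?I" by simp
  moreover have fin: "finite ?I" by simp
  ultimately have m: "m < T.N" "eo (T.pos m) \<in> \<Delta>" using Max_in[of ?I] unfolding m_def by blast+
  have after: "eo (T.pos i) \<notin> \<Delta>" if "m < i" "i < T.N" for i
    using that Max_ge[OF fin, of i] unfolding m_def by fastforce
  have pred: "T.pos i = (if eo (inv \<sigma> (T.pos (Suc i))) \<in> T then \<alpha> (inv \<sigma> (T.pos (Suc i))) else inv \<sigma> (T.pos (Suc i)))" for i
    using motion_pred[OF T.pos_in_H T.pos_Suc[symmetric]] .
  have pred': "T'.pos i = (if eo (inv \<sigma> (T'.pos (Suc i))) \<in> T' then \<alpha> (inv \<sigma> (T'.pos (Suc i))) else inv \<sigma> (T'.pos (Suc i)))" for i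
    using motion_pred[OF T'.pos_in_H T'.pos_Suc[symmetric]] .
  have inv_H: "inv \<sigma> (T.pos i) \<in> H" for i
    using permutes_in_image[OF permutes_inv[OF perm_\<sigma>]] by simp
  have eo_pred: "eo (inv \<sigma> (T.pos (Suc i))) = eo (T.pos i)" for i
    using pred[of i] inv_H[of "Suc i"] by (auto split: if_splits)
  \<comment> \<open>The induction runs downwards from position \<open>N\<close>, where both tours
    are at \<open>h0\<close>.\<close>
  have same: "T.pos i = T'.pos i" if "m < i" "i \<le> T.N" for i
    using that(2,1)
  proof (induction i rule: inc_induct)
    case base
    then show ?case by simp
  next
    case (step i)
    then have eq: "T'.pos (Suc i) = T.pos (Suc i)" by simp
    have "eo (T.pos i) \<notin> \<Delta>" using after step by simp
    then have "eo (T.pos i) \<in> T \<longleftrightarrow> eo (T.pos i) \<in> T'" using sub by simp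
    then show ?case using pred[of i] pred'[of i] unfolding eq eo_pred by simp
  qed
  have rk_same: "T.rk h = T'.rk h \<and> eo h \<notin> \<Delta>" if "h \<in> H" "m < T.rk h \<or> m < T'.rk h" for h
    using that(2)
  proof
    assume h: "m < T.rk h"
    then have "T'.pos (T.rk h) = h" using same[of "T.rk h"] that(1) less_imp_le[OF T.rk_less_N[OF that(1)]] by simp
    then have "T'.rk h = T.rk h" using T'.pos_eqD[of "T.rk h" h] that(1) by simp
    moreover have "eo h \<notin> \<Delta>" using after[OF h] that(1) by simp
    ultimately show ?thesis by simp
  next
    assume h: "m < T'.rk h"
    then have "T.pos (T'.rk h) = h" using same[of "T'.rk h"] that(1) less_imp_le[OF T'.rk_less_N[OF that(1)]] by simp
    moreover from this have "T.rk h = T'.rk h" using T.pos_eqD[of "T'.rk h" h] that(1) by simp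
    ultimately show ?thesis using after[OF h] that(1) by simp
  qed
  define g where "g = inv \<sigma> (T.pos (Suc m))"
  have g: "g \<in> H" "eo g \<in> \<Delta>" using inv_H m(2) eo_pred[of m] by (simp_all add: g_def)
  let ?u = "if eo g \<in> T then \<alpha> g else g" and ?u' = "if eo g \<in> T' then \<alpha> g else g"
  have u: "?u = T.pos m" using pred[of m] unfolding g_def by simp
  have "T.pos (Suc m) = T'.pos (Suc m)" using same[of "Suc m"] m(1) by simp
  then have u': "?u' = T'.pos m" using pred'[of m] unfolding g_def by simp
  have rk: "T.rk ?u = m" "T'.rk ?u' = m" unfolding u u' using m(1) by simp_all
  have uH: "?u \<in> H" "?u' \<in> H" "eo (\<alpha> ?u) = eo g" "eo (\<alpha> ?u') = eo g" using g(1) by auto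
  \<comment> \<open>The edge of \<open>g\<close> lies in \<open>\<Delta>\<close>, while all ranks
    above \<open>m\<close> carry edges outside \<open>\<Delta>\<close>. So neither half has been met
    before, and both tours stand on the larger one.\<close>
  have le: "T.rk h \<le> m \<and> T'.rk h \<le> m" if "h \<in> H" "eo h = eo g" for h
    using rk_same[OF that(1)] that(2) g(2) by (auto simp: not_le[symmetric])
  have "T.rk (\<alpha> ?u) \<le> m" "T'.rk (\<alpha> ?u') \<le> m"
    using le[of "\<alpha> ?u"] le[of "\<alpha> ?u'"] uH \<alpha>_in_H by blast+
  moreover have "T.rk (\<alpha> ?u) \<noteq> T.rk ?u" "T'.rk (\<alpha> ?u') \<noteq> T'.rk ?u'"
    using \<alpha>_neq uH(1,2) T.rk_eq_iff T'.rk_eq_iff \<alpha>_in_H by metis+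
  ultimately have "T.top ?u" "T'.top ?u'" unfolding T.top_def T'.top_def rk by linarith+
  moreover have "agree T T' m" unfolding agree_def
  proof (intro ballI impI conjI)
    fix h assume h: "h \<in> H" "m < T.rk h \<or> m < T'.rk h"
    show "T.rk h = T'.rk h" "eo h \<in> T \<longleftrightarrow> eo h \<in> T'"
      using rk_same[OF h] sub[OF eo_in_E[OF h(1)]] by auto
  qed
  ultimately show thesis using that[of g m ?u ?u'] g rk rk_same by blast
qed

section \<open>Existence and uniqueness of the tree of a subgraph\<close>

lemma (in tour) mem_tree_interval_iff:
  "S \<in> tree_interval M T \<longleftrightarrow> S \<subseteq> E \<and> (\<forall>e\<in>E. \<not> act e \<longrightarrow> (e \<in> S \<longleftrightarrow> e \<in> T))"
proof
  assume "S \<in> tree_interval M T"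
  then obtain A B where "S = T - A \<union> B" "A \<subseteq> internal_active M T" "B \<subseteq> external_active M T"
    unfolding tree_interval_def by blast
  then show "S \<subseteq> E \<and> (\<forall>e\<in>E. \<not> act e \<longrightarrow> (e \<in> S \<longleftrightarrow> e \<in> T))"
    using T_E external_active_sub unfolding act_def by blast
next
  assume S: "S \<subseteq> E \<and> (\<forall>e\<in>E. \<not> act e \<longrightarrow> (e \<in> S \<longleftrightarrow> e \<in> T))"
  have "S = T - (T - S) \<union> (S - T)" by blast
  moreover have "T - S \<subseteq> internal_active M T" "S - T \<subseteq> external_active M T"
    using S T_E external_active_sub internal_active_sub unfolding act_def by blast+
  ultimately show "S \<in> tree_interval M T" unfolding tree_interval_def by blast
qed

text \<open>At the first edge where two such trees differ, each tree shows that the other could have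
  decided differently, so the edge is active for neither. But then both trees have to follow
  \<open>S\<close> there.\<close>

lemma tree_interval_unique:
  assumes T: "span_tree M T" "S \<in> tree_interval M T" and T': "span_tree M T'" "S \<in> tree_interval M T'"
  shows "T = T'"
proof (rule ccontr)
  assume "T \<noteq> T'"
  interpret T: tour M T using T(1) by (rule tourI)
  interpret T': tour M T' using T'(1) by (rule tourI)
  define \<Delta> where "\<Delta> = {e. (e \<in> T) \<noteq> (e \<in> T')}"
  have sub: "e \<in> T \<longleftrightarrow> e \<in> T'" if "e \<notin> \<Delta>" for e using that by (simp add: \<Delta>_def)
  have ex: "\<exists>e\<in>E. e \<in> \<Delta>" using \<open>T \<noteq> T'\<close> T.T_E T'.T_E unfolding \<Delta>_def by blast
  obtain g m u u' where *: "g \<in> H" "eo g \<in> \<Delta>" "agree T T' m"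
    "u = (if eo g \<in> T then \<alpha> g else g)" "u' = (if eo g \<in> T' then \<alpha> g else g)"
    "T.rk u = m" "T'.rk u' = m" "T.top u" "T'.top u'" "\<forall>h\<in>H. m < T.rk h \<longrightarrow> eo h \<notin> \<Delta>"
    by (rule first_diff[OF T(1) T'(1) sub ex])
  have u: "u \<in> H" "u' \<in> H" "eo u = eo g" "eo u' = eo g" using *(1,4,5) by auto
  have diff: "(eo g \<in> T) \<noteq> (eo g \<in> T')" using *(2) by (simp add: \<Delta>_def)
  have "\<not> T.act (eo u)"
    using not_act_agree[OF T(1) T'(1) *(3) u(1) *(6,8)] diff u by simp
  moreover have "\<not> T'.act (eo u')"
    using not_act_agree[OF T'(1) T(1) agree_sym[OF *(3)] u(2) *(7,9)] diff u by simp
  ultimately show False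
    using T(2) T'(2) *(1) diff u unfolding T.mem_tree_interval_iff T'.mem_tree_interval_iff using eo_in_E[OF *(1)] by metis
qed

lemma conn_E: "conn E"
proof -
  have inv: "inv \<sigma> h \<in> H" "vt (inv \<sigma> h) = vt h" "inv \<alpha> h = \<alpha> h" if "h \<in> H" for h
  proof -
    show 1: "inv \<sigma> h \<in> H" using permutes_in_image[OF permutes_inv[OF perm_\<sigma>]] that by simp
    show "vt (inv \<sigma> h) = vt h" using vt_\<sigma>[of "inv \<sigma> h"] permutes_inverses(1)[OF perm_\<sigma>] by simp
    show "inv \<alpha> h = \<alpha> h" using permutes_inverses(2)[OF perm_\<alpha>, of "\<alpha> h"] that by simp
  qed
  have \<alpha>: "linked (darts E) h (\<alpha> h)" if "h \<in> H" for h
    using that by (intro reach_step) (simp add: in_darts)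
  have "g h \<in> H \<and> linked (darts E) h (g h)" if "g \<in> perm_group {\<sigma>, \<alpha>}" "h \<in> H" for g h
    using that
  proof (induction g rule: perm_group.induct)
    case one
    then show ?case by simp
  next
    case (gen f g)
    then have *: "g h \<in> H" "linked (darts E) h (g h)" by auto
    show ?case using gen(1) * reach_trans[OF *(2) \<alpha>[OF *(1)]] by auto
  next
    case (gen_inv f g)
    then have *: "g h \<in> H" "linked (darts E) h (g h)" by auto
    show ?case using gen_inv(1) * reach_trans[OF *(2) \<alpha>[OF *(1)]] inv[OF *(1)] by auto
  qed
  then have "linked (darts E) h h'" if "h \<in> H" "h' \<in> H" for h h'
    using transitive[OF that] that by blast
  then show ?thesis unfolding conn_def by (metis V_E)
qed

lemma ex_span_tree: "\<exists>T. span_tree M T"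
proof -
  obtain S where S: "S \<subseteq> E \<and> conn S" "\<And>S'. S' \<subseteq> E \<and> conn S' \<Longrightarrow> card S \<le> card S'"
    using ex_has_least_nat[of "\<lambda>S. S \<subseteq> E \<and> conn S" E card] conn_E by blast
  have "acyc S" unfolding acyc_def
  proof (rule ballI, rule notI)
    fix h assume h: "h \<in> darts S" "linked (darts (S - {eo h})) (\<alpha> h) h"
    then have "num_components M (insert (eo h) (S - {eo h})) = num_components M (S - {eo h})"
      by (intro num_components_insert_same) (auto simp: in_darts dest: reach_darts_sym)
    moreover have "insert (eo h) (S - {eo h}) = S" using h by (auto simp: in_darts)
    ultimately have "conn (S - {eo h})" using S(1) by (simp add: conn_iff_num_components)
    moreover have "card (S - {eo h}) < card S"
      using h S(1) finite_subgraph[of S] by (intro psubset_card_mono) (auto simp: in_darts)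
    ultimately show False using S(1) S(2)[of "S - {eo h}"] by auto
  qed
  then show ?thesis using S(1) unfolding span_tree_iff by blast
qed

lemma tree_interval_exists:
  assumes "S \<subseteq> E" shows "\<exists>T. span_tree M T \<and> S \<in> tree_interval M T"
proof -
  \<comment> \<open>The mistakes of \<open>T\<close>: non-active edges at which \<open>T\<close>
    does not follow \<open>S\<close>, recorded by the half that the reverse tour meets first.
    \<open>mu\<close> measures how early the first mistake occurs; \<open>Suc\<close> keeps the
    value 0 for trees without mistakes.\<close>
  define mist where "mist T = {h \<in> H. tour.top M T h \<and> \<not> tour.act M T (eo h) \<and> (eo h \<in> S) \<noteq> (eo h \<in> T)}" for T
  define mu where "mu T = (if mist T = {} then 0 else Suc (Max (rank M T ` mist T)))" for T
  obtain T where T: "span_tree M T" and least: "\<And>T'. span_tree M T' \<Longrightarrow> mu T \<le> mu T'"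
    using ex_has_least_nat[of "span_tree M" _ mu] ex_span_tree by blast
  interpret T: tour M T using T by (rule tourI)
  have fin: "finite (mist T')" for T' unfolding mist_def by simp
  have "mist T = {}"
  proof (rule ccontr)
    assume ne: "mist T \<noteq> {}"
    define n where "n = Max (T.rk ` mist T)"
    have "n \<in> T.rk ` mist T" unfolding n_def using ne fin by (intro Max_in) auto
    then obtain x where x: "x \<in> mist T" "T.rk x = n" by auto
    have max: "T.rk h \<le> n" if "h \<in> mist T" for h unfolding n_def using that fin by (intro Max_ge) auto
    have xH: "x \<in> H" "T.top x" "\<not> T.act (eo x)" "(eo x \<in> S) \<noteq> (eo x \<in> T)" using x unfolding mist_def by auto
    then obtain T' where T': "span_tree M T'" "\<forall>h\<in>H. T.rk x < T.rk h \<longrightarrow> (eo h \<in> T' \<longleftrightarrow> eo h \<in> T)"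
      "(eo x \<in> T') \<noteq> (eo x \<in> T)" unfolding T.act_iff[OF xH(1,2)] by blast
    interpret T': tour M T' using T'(1) by (rule tourI)
    define \<Delta> where "\<Delta> = {e. (e \<in> T) \<noteq> (e \<in> T')}"
    have sub: "e \<in> T \<longleftrightarrow> e \<in> T'" if "e \<notin> \<Delta>" for e using that by (simp add: \<Delta>_def)
    have ex: "\<exists>e\<in>E. e \<in> \<Delta>" using xH(1) T'(3) unfolding \<Delta>_def by (intro bexI[of _ "eo x"]) auto
    obtain g m u u' where *: "g \<in> H" "eo g \<in> \<Delta>" "agree T T' m"
      "u = (if eo g \<in> T then \<alpha> g else g)" "u' = (if eo g \<in> T' then \<alpha> g else g)"
      "T.rk u = m" "T'.rk u' = m" "T.top u" "T'.top u'" "\<forall>h\<in>H. m < T.rk h \<longrightarrow> eo h \<notin> \<Delta>"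
      by (rule first_diff[OF T T'(1) sub ex])
    have uH: "u \<in> H" "u' \<in> H" "eo u = eo g" "eo u' = eo g" using *(1,4,5) by auto
    \<comment> \<open>The tree \<open>T'\<close> departs from \<open>T\<close> exactly at the first
      mistake, which it corrects. By \<open>agree_top\<close> and \<open>agree_act\<close> no
      mistake arises above it, so all mistakes of \<open>T'\<close> have smaller rank.\<close>
    have "m = n"
    proof (rule antisym)
      have "(eo u \<in> T) \<noteq> (eo u \<in> T')" using *(2) uH by (simp add: \<Delta>_def)
      then show "m \<le> n" using T'(2) uH(1) *(6) x(2) by (metis not_le)
      have "eo x \<in> \<Delta>" using T'(3) by (auto simp: \<Delta>_def)
      then show "n \<le> m" using *(10) xH(1) x(2) by (metis not_le)
    qed
    then have "u = x" using *(6) x(2) uH(1) xH(1) T.rk_eq_iff by blast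
    have "T'.rk h < n" if "h \<in> mist T'" for h
    proof (rule ccontr)
      assume "\<not> T'.rk h < n"
      then consider "n < T'.rk h" | "T'.rk h = n" by linarith
      then show False
      proof cases
        case 1
        have h: "h \<in> H" "T'.top h" "\<not> T'.act (eo h)" "(eo h \<in> S) \<noteq> (eo h \<in> T')" using that unfolding mist_def by auto
        have ag: "agree T' T n" using *(3) \<open>m = n\<close> agree_sym by blast
        have "T.top h" using agree_top[OF T'(1) T ag h(1) 1 h(2)] .
        moreover have "\<not> T.act (eo h)" using agree_act[OF T'(1) T ag h(1) 1 h(2)] h(3) by simp
        moreover have eq: "T'.rk h = T.rk h" "eo h \<in> T' \<longleftrightarrow> eo h \<in> T" using ag h(1) 1 unfolding agree_def by blast+
        ultimately have "h \<in> mist T" using h unfolding mist_def by blast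
        then show False using max 1 eq by fastforce
      next
        case 2
        then have "h = u'" using that *(7) uH(2) \<open>m = n\<close> T'.rk_eq_iff unfolding mist_def by blast
        then have "eo h = eo x" using uH \<open>u = x\<close> by simp
        then show False using that xH(4) T'(3) unfolding mist_def by auto
      qed
    qed
    then have "mu T' \<le> n" using fin[of T'] unfolding mu_def by (auto simp: Suc_le_eq)
    moreover have "mu T = Suc n" using ne unfolding mu_def n_def by simp
    ultimately show False using least[OF T'(1)] by simp
  qed
  then have "e \<in> S \<longleftrightarrow> e \<in> T" if e: "e \<in> E" "\<not> T.act e" for e
  proof -
    obtain l where l: "l \<in> H" "e = eo l" "T.low l" using e(1) T.low_cases by blast
    have "\<alpha> l \<in> H" "T.top (\<alpha> l)" "eo (\<alpha> l) = e" using l by (simp_all add: T.top_iff)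
    moreover have "\<alpha> l \<notin> mist T" using \<open>mist T = {}\<close> by simp
    ultimately show ?thesis using e(2) unfolding mist_def mem_Collect_eq by metis
  qed
  then show ?thesis using T assms T.mem_tree_interval_iff by blast
qed

lemma tree_of_eq: "span_tree M T \<Longrightarrow> S \<in> tree_interval M T \<Longrightarrow> tree_of M S = T"
  unfolding tree_of_def by (rule the_equality) (simp, rule tree_interval_unique, simp_all)

lemma tree_of_span: "S \<subseteq> E \<Longrightarrow> span_tree M (tree_of M S)"
  and tree_of_interval: "S \<subseteq> E \<Longrightarrow> S \<in> tree_interval M (tree_of M S)"
proof -
  assume "S \<subseteq> E"
  then obtain T where T: "span_tree M T" "S \<in> tree_interval M T" using tree_interval_exists by blast
  then have "tree_of M S = T" by (rule tree_of_eq)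
  then show "span_tree M (tree_of M S)" "S \<in> tree_interval M (tree_of M S)" using T by simp_all
qed

section \<open>The orientation of a subgraph\<close>

definition tails :: "('h set \<Rightarrow> 'h \<times> 'h) \<Rightarrow> 'h set" where
  "tails Or = {h \<in> H. Or (eo h) = (h, \<alpha> h)}"

lemma tails_subset: "tails Or \<subseteq> H"
  unfolding tails_def by auto

lemma tails_in_H: "h \<in> tails Or \<Longrightarrow> h \<in> H"
  unfolding tails_def by auto

lemma orientation_cases:
  assumes "Or \<in> orientations M" "h \<in> H"
  shows "Or (eo h) = (h, \<alpha> h) \<or> Or (eo h) = (\<alpha> h, h)"
proof -
  have "Or (eo h) \<in> {(x, \<alpha> x) | x. x \<in> eo h}"
    by (rule PiE_mem[OF assms(1)[unfolded orientations_def] eo_in_E[OF assms(2)]])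
  then obtain x where "Or (eo h) = (x, \<alpha> x)" "x \<in> eo h" by blast
  then show ?thesis using assms(2) unfolding edge_of_def by (elim insertE emptyE) simp_all
qed

lemma tails_\<alpha>: "Or \<in> orientations M \<Longrightarrow> h \<in> H \<Longrightarrow> \<alpha> h \<in> tails Or \<longleftrightarrow> h \<notin> tails Or"
  using orientation_cases[of Or h] \<alpha>_neq[of h] unfolding tails_def by auto

lemma fst_orientation:
  assumes "Or \<in> orientations M" "e \<in> E"
  shows "fst (Or e) \<in> tails Or" "eo (fst (Or e)) = e" "snd (Or e) = \<alpha> (fst (Or e))"
proof -
  obtain h where h: "h \<in> H" "e = eo h" using assms(2) E_E by blast
  then show "fst (Or e) \<in> tails Or" "eo (fst (Or e)) = e" "snd (Or e) = \<alpha> (fst (Or e))"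
    using orientation_cases[OF assms(1) h(1)] by (auto simp: tails_def)
qed

lemma fst_orientation_eo: "h \<in> tails Or \<Longrightarrow> fst (Or (eo h)) = h"
  unfolding tails_def by simp

lemma wf_oriented: assumes "Or \<in> orientations M" shows "wf_digraph (oriented_graph M Or)"
proof (unfold_locales)
  fix e assume "e \<in> arcs (oriented_graph M Or)"
  then have e: "e \<in> E" by (simp add: oriented_graph_def)
  have "fst (Or e) \<in> H" using fst_orientation(1)[OF assms e] by (rule tails_in_H)
  then show "tail (oriented_graph M Or) e \<in> verts (oriented_graph M Or)"
    "head (oriented_graph M Or) e \<in> verts (oriented_graph M Or)"
    by (simp_all add: oriented_graph_def fst_orientation(3)[OF assms e])
qed

lemma oriented_ends:
  assumes "Or \<in> orientations M" "Z \<subseteq> E"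
  shows "(\<lambda>e. (tail (oriented_graph M Or) e, head (oriented_graph M Or) e)) ` Z =
    (\<lambda>h. (vt h, vt (\<alpha> h))) ` (\<lambda>e. fst (Or e)) ` Z"
  unfolding image_image
proof (rule image_cong)
  fix e assume "e \<in> Z"
  then have "snd (Or e) = \<alpha> (fst (Or e))" using assms fst_orientation(3) by blast
  then show "(tail (oriented_graph M Or) e, head (oriented_graph M Or) e) = (vt (fst (Or e)), vt (\<alpha> (fst (Or e))))"
    by (simp add: oriented_graph_def)
qed simp

lemma fst_orientation_image: "Or \<in> orientations M \<Longrightarrow> (\<lambda>e. fst (Or e)) ` E = tails Or"
proof (intro equalityI subsetI)
  fix h assume "h \<in> tails Or"
  then show "h \<in> (\<lambda>e. fst (Or e)) ` E"
    using tails_in_H by (intro image_eqI[of _ _ "eo h"]) (simp_all add: fst_orientation_eo)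
qed (auto intro: fst_orientation(1))

lemma reachable_oriented:
  assumes "Or \<in> orientations M"
  shows "u \<rightarrow>\<^sup>*\<^bsub>oriented_graph M Or\<^esub> w \<longleftrightarrow> u \<in> V \<and> (u, w) \<in> reach (tails Or)"
  using oriented_ends[OF assms order_refl]
  unfolding reachable_conv[OF wf_oriented[OF assms]] fst_orientation_image[OF assms] reach_def arcs_ends_conv
  by (simp add: oriented_graph_def)

lemma root_connected_iff:
  assumes "Or \<in> orientations M"
  shows "root_connected M Or \<longleftrightarrow> (\<forall>h\<in>H. linked (tails Or) h0 h)"
  unfolding root_connected_def reachable_oriented[OF assms]
  by (simp add: root_vertex_def vertices_def)

lemma strongly_connected_iff:
  "Or \<in> orientations M \<Longrightarrow> strongly_connected_or M Or \<longleftrightarrow> (\<forall>h\<in>H. \<forall>h'\<in>H. linked (tails Or) h h')"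
proof -
  assume "Or \<in> orientations M"
  have verts: "verts (oriented_graph M Or) = V" by (simp add: oriented_graph_def)
  have "V \<noteq> {}" using root_in_V by blast
  then show ?thesis
    unfolding strongly_connected_or_def strongly_connected_def reachable_oriented[OF \<open>Or \<in> _\<close>] verts
    by (auto simp: vertices_def)
qed

lemma outdegree_eq_iff:
  assumes "Or \<in> orientations M" "Or' \<in> orientations M"
  shows "outdegree M Or = outdegree M Or' \<longleftrightarrow>
    (\<forall>w\<in>V. card {h \<in> tails Or. vt h = w} = card {h \<in> tails Or'. vt h = w})"
proof -
  have *: "out_degree (oriented_graph M Or) w = card {h \<in> tails Or. vt h = w}" if "Or \<in> orientations M" for Or w
  proof -
    have "inj_on eo {h \<in> tails Or. vt h = w}"
      by (rule inj_on_inverseI[where g = "\<lambda>e. fst (Or e)"]) (simp add: fst_orientation_eo)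
    moreover have "eo ` {h \<in> tails Or. vt h = w} = {e \<in> E. vt (fst (Or e)) = w}"
    proof (intro equalityI subsetI)
      fix e assume "e \<in> {e \<in> E. vt (fst (Or e)) = w}"
      then show "e \<in> eo ` {h \<in> tails Or. vt h = w}"
        using fst_orientation[OF that, of e] by (intro image_eqI[of _ _ "fst (Or e)"]) simp_all
    qed (use fst_orientation_eo tails_in_H in auto)
    moreover have "out_arcs (oriented_graph M Or) w = {e \<in> E. vt (fst (Or e)) = w}"
      by (auto simp: out_arcs_def oriented_graph_def)
    ultimately show ?thesis unfolding out_degree_def using card_image by fastforce
  qed
  show ?thesis unfolding outdegree_def fun_eq_iff restrict_def *[OF assms(1)] *[OF assms(2)]
    by (simp add: Ball_def)
qed

lemma directed_cycle_reach:
  assumes Or: "Or \<in> orientations M" and p: "directed_cycle M Or p" and e: "e \<in> set p"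
  shows "linked ((\<lambda>e. fst (Or e)) ` set p) (\<alpha> (fst (Or e))) (fst (Or e))" "set p \<subseteq> E"
proof -
  let ?G = "oriented_graph M Or"
  interpret wf_digraph ?G by (rule wf_oriented[OF Or])
  obtain u where u: "awalk u p u" using p unfolding directed_cycle_def cycle_def by blast
  have "arcs ?G = E" by (simp add: oriented_graph_def)
  then show sub: "set p \<subseteq> E" using u unfolding awalk_def by simp
  \<comment> \<open>The closed walk is rotated so that it starts after \<open>e\<close>.\<close>
  obtain p1 p2 where split: "p = p1 @ e # p2" using e by (meson split_list)
  then have "awalk (head ?G e) p2 u" "awalk u p1 (tail ?G e)" using u by (auto simp: awalk_Cons_iff)
  then have "awalk (head ?G e) (p2 @ p1) (tail ?G e)" by (rule awalk_appendI)
  then have "(head ?G e, tail ?G e) \<in> ((\<lambda>e. (tail ?G e, head ?G e)) ` set (p2 @ p1))\<^sup>*"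
    by (rule awalk_rtrancl[OF wf_oriented[OF Or]])
  moreover have "(\<lambda>e. (tail ?G e, head ?G e)) ` set (p2 @ p1) \<subseteq> (\<lambda>e. (tail ?G e, head ?G e)) ` set p"
    using split by auto
  ultimately have "(head ?G e, tail ?G e) \<in> ((\<lambda>e. (tail ?G e, head ?G e)) ` set p)\<^sup>*"
    using rtrancl_mono by blast
  then show "linked ((\<lambda>e. fst (Or e)) ` set p) (\<alpha> (fst (Or e))) (fst (Or e))"
    unfolding oriented_ends[OF Or sub] reach_def
    using e sub fst_orientation(3)[OF Or, of e] by (auto simp: oriented_graph_def)
qed

lemma directed_cycleI:
  assumes Or: "Or \<in> orientations M" and h: "h \<in> tails Or" and X: "X \<subseteq> tails Or"
    and r: "linked X (\<alpha> h) h"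
  obtains p where "directed_cycle M Or p" "eo h \<in> set p" "set p \<subseteq> insert (eo h) (eo ` X)"
proof -
  let ?G = "oriented_graph M Or"
  interpret wf_digraph ?G by (rule wf_oriented[OF Or])
  have hH: "h \<in> H" using h by (rule tails_in_H)
  have ends: "tail ?G (eo h) = vt h" "head ?G (eo h) = vt (\<alpha> h)"
    using h by (simp_all add: oriented_graph_def tails_def)
  have sub: "eo ` X \<subseteq> E" using X tails_in_H by force
  have "(\<lambda>e. fst (Or e)) ` eo ` X = X"
    using X fst_orientation_eo by (force simp: image_iff)
  then have "(vt (\<alpha> h), vt h) \<in> ((\<lambda>e. (tail ?G e, head ?G e)) ` eo ` X)\<^sup>*"
    using r unfolding oriented_ends[OF Or sub] reach_def by simp
  moreover have "eo ` X \<subseteq> arcs ?G" "vt (\<alpha> h) \<in> verts ?G" using sub hH by (simp_all add: oriented_graph_def)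
  ultimately obtain p where p: "apath (vt (\<alpha> h)) p (vt h)" "set p \<subseteq> eo ` X"
    using rtrancl_awalk[OF wf_oriented[OF Or], of "eo ` X" "vt (\<alpha> h)" "vt h"] by blast
  have "eo h \<in> arcs ?G" using hH by (simp add: oriented_graph_def)
  then have "awalk (vt h) (eo h # p) (vt h)" "distinct (tl (awalk_verts (vt h) (eo h # p)))"
    using p(1) ends by (auto simp: apath_def awalk_Cons_iff)
  then have "directed_cycle M Or (eo h # p)" unfolding directed_cycle_def cycle_def by blast
  then show thesis using that[of "eo h # p"] p(2) by auto
qed

end

section \<open>Flipped edges, directed cuts and directed cycles of \<open>Phi M S\<close>\<close>

locale tree_int = tour M T for M :: "'h rooted_map" and T :: "'h set set" +
  fixes S :: "'h set set"
  assumes interval: "S \<in> tree_interval M T"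
begin

lemma S_E: "S \<subseteq> E"
  using interval mem_tree_interval_iff by blast

lemma not_act_mem: "e \<in> E \<Longrightarrow> \<not> act e \<Longrightarrow> e \<in> S \<longleftrightarrow> e \<in> T"
  using interval mem_tree_interval_iff by blast

lemma removed_active: "e \<in> T \<Longrightarrow> e \<notin> S \<Longrightarrow> e \<in> internal_active M T"
  using not_act_mem[of e] T_E external_active_sub unfolding act_def by blast

lemma added_active: "e \<in> S \<Longrightarrow> e \<notin> T \<Longrightarrow> e \<in> external_active M T"
  using not_act_mem[of e] S_E internal_active_sub unfolding act_def by blast

lemma tree_of_S: "tree_of M S = T"
  using tree interval by (rule tree_of_eq)

text \<open>The deviation from a default: an unflipped internal edge has its smaller half as tail,
  an unflipped external edge its larger half.\<close>

definition flip :: "'h set \<Rightarrow> bool" where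
  "flip e \<longleftrightarrow> (e \<in> T \<and> fund_cocycle M T e \<inter> ((S - T) \<union> (T - S)) \<noteq> {}) \<or>
    (e \<notin> T \<and> fund_cycle M T e \<inter> ((S - T) \<union> (T - S)) \<noteq> {})"

abbreviation "X \<equiv> tails (Phi M S)"

lemma Phi_eo:
  assumes "h \<in> H" "low h"
  shows "Phi M S (eo h) = (if (eo h \<in> T) \<noteq> flip (eo h) then (h, \<alpha> h) else (\<alpha> h, h))"
  using assms unfolding Phi_def flip_def tree_of_S by (auto simp: Let_def smallest_half_edge_eo)

lemma Phi_orientation: "Phi M S \<in> orientations M"
  unfolding orientations_def
proof (rule PiE_I)
  fix e assume "e \<in> E"
  then obtain h where h: "h \<in> H" "e = eo h" "low h" using low_cases by blast
  then show "Phi M S e \<in> {(h, \<alpha> h) |h. h \<in> e}"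
    using Phi_eo[OF h(1,3)] by (auto simp: edge_of_def)
qed (simp add: Phi_def)

lemma low_tail_iff: "h \<in> H \<Longrightarrow> low h \<Longrightarrow> h \<in> X \<longleftrightarrow> (eo h \<in> T) \<noteq> flip (eo h)"
  using Phi_eo[of h] \<alpha>_neq[of h] unfolding tails_def by auto

lemma X_\<alpha>: "h \<in> H \<Longrightarrow> \<alpha> h \<in> X \<longleftrightarrow> h \<notin> X"
  by (rule tails_\<alpha>[OF Phi_orientation])

lemma flip_internal:
  assumes "k \<in> H" "low k" "eo k \<in> T"
  shows "flip (eo k) \<longleftrightarrow> eo k \<notin> S \<or> (\<exists>b. b \<in> H \<and> low b \<and> eo b \<in> S \<and> eo b \<notin> T \<and> cross k b)"
proof -
  have "flip (eo k) \<longleftrightarrow> (\<exists>e. e \<in> fund_cocycle M T (eo k) \<and> (e \<in> S - T \<or> e \<in> T - S))"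
    unfolding flip_def using assms(3) by blast
  then show ?thesis unfolding fund_cocycle_eq[OF assms(1,3,2)] using assms by blast
qed

lemma flip_external:
  assumes "f \<in> H" "low f" "eo f \<notin> T"
  shows "flip (eo f) \<longleftrightarrow> eo f \<in> S \<or> (\<exists>a. a \<in> H \<and> low a \<and> eo a \<in> T \<and> eo a \<notin> S \<and> cross a f)"
proof -
  have "flip (eo f) \<longleftrightarrow> (\<exists>e. e \<in> fund_cycle M T (eo f) \<and> (e \<in> S - T \<or> e \<in> T - S))"
    unfolding flip_def using assms(3) by blast
  then show ?thesis unfolding fund_cycle_eq[OF assms(1,3,2)] using assms by blast
qed

text \<open>A removed edge is active, hence minimal in its cocycle; this selects one of the two
  alternation patterns. Together with \<open>added_cross\<close> it follows that a removed and an
  added edge never cross.\<close>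

lemma removed_cross:
  assumes "a \<in> H" "low a" "eo a \<in> T" "eo a \<notin> S" "f \<in> H" "low f" "eo f \<notin> T" "cross a f"
  shows "rk a < rk f" "rk f < rk (\<alpha> a)" "rk (\<alpha> a) < rk (\<alpha> f)"
proof -
  have "rk a < rk f" using removed_active[OF assms(3,4)] internal_active_iff[OF assms(1,2)] assms by blast
  then show "rk a < rk f" "rk f < rk (\<alpha> a)" "rk (\<alpha> a) < rk (\<alpha> f)" using assms(8) unfolding cross_def by linarith+
qed

lemma added_cross:
  assumes "b \<in> H" "low b" "eo b \<in> S" "eo b \<notin> T" "k \<in> H" "low k" "eo k \<in> T" "cross k b"
  shows "rk b < rk k" "rk k < rk (\<alpha> b)" "rk (\<alpha> b) < rk (\<alpha> k)"
proof -
  have "rk b < rk k" using added_active[OF assms(3,4)] external_active_iff[OF assms(1,2)] assms by blast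
  then show "rk b < rk k" "rk k < rk (\<alpha> b)" "rk (\<alpha> b) < rk (\<alpha> k)" using assms(8) unfolding cross_def by linarith+
qed

text \<open>All edges of the cocycle are flipped because \<open>a\<close> is removed. So the tail of
  \<open>a\<close> is its larger half, which lies inside, and the tail of an external edge across
  the cut is its smaller half, which lies inside by \<open>removed_cross\<close>.\<close>

lemma removed_cut:
  assumes a: "a \<in> H" "low a" "eo a \<in> T" "eo a \<notin> S" and h: "h \<in> X" "\<not> inside a h"
  shows "\<not> inside a (\<alpha> h)"
proof
  assume ins: "inside a (\<alpha> h)"
  have hH: "h \<in> H" using h(1) by (rule tails_in_H)
  have "a \<notin> X" using low_tail_iff[OF a(1,2)] flip_internal[OF a(1-3)] a by blast
  then have neq: "h \<noteq> a" using h(1) by blast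
  moreover have "h \<noteq> \<alpha> a" using h(2) inside_self(2)[OF a(1,3,2)] by blast
  ultimately have neq: "eo h \<noteq> eo a" using a(1) eo_eq_iff by blast
  then have nT: "eo h \<notin> T" using inside_\<alpha>[OF a(1,3,2) hH] h(2) ins by blast
  show False
  proof (cases "low h")
    case True
    have "cross a h" using cross_iff_inside[OF a(1,2) hH True neq] h(2) ins by blast
    then show False using removed_cross[OF a hH True nT] h(2) ins unfolding inside_def by linarith
  next
    case False
    let ?f = "\<alpha> h"
    have f: "?f \<in> H" "low ?f" "eo ?f \<notin> T" "eo ?f \<noteq> eo a" "\<alpha> ?f = h" using hH False nT neq by (simp_all add: low_\<alpha>)
    have "cross a ?f" using cross_iff_inside[OF a(1,2) f(1,2,4)] h(2) ins f(5) by simp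
    then have "flip (eo ?f)" using flip_external[OF f(1-3)] a by blast
    then have "?f \<in> X" using low_tail_iff[OF f(1,2)] f(3) by blast
    then show False using X_\<alpha>[OF hH] h(1) by blast
  qed
qed

text \<open>The tails on the fundamental cycle of an added edge \<open>b\<close>. All edges on it
  are flipped, so the external edge \<open>b\<close> has its smaller half as tail and the internal
  edges that cross it have their larger ones.\<close>

definition cyc :: "'h \<Rightarrow> 'h set" where
  "cyc b = insert b {\<alpha> k | k. k \<in> H \<and> low k \<and> eo k \<in> T \<and> cross k b}"

lemma cycI: "k \<in> H \<Longrightarrow> low k \<Longrightarrow> eo k \<in> T \<Longrightarrow> cross k b \<Longrightarrow> \<alpha> k \<in> cyc b"
  unfolding cyc_def by blast

lemma cyc_tails:
  assumes b: "b \<in> H" "low b" "eo b \<in> S" "eo b \<notin> T"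
  shows "cyc b \<subseteq> X"
proof -
  have "b \<in> X" using low_tail_iff[OF b(1,2)] flip_external[OF b(1,2,4)] b by blast
  moreover have "\<alpha> k \<in> X" if k: "k \<in> H" "low k" "eo k \<in> T" "cross k b" for k
    using low_tail_iff[OF k(1,2)] flip_internal[OF k(1-3)] b k X_\<alpha>[OF k(1)] by blast
  ultimately show ?thesis unfolding cyc_def by blast
qed

lemma cyc_in_H: "b \<in> H \<Longrightarrow> cyc b \<subseteq> H"
  unfolding cyc_def by auto

text \<open>Closes the cycle without the arc \<open>h\<close> itself, as needed where the edge of
  \<open>h\<close> is left out of a minor.\<close>

lemma cyc_reach:
  assumes b: "b \<in> H" "low b" "eo b \<in> S" "eo b \<notin> T" and h: "h \<in> cyc b"
  shows "linked (cyc b - {h}) (\<alpha> h) h"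
proof (cases "h = b")
  case True
  have "linked (cyc b - {b}) (\<alpha> b) b"
  proof (rule chord_path_rev[OF b(1,2,4)])
    fix k assume k: "k \<in> H" "low k" "eo k \<in> T" "cross k b" "rk b < rk k"
    have "\<alpha> k \<noteq> b" using k(1,3) b(4) eo_\<alpha> by metis
    then show "linked (cyc b - {b}) (\<alpha> k) k"
      using reach_step[of "\<alpha> k" "cyc b - {b}"] cycI[OF k(1-4)] k(1) by simp
  next
    fix k assume "k \<in> H" "low k" "eo k \<in> T" "cross k b" "rk k < rk b"
    then show "linked (cyc b - {b}) k (\<alpha> k)" using added_cross(1)[OF b] by fastforce
  qed
  then show ?thesis using True by simp
next
  case False
  then obtain k where k: "h = \<alpha> k" "k \<in> H" "low k" "eo k \<in> T" "cross k b" using h unfolding cyc_def by blast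
  have rk: "rk b < rk k" "rk k < rk (\<alpha> b)" "rk (\<alpha> b) < rk (\<alpha> k)"
    using added_cross[OF b k(2-5)] by blast+
  \<comment> \<open>The walk goes back along the tour from \<open>k\<close> to \<open>b\<close>,
    over \<open>b\<close>, and back along the tour from \<open>\<alpha> b\<close> to the position
    after \<open>k\<close>, which is at the vertex of \<open>\<alpha> k\<close>. Internal edges
    never cross each other, so an internal edge with one half in such a window has to cross
    \<open>b\<close> and is directed as the cycle requires.\<close>
  have "linked (cyc b - {h}) k b"
  proof (rule path_reach_rev)
    fix x assume x: "x \<in> H" "eo x \<in> T" "rk b \<le> rk x" "rk x < rk k" "rk (\<alpha> x) < rk b \<or> rk k \<le> rk (\<alpha> x)"
    have "x \<noteq> k" "x \<noteq> \<alpha> k" using x(4) k(3) by (auto simp: low_def)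
    then have neq: "x \<noteq> b" "\<alpha> x \<noteq> b" "eo k \<noteq> eo x" "\<alpha> x \<noteq> k"
      using x(1,2) b eo_\<alpha> k(2) eo_eq_iff[of x k] \<alpha>_\<alpha> by metis+
    have rkx: "rk b < rk x" using x(1,3) b(1) neq by (auto simp: le_less)
    have "\<not> rk (\<alpha> x) < rk b"
    proof
      assume lt: "rk (\<alpha> x) < rk b"
      then have "low (\<alpha> x)" "cross (\<alpha> x) b" using x rkx rk by (auto simp: low_def cross_def)
      then have "rk b < rk (\<alpha> x)" using added_cross(1)[OF b, of "\<alpha> x"] x by simp
      then show False using lt by simp
    qed
    then have "rk k < rk (\<alpha> x)" using x(1,5) neq(4) k(2) by (auto simp: le_less)
    then have lowx: "low x" and "inside x k" using x(4) by (auto simp: low_def inside_def)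
    then have "inside x (\<alpha> k)" using inside_\<alpha>[OF x(1,2) lowx k(2,4) neq(3)] by blast
    then have "cross x b" using rk rkx x(4) by (auto simp: cross_def inside_def)
    then have "\<alpha> x \<in> cyc b" using x lowx unfolding cyc_def by blast
    moreover have "\<alpha> x \<noteq> h" using k \<open>x \<noteq> k\<close> x(1) by (metis \<alpha>_\<alpha>)
    ultimately show "linked (cyc b - {h}) (\<alpha> x) x"
      using reach_step[of "\<alpha> x" "cyc b - {h}"] x(1) by simp
  qed (use b k rk in auto)
  also have "linked (cyc b - {h}) b (\<alpha> b)"
    using False by (intro reach_step) (simp add: cyc_def)
  also have "linked (cyc b - {h}) (\<alpha> b) (pos (Suc (rk k)))"
  proof (rule path_reach_rev)
    have "rk (\<alpha> b) < N" using b(1) by simp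
    then have Sk: "Suc (rk k) < N" using rk by linarith
    then show "rk (pos (Suc (rk k))) \<le> rk (\<alpha> b)" using rk by simp
    fix x assume x: "x \<in> H" "eo x \<in> T" "rk (pos (Suc (rk k))) \<le> rk x" "rk x < rk (\<alpha> b)"
      "rk (\<alpha> x) < rk (pos (Suc (rk k))) \<or> rk (\<alpha> b) \<le> rk (\<alpha> x)"
    have rkx: "rk k < rk x" "rk (\<alpha> x) \<le> rk k \<or> rk (\<alpha> b) \<le> rk (\<alpha> x)" using x(3,5) Sk by auto
    have "inside k x" using rk rkx x(4) by (simp add: inside_def)
    moreover have "x \<noteq> k" "x \<noteq> \<alpha> k" using rkx x(4) rk by auto
    then have "eo x \<noteq> eo k" using k(2) by (simp add: eo_eq_iff)
    ultimately have "inside k (\<alpha> x)" using inside_\<alpha>[OF k(2,4,3) x(1,2)] by blast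
    then have "rk (\<alpha> b) \<le> rk (\<alpha> x)" using rkx(2) by (auto simp: inside_def)
    moreover have "\<alpha> b \<noteq> \<alpha> x" using x(1,2) b eo_\<alpha> by metis
    ultimately have "rk (\<alpha> b) < rk (\<alpha> x)" using x(1) b(1) by (auto simp: le_less)
    then have "low x" "cross x b" using x(4) rk rkx by (auto simp: low_def cross_def)
    then have "\<alpha> x \<in> cyc b" using x unfolding cyc_def by blast
    moreover have "\<alpha> x \<noteq> h" using k \<open>x \<noteq> k\<close> x(1) by (metis \<alpha>_\<alpha>)
    ultimately show "linked (cyc b - {h}) (\<alpha> x) x"
      using reach_step[of "\<alpha> x" "cyc b - {h}"] x(1) by simp
  qed (use b in auto)
  finally show ?thesis using k by (simp add: pos_Suc vt_t)
qed

definition above :: "'h \<Rightarrow> 'h set" where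
  "above u = {h \<in> H. rk u < rk h \<or> rk u < rk (\<alpha> h)}"

text \<open>
  The darts of the minor at the moment the reverse tour meets \<open>u\<close>: the edges decided earlier have
  been contracted (if internal) or deleted (if external), and the edge of \<open>u\<close> itself is left out.
\<close>

definition minor :: "'h \<Rightarrow> 'h set" where
  "minor u = {h \<in> X. h \<notin> above u \<and> eo h \<noteq> eo u} \<union> (above u \<inter> darts T)"

section \<open>Reachability in the minors\<close>

lemma minor_H: "minor u \<subseteq> H"
  using tails_subset unfolding minor_def above_def by blast

lemma low_below:
  assumes "u \<in> H" "h \<in> H" "h \<notin> above u" "eo h \<noteq> eo u"
  shows "rk h < rk u" "rk (\<alpha> h) < rk u"
proof -
  have "h \<noteq> u" "\<alpha> h \<noteq> u" using assms(1,2,4) eo_\<alpha> by metis+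
  then have "rk h \<noteq> rk u" "rk (\<alpha> h) \<noteq> rk u" using assms(1,2) by simp_all
  then show "rk h < rk u" "rk (\<alpha> h) < rk u" using assms(2,3) unfolding above_def by auto
qed

lemma above_neq: "u \<in> H \<Longrightarrow> top u \<Longrightarrow> h \<in> above u \<Longrightarrow> eo h \<noteq> eo u"
  using eo_eq_iff[of u h] unfolding above_def top_def by auto

text \<open>If \<open>b\<close> is undecided at \<open>u\<close>, its cycle survives in the minor,
  apart from the edge of \<open>u\<close>: the other edges are internal, hence directed as in the
  cycle if undecided and contracted if decided.\<close>

lemma cyc_minor:
  assumes b: "b \<in> H" "low b" "eo b \<in> S" "eo b \<notin> T" and u: "u \<in> H" "rk (\<alpha> b) < rk u"
    and h: "h \<in> cyc b" "h \<noteq> u" "eo h \<in> T \<Longrightarrow> h \<noteq> \<alpha> u"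
  shows "h \<in> minor u"
proof (cases "h = b")
  case True
  have "rk b < rk u" using b(2) u(2) by (simp add: low_def)
  then have "h \<notin> above u" "h \<noteq> \<alpha> u" using True u by (auto simp: above_def)
  then have "eo h \<noteq> eo u" using h(2) u(1) eo_eq_iff by blast
  then show ?thesis using True cyc_tails[OF b] h(1) \<open>h \<notin> above u\<close> unfolding minor_def by blast
next
  case False
  then obtain k where k: "h = \<alpha> k" "k \<in> H" "low k" "eo k \<in> T" "cross k b" using h(1) unfolding cyc_def by blast
  then have hT: "h \<in> H" "eo h \<in> T" by simp_all
  then have neq: "eo h \<noteq> eo u" using h(2,3) u(1) eo_eq_iff by blast
  show ?thesis using hT neq cyc_tails[OF b] h(1) unfolding minor_def by (auto simp: in_darts)
qed

text \<open>With \<open>g\<close> for \<open>if eo u \<in> T then \<alpha> u else u\<close>, this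
  lemma and its three companions tell whether the minor leads from \<open>g\<close> to the other end
  of the edge. Unflipped: no for internal and yes for external edges. Flipped and not active: the
  other way round.\<close>

lemma minor_internal_unflipped:
  assumes u: "u \<in> H" "top u" "eo u \<in> T" "\<not> flip (eo u)"
  shows "\<not> linked (minor u) (\<alpha> u) u"
proof
  assume r: "linked (minor u) (\<alpha> u) u"
  let ?l = "\<alpha> u"
  have l: "?l \<in> H" "low ?l" "eo ?l = eo u" "\<alpha> ?l = u" "eo ?l \<in> T" using u by (simp_all add: top_iff)
  have uS: "eo u \<in> S" and nob: "\<not> (b \<in> H \<and> low b \<and> eo b \<in> S \<and> eo b \<notin> T \<and> cross ?l b)" for b
    using flip_internal[OF l(1,2,5)] u(4) l(3) by auto
  \<comment> \<open>The side of \<open>?l\<close> may be entered by an undecided flipped external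
    edge. Such an edge crosses a removed undecided edge \<open>a\<close> and starts inside it, so
    the insides of these \<open>a\<close> are excluded as well: by \<open>removed_cut\<close> no
    oriented arc enters them, and no contracted edge crosses their border.\<close>
  define A where "A = {a \<in> H. low a \<and> eo a \<in> T \<and> eo a \<notin> S \<and> rk (\<alpha> a) < rk u}"
  define P where "P h \<longleftrightarrow> \<not> inside ?l h \<and> (\<forall>a\<in>A. \<not> inside a h)" for h
  have A: "a \<in> H" "low a" "eo a \<in> T" "eo a \<notin> S" "rk (\<alpha> a) < rk u" "eo a \<noteq> eo u" if "a \<in> A" for a
    using that uS unfolding A_def by auto
  have "P u"
  proof (rule reach_closed[OF r])
    have "\<not> inside a ?l" if a: "a \<in> A" for a
    proof -
      have "\<not> inside a u" using A(5)[OF a] by (simp add: inside_def)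
      then show ?thesis using inside_\<alpha>[OF A(1,3,2)[OF a] u(1,3)] A(6)[OF a] by simp
    qed
    then show "P ?l" using inside_self(1)[OF l(1,5,2)] unfolding P_def by blast
    show "P (\<sigma> h) = P h" if "h \<in> H" for h
      using inside_\<sigma>[OF l(1,5,2) that] inside_\<sigma>[OF A(1,3,2) that] unfolding P_def by blast
    fix h assume h: "h \<in> minor u" "P h"
    then have hH: "h \<in> H" using minor_H by blast
    show "P (\<alpha> h)"
    proof (cases "h \<in> above u")
      case True
      then have hT: "eo h \<in> T" "eo h \<noteq> eo u"
        using h(1) above_neq[OF u(1,2)] unfolding minor_def by (auto simp: in_darts)
      have "inside a (\<alpha> h) = inside a h" if a: "a \<in> A" for a
      proof (rule inside_\<alpha>[OF A(1,3,2)[OF a] hH hT(1)])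
        have "h \<noteq> a" "h \<noteq> \<alpha> a" using True A(1,2,5)[OF a] by (auto simp: above_def low_def)
        then show "eo h \<noteq> eo a" using A(1)[OF a] eo_eq_iff by blast
      qed
      then show ?thesis using h(2) inside_\<alpha>[OF l(1,5,2) hH hT(1)] hT(2) l(3) unfolding P_def by simp
    next
      case False
      then have hX: "h \<in> X" "eo h \<noteq> eo u" using h(1) unfolding minor_def by auto
      have "\<not> inside ?l (\<alpha> h)"
      proof
        assume ins: "inside ?l (\<alpha> h)"
        have nins: "\<not> inside ?l h" "\<And>a. a \<in> A \<Longrightarrow> \<not> inside a h" using h(2) unfolding P_def by auto
        have lt: "rk h < rk u" "rk (\<alpha> h) < rk u" using low_below[OF u(1) hH False hX(2)] .
        have "eo h \<notin> T" using inside_\<alpha>[OF l(1,5,2) hH] ins nins(1) hX(2) l(3) by auto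
        have "rk h < rk (\<alpha> h)" using ins nins(1) lt l(4) by (auto simp: inside_def)
        then have lowh: "low h" by (simp add: low_def)
        have crl: "cross ?l h" using cross_iff_inside[OF l(1,2) hH lowh] ins nins(1) hX(2) l(3) by simp
        have "flip (eo h)" using low_tail_iff[OF hH lowh] hX(1) \<open>eo h \<notin> T\<close> by blast
        moreover have "eo h \<notin> S" using nob[of h] hH lowh \<open>eo h \<notin> T\<close> crl by blast
        ultimately obtain a where a: "a \<in> H" "low a" "eo a \<in> T" "eo a \<notin> S" "cross a h"
          using flip_external[OF hH lowh \<open>eo h \<notin> T\<close>] by blast
        have cr: "rk a < rk h" "rk h < rk (\<alpha> a)" "rk (\<alpha> a) < rk (\<alpha> h)"
          using removed_cross[OF a(1-4) hH lowh \<open>eo h \<notin> T\<close> a(5)] .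
        then have "a \<in> A" "inside a h" using a lt unfolding A_def inside_def by auto
        then show False using nins(2) by blast
      qed
      moreover have "\<not> inside a (\<alpha> h)" if a: "a \<in> A" for a
        using removed_cut[OF A(1-4)[OF a] hX(1)] h(2) a unfolding P_def by blast
      ultimately show ?thesis unfolding P_def by blast
    qed
  qed (use u l minor_H in auto)
  then show False using inside_self(2)[OF l(1,5,2)] l(4) unfolding P_def by simp
qed

text \<open>A non-active edge follows \<open>S\<close>, so the flip is due to an added
  \<open>b\<close> that crosses it. The directed cycle of \<open>b\<close> runs through
  \<open>u\<close>, and \<open>rk (\<alpha> b) < rk u\<close> puts it into the minor.\<close>

lemma minor_internal_flipped:
  assumes u: "u \<in> H" "top u" "eo u \<in> T" "flip (eo u)" "\<not> act (eo u)"
  shows "linked (minor u) (\<alpha> u) u"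
proof -
  let ?l = "\<alpha> u"
  have l: "?l \<in> H" "low ?l" "eo ?l = eo u" "\<alpha> ?l = u" "eo ?l \<in> T" using u by (simp_all add: top_iff)
  have "eo u \<in> S" using not_act_mem[of "eo u"] u by simp
  then obtain b where b: "b \<in> H" "low b" "eo b \<in> S" "eo b \<notin> T" "cross ?l b"
    using flip_internal[OF l(1,2,5)] u(4) l(3) by auto
  have cr: "rk b < rk ?l" "rk ?l < rk (\<alpha> b)" "rk (\<alpha> b) < rk u"
    using added_cross[OF b(1-4) l(1,2,5) b(5)] l(4) by simp_all
  have "\<alpha> ?l \<in> cyc b" by (rule cycI[OF l(1,2,5) b(5)])
  then have "u \<in> cyc b" using l(4) by simp
  then have "linked (cyc b - {u}) ?l u" using cyc_reach[OF b(1-4)] by blast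
  moreover have "cyc b - {u} \<subseteq> minor u"
  proof
    fix h assume h: "h \<in> cyc b - {u}"
    have "h \<noteq> ?l" if "eo h \<in> T"
    proof
      assume hl: "h = ?l"
      then have "h \<noteq> b" using b(4) that by blast
      then obtain k where k: "h = \<alpha> k" "low k" "k \<in> H" using h unfolding cyc_def by blast
      then have "low (\<alpha> k)" using hl l(2) by simp
      then show False using low_\<alpha>[OF k(3)] k(2) by simp
    qed
    then show "h \<in> minor u" using cyc_minor[OF b(1-4) u(1) cr(3)] h by blast
  qed
  ultimately show ?thesis using reach_mono by blast
qed

text \<open>A kept tree edge can be passed away from the root, either by itself or along the rest of
  a directed cycle through it.\<close>

lemma tree_down:
  assumes k: "k \<in> H" "low k" "eo k \<in> T" "eo k \<in> S"
  obtains "k \<in> X" | b where "b \<in> H" "low b" "eo b \<in> S" "eo b \<notin> T" "\<alpha> k \<in> cyc b"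
    "rk b < rk k" "rk k < rk (\<alpha> b)" "rk (\<alpha> b) < rk (\<alpha> k)" "linked (cyc b - {\<alpha> k}) k (\<alpha> k)"
proof (cases "k \<in> X")
  case False
  then have "flip (eo k)" using low_tail_iff[OF k(1,2)] k(3) by blast
  then obtain b where b: "b \<in> H" "low b" "eo b \<in> S" "eo b \<notin> T" "cross k b"
    using flip_internal[OF k(1-3)] k(4) by blast
  have "\<alpha> k \<in> cyc b" using k b unfolding cyc_def by blast
  moreover from this have "linked (cyc b - {\<alpha> k}) k (\<alpha> k)"
    using cyc_reach[OF b(1-4)] k(1) by fastforce
  ultimately show thesis using that(2) b added_cross[OF b(1-4) k(1-3) b(5)] by blast
qed (use that in blast)

text \<open>The tree path between the ends is available: its edges that start after
  \<open>\<alpha> u\<close> have been contracted, and those that start before it are kept, as no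
  removed edge crosses an unflipped external one, so \<open>tree_down\<close> applies.\<close>

lemma minor_external_unflipped:
  assumes u: "u \<in> H" "top u" "eo u \<notin> T" "\<not> flip (eo u)"
  shows "linked (minor u) u (\<alpha> u)"
proof -
  let ?l = "\<alpha> u"
  have l: "?l \<in> H" "low ?l" "eo ?l = eo u" "\<alpha> ?l = u" "eo ?l \<notin> T" using u by (simp_all add: top_iff)
  have uS: "eo u \<notin> S" and noa: "\<not> (a \<in> H \<and> low a \<and> eo a \<in> T \<and> eo a \<notin> S \<and> cross a ?l)" for a
    using flip_external[OF l(1,2,5)] u(4) l(3) by auto
  have "linked (minor u) (\<alpha> ?l) ?l"
  proof (rule chord_path_rev[OF l(1,2,5)])
    fix k assume k: "k \<in> H" "low k" "eo k \<in> T" "cross k ?l" "rk ?l < rk k"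
    then have "\<alpha> k \<in> minor u" using l(4) unfolding minor_def above_def cross_def by (auto simp: in_darts)
    then show "linked (minor u) (\<alpha> k) k" using reach_step[of "\<alpha> k"] k(1) by simp
  next
    fix k assume k: "k \<in> H" "low k" "eo k \<in> T" "cross k ?l" "rk k < rk ?l"
    have rk: "rk ?l < rk (\<alpha> k)" "rk (\<alpha> k) < rk u" using k(4,5) l(4) by (auto simp: cross_def)
    have kS: "eo k \<in> S" using noa[of k] k by blast
    from k(1-3) kS show "linked (minor u) k (\<alpha> k)"
    proof (cases rule: tree_down)
      case 1
      moreover have "k \<notin> above u" "eo k \<noteq> eo u" using k rk u(3) by (auto simp: above_def)
      ultimately show ?thesis unfolding minor_def by (intro reach_step) simp
    next
      case (2 b)
      have "rk (\<alpha> b) < rk u" using 2(8) rk by simp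
      moreover have "h \<noteq> u" "eo h \<in> T \<Longrightarrow> h \<noteq> \<alpha> u" if "h \<in> cyc b" for h
      proof -
        have "eo h \<in> S \<or> eo h \<in> T" using that 2(3) unfolding cyc_def by auto
        then show "h \<noteq> u" using uS u(3) by blast
        show "eo h \<in> T \<Longrightarrow> h \<noteq> \<alpha> u" using l(5) by blast
      qed
      ultimately have "cyc b \<subseteq> minor u" using cyc_minor[OF 2(1-4) u(1)] by blast
      then show ?thesis using 2(9) reach_mono by blast
    qed
  qed
  then show ?thesis using l(4) by simp
qed

text \<open>The flip is due to a removed \<open>a\<close> across the edge. As
  \<open>rk (\<alpha> a) < rk u\<close>, it is not contracted, and its directed cut cannot be
  entered: \<open>u\<close> lies outside and \<open>\<alpha> u\<close> inside.\<close>

lemma minor_external_flipped: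
  assumes u: "u \<in> H" "top u" "eo u \<notin> T" "flip (eo u)" "\<not> act (eo u)"
  shows "\<not> linked (minor u) u (\<alpha> u)"
proof
  assume r: "linked (minor u) u (\<alpha> u)"
  let ?l = "\<alpha> u"
  have l: "?l \<in> H" "low ?l" "eo ?l = eo u" "\<alpha> ?l = u" "eo ?l \<notin> T" using u by (simp_all add: top_iff)
  have "eo u \<notin> S" using not_act_mem[of "eo u"] u by simp
  then obtain a where a: "a \<in> H" "low a" "eo a \<in> T" "eo a \<notin> S" "cross a ?l"
    using flip_external[OF l(1,2,5)] u(4) l(3) by auto
  have cr: "rk a < rk ?l" "rk ?l < rk (\<alpha> a)" "rk (\<alpha> a) < rk u"
    using removed_cross[OF a(1-4) l(1,2,5) a(5)] l(4) by simp_all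
  have "\<not> inside a ?l"
  proof (rule reach_closed[OF r, where P = "\<lambda>h. \<not> inside a h"])
    show "\<not> inside a u" using cr by (simp add: inside_def)
    fix h assume h: "h \<in> minor u" "\<not> inside a h"
    show "\<not> inside a (\<alpha> h)"
    proof (cases "h \<in> above u")
      case True
      then have hT: "h \<in> H" "eo h \<in> T" using h(1) unfolding minor_def by (auto simp: above_def in_darts)
      have "h \<noteq> a" "h \<noteq> \<alpha> a" using True a(1,2) cr by (auto simp: above_def)
      then have "eo h \<noteq> eo a" using a(1) eo_eq_iff by blast
      then show ?thesis using inside_\<alpha>[OF a(1,3,2) hT] h(2) by blast
    next
      case False
      then have "h \<in> X" using h(1) unfolding minor_def by blast
      then show ?thesis using removed_cut[OF a(1-4)] h(2) by blast
    qed
  qed (use u l minor_H inside_\<sigma>[OF a(1,3,2)] in auto)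
  then show False using cr by (simp add: inside_def)
qed

text \<open>Read at this half-edge, the orientation shows the flip and nothing about whether the
  edge is internal. It is the \<open>g\<close> of \<open>first_diff\<close>, the same for two tours
  that decide differently.\<close>

lemma top_tail_iff:
  assumes u: "u \<in> H" "top u"
  shows "(if eo u \<in> T then \<alpha> u else u) \<in> X \<longleftrightarrow> \<not> flip (eo u)"
proof -
  have l: "\<alpha> u \<in> H" "low (\<alpha> u)" "eo (\<alpha> u) = eo u" using u by (simp_all add: top_iff)
  show ?thesis using low_tail_iff[OF l(1,2)] X_\<alpha>[OF u(1)] l(3) by auto
qed

section \<open>Root-connected and strongly connected orientations\<close>

lemma ex_removed:
  assumes "\<not> T \<subseteq> S" obtains a where "a \<in> H" "low a" "eo a \<in> T" "eo a \<notin> S"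
  using assms T_E low_cases by (metis subset_iff)

lemma ex_added:
  assumes "\<not> S \<subseteq> T" obtains b where "b \<in> H" "low b" "eo b \<in> S" "eo b \<notin> T"
  using assms S_E low_cases by (metis subset_iff)

lemma rk_root: "rk h0 = 0"
  using rk_pos[of 0] by simp

lemma reach_down:
  assumes "k \<in> H" "low k" "eo k \<in> T" "eo k \<in> S"
  shows "linked X k (\<alpha> k)"
  using assms
proof (cases rule: tree_down)
  case 1
  then show ?thesis by (rule reach_step)
next
  case (2 b)
  have "cyc b - {\<alpha> k} \<subseteq> X" using cyc_tails[OF 2(1-4)] by blast
  then show ?thesis using 2(9) by (rule reach_mono)
qed

lemma cut_unreachable:
  assumes a: "a \<in> H" "low a" "eo a \<in> T" "eo a \<notin> S" and "x \<in> H" "y \<in> H" "\<not> inside a x" "inside a y"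
    and "Y \<subseteq> X"
  shows "\<not> linked Y x y"
proof
  assume "linked Y x y"
  then have "\<not> inside a y"
  proof (rule reach_closed[where P = "\<lambda>h. \<not> inside a h"])
    show "\<And>h. h \<in> Y \<Longrightarrow> \<not> inside a h \<Longrightarrow> \<not> inside a (\<alpha> h)" using removed_cut[OF a] assms(9) by blast
    show "Y \<subseteq> H" using assms(9) tails_subset by blast
  qed (use assms inside_\<sigma>[OF a(1,3,2)] in auto)
  then show False using assms by blast
qed

text \<open>The cut of a removed edge cannot be entered from the root. Conversely, the tour from
  \<open>h0\<close> to \<open>h\<close> has unmatched tree edges only at their smaller halves, so
  \<open>reach_down\<close> suffices.\<close>

lemma root_connected_iff_subset: "root_connected M (Phi M S) \<longleftrightarrow> T \<subseteq> S"
proof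
  assume rc: "root_connected M (Phi M S)"
  show "T \<subseteq> S"
  proof (rule ccontr)
    assume "\<not> T \<subseteq> S"
    then obtain a where a: "a \<in> H" "low a" "eo a \<in> T" "eo a \<notin> S" by (rule ex_removed)
    have "\<not> inside a h0" by (simp add: inside_def rk_root)
    moreover have "linked X h0 (\<alpha> a)" using rc a(1) unfolding root_connected_iff[OF Phi_orientation] by simp
    ultimately show False
      using cut_unreachable[OF a root_in_H, of "\<alpha> a" X] a(1) inside_self(2)[OF a(1,3,2)] by simp
  qed
next
  assume TS: "T \<subseteq> S"
  show "root_connected M (Phi M S)" unfolding root_connected_iff[OF Phi_orientation]
  proof
    fix h assume h: "h \<in> H"
    show "linked X h0 h"
    proof (rule path_reach)
      fix x assume x: "x \<in> H" "eo x \<in> T" "rk x < rk h" "rk (\<alpha> x) < rk h0 \<or> rk h \<le> rk (\<alpha> x)"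
      then have "low x" by (simp add: low_def rk_root)
      then show "linked X x (\<alpha> x)" using reach_down x TS by blast
    qed (use h rk_root in auto)
  qed
qed

text \<open>Since \<open>k\<close> is not active, a smaller \<open>f\<close> crosses it. If
  \<open>f\<close> is added, \<open>k\<close> itself is directed upwards. Otherwise \<open>f\<close>
  is unflipped and leads from \<open>\<alpha> f\<close> to \<open>f\<close>: the walk goes down the
  tree from \<open>\<alpha> k\<close> to \<open>\<alpha> f\<close>, over \<open>f\<close>, and on to
  \<open>k\<close> along tree edges that are passed downwards or are smaller than \<open>k\<close>,
  to which the induction on \<open>rk k\<close> applies.\<close>

lemma reach_up:
  assumes TS: "T \<subseteq> S" and ia: "internal_active M T = {}"
  shows "k \<in> H \<Longrightarrow> low k \<Longrightarrow> eo k \<in> T \<Longrightarrow> linked X (\<alpha> k) k"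
proof (induction "rk k" arbitrary: k rule: less_induct)
  case less
  note k = less.prems
  obtain f where f: "f \<in> H" "low f" "eo f \<notin> T" "cross k f" "\<not> rk k < rk f"
    using ia internal_active_iff[OF k(1,2)] k(3) by blast
  have cr: "rk f < rk k" "rk k < rk (\<alpha> f)" "rk (\<alpha> f) < rk (\<alpha> k)"
    using f(4,5) unfolding cross_def by linarith+
  show ?case
  proof (cases "eo f \<in> S")
    case True
    then have "\<alpha> k \<in> X" using cyc_tails[OF f(1,2) True f(3)] cycI[OF k f(4)] by blast
    then show ?thesis using reach_step[of "\<alpha> k"] k(1) by simp
  next
    case False
    have "\<not> flip (eo f)" using flip_external[OF f(1-3)] False TS by blast
    then have "f \<notin> X" using low_tail_iff[OF f(1,2)] f(3) by blast
    then have "\<alpha> f \<in> X" using X_\<alpha>[OF f(1)] by blast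
    then have step: "linked X (\<alpha> f) f" using reach_step[of "\<alpha> f"] f(1) by simp
    have "rk (\<alpha> f) < N" using f(1) by simp
    then have Sk: "Suc (rk k) < N" using cr by linarith
    have "vt (\<alpha> k) = vt (pos (Suc (rk k)))" using k by (simp add: pos_Suc vt_t)
    also have "linked X (pos (Suc (rk k))) (\<alpha> f)"
    proof (rule path_reach)
      show "rk (pos (Suc (rk k))) \<le> rk (\<alpha> f)" using Sk cr by simp
      fix x assume x: "x \<in> H" "eo x \<in> T" "rk (pos (Suc (rk k))) \<le> rk x" "rk x < rk (\<alpha> f)"
        "rk (\<alpha> x) < rk (pos (Suc (rk k))) \<or> rk (\<alpha> f) \<le> rk (\<alpha> x)"
      have rkx: "rk k < rk x" "rk (\<alpha> x) \<le> rk k \<or> rk (\<alpha> f) \<le> rk (\<alpha> x)" using x(3,5) Sk by auto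
      have "inside k x" using cr rkx x(4) by (simp add: inside_def)
      moreover have "x \<noteq> k" "x \<noteq> \<alpha> k" using rkx x(4) cr by auto
      then have "eo x \<noteq> eo k" using k(1) by (simp add: eo_eq_iff)
      ultimately have "inside k (\<alpha> x)" using inside_\<alpha>[OF k(1,3,2) x(1,2)] by blast
      then have "low x" using rkx x(4) by (auto simp: inside_def low_def)
      then show "linked X x (\<alpha> x)" using reach_down x TS by blast
    qed (use f in auto)
    also note step
    also have "linked X f k"
    proof (rule path_reach)
      fix x assume x: "x \<in> H" "eo x \<in> T" "rk f \<le> rk x" "rk x < rk k" "rk (\<alpha> x) < rk f \<or> rk k \<le> rk (\<alpha> x)"
      show "linked X x (\<alpha> x)"
      proof (cases "low x")
        case True
        then show ?thesis using reach_down x TS by blast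
      next
        case False
        then have "low (\<alpha> x)" "rk (\<alpha> x) < rk k" using x low_\<alpha> by (auto simp: low_def)
        then show ?thesis using less.hyps[of "\<alpha> x"] x(1,2) by simp
      qed
    qed (use k f cr in auto)
    finally show ?thesis .
  qed
qed

lemma strongly_connected_iff_active:
  "strongly_connected_or M (Phi M S) \<longleftrightarrow> internal_active M T = {}"
proof
  assume sc: "strongly_connected_or M (Phi M S)"
  then have "root_connected M (Phi M S)"
    unfolding strongly_connected_iff[OF Phi_orientation] root_connected_iff[OF Phi_orientation] by simp
  then have TS: "T \<subseteq> S" using root_connected_iff_subset by blast
  show "internal_active M T = {}"
  proof (rule ccontr)
    assume "internal_active M T \<noteq> {}"
    then obtain k where k: "k \<in> H" "low k" "eo k \<in> internal_active M T"
      using internal_active_sub T_E low_cases by (metis ex_in_conv subset_iff)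
    then have act: "eo k \<in> T" "\<And>f. f \<in> H \<Longrightarrow> low f \<Longrightarrow> eo f \<notin> T \<Longrightarrow> cross k f \<Longrightarrow> rk k < rk f"
      using internal_active_iff[OF k(1,2)] by blast+
    \<comment> \<open>By \<open>added_cross\<close>, an added edge across the active edge
      \<open>k\<close> would be smaller than \<open>k\<close>. So nothing on the cocycle of
      \<open>k\<close> is flipped, and the cut is directed away from the root.\<close>
    have noflip: "\<not> (b \<in> H \<and> low b \<and> eo b \<in> S \<and> eo b \<notin> T \<and> cross k b)" for b
      using added_cross(1)[of b k] act k by fastforce
    have "linked X (\<alpha> k) k"
      using sc k(1) unfolding strongly_connected_iff[OF Phi_orientation] by simp
    then have "inside k k"
    proof (rule reach_closed[where P = "inside k"])
      fix h assume h: "h \<in> X" "inside k h"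
      have hH: "h \<in> H" using h(1) by (rule tails_in_H)
      show "inside k (\<alpha> h)"
      proof (rule ccontr)
        assume nins: "\<not> inside k (\<alpha> h)"
        have "\<not> flip (eo k)" using flip_internal[OF k(1,2) act(1)] noflip act(1) TS by blast
        then have "k \<in> X" using low_tail_iff[OF k(1,2)] act(1) by blast
        then have "h \<noteq> \<alpha> k" using X_\<alpha>[OF k(1)] h(1) by blast
        moreover have "h \<noteq> k" using h(2) inside_self(1)[OF k(1) act(1) k(2)] by blast
        ultimately have neq: "eo h \<noteq> eo k" using k(1) eo_eq_iff by blast
        then have nT: "eo h \<notin> T" using inside_\<alpha>[OF k(1) act(1) k(2) hH] h(2) nins by blast
        show False
        proof (cases "low h")
          case True
          have cr: "cross k h" using cross_iff_inside[OF k(1,2) hH True neq] h(2) nins by blast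
          have "flip (eo h)" using low_tail_iff[OF hH True] h(1) nT by blast
          then show False using flip_external[OF hH True nT] noflip[of h] hH True nT cr TS by blast
        next
          case False
          let ?f = "\<alpha> h"
          have f: "?f \<in> H" "low ?f" "eo ?f \<notin> T" "eo ?f \<noteq> eo k" "\<alpha> ?f = h"
            using hH False nT neq by (simp_all add: low_\<alpha>)
          have cr: "cross k ?f" using cross_iff_inside[OF k(1,2) f(1,2,4)] h(2) nins f(5) by simp
          then have "rk k < rk ?f" using act(2) f by blast
          then show False using cr h(2) nins f(5) by (auto simp: cross_def inside_def)
        qed
      qed
    qed (use k inside_self(2)[OF k(1) act(1) k(2)] inside_\<sigma>[OF k(1) act(1) k(2)] tails_subset in auto)
    then show False using inside_self(1)[OF k(1) act(1) k(2)] by blast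
  qed
next
  assume ia: "internal_active M T = {}"
  have TS: "T \<subseteq> S" using removed_active ia by blast
  have root: "linked X h0 h" if "h \<in> H" for h
    using root_connected_iff_subset TS that unfolding root_connected_iff[OF Phi_orientation] by blast
  have "linked X h h0" if h: "h \<in> H" for h
  proof (rule path_reach_rev)
    fix x assume x: "x \<in> H" "eo x \<in> T" "rk x < rk h" "rk (\<alpha> x) < rk h0 \<or> rk h \<le> rk (\<alpha> x)"
    then have "low x" by (simp add: low_def rk_root)
    then show "linked X (\<alpha> x) x" using reach_up[OF TS ia] x by blast
  qed (use h rk_root in auto)
  then show "strongly_connected_or M (Phi M S)"
    unfolding strongly_connected_iff[OF Phi_orientation] using root by (blast intro: reach_trans)
qed

section \<open>Minimal and acyclic orientations\<close>

lemma cycle_not_cut: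
  assumes p: "directed_cycle M (Phi M S) p" and h: "h \<in> X" "eo h \<in> set p"
    and a: "a \<in> H" "low a" "eo a \<in> T" "eo a \<notin> S"
  shows "inside a h \<longleftrightarrow> inside a (\<alpha> h)"
proof (rule ccontr)
  assume neq: "inside a h \<noteq> inside a (\<alpha> h)"
  have hH: "h \<in> H" using h(1) by (rule tails_in_H)
  then have "inside a h" "\<not> inside a (\<alpha> h)" using neq removed_cut[OF a h(1)] by blast+
  moreover have "linked ((\<lambda>e. fst (Phi M S e)) ` set p) (\<alpha> h) h"
    using directed_cycle_reach(1)[OF Phi_orientation p h(2)] fst_orientation_eo[OF h(1)] by simp
  moreover have "(\<lambda>e. fst (Phi M S e)) ` set p \<subseteq> X"
    using directed_cycle_reach(2)[OF Phi_orientation p h(2)] fst_orientation(1)[OF Phi_orientation] by blast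
  ultimately show False using cut_unreachable[OF a, of "\<alpha> h" h] hH by simp
qed

lemma cycle_leaves:
  assumes p: "directed_cycle M (Phi M S) p" and e: "h \<in> X" "eo h \<in> set p"
    and k: "k \<in> H" "low k" "eo k \<in> T" "inside k (\<alpha> h)" "\<not> inside k h"
  obtains f where "f \<in> X" "eo f \<in> set p" "inside k f" "\<not> inside k (\<alpha> f)"
proof (rule ccontr)
  assume none: "\<not> thesis"
  let ?Y = "(\<lambda>e. fst (Phi M S e)) ` set p"
  have pE: "set p \<subseteq> E" using directed_cycle_reach(2)[OF Phi_orientation p e(2)] .
  have hH: "h \<in> H" using e(1) by (rule tails_in_H)
  have YX: "?Y \<subseteq> X" using pE fst_orientation(1)[OF Phi_orientation] by blast
  have "linked ?Y (\<alpha> h) h"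
    using directed_cycle_reach(1)[OF Phi_orientation p e(2)] fst_orientation_eo[OF e(1)] by simp
  then have "inside k h"
  proof (rule reach_closed[where P = "inside k"])
    fix f assume f: "f \<in> ?Y" "inside k f"
    then have "f \<in> X" "eo f \<in> set p" using YX pE fst_orientation(2)[OF Phi_orientation] by auto
    then show "inside k (\<alpha> f)" using none that f(2) by blast
  qed (use hH k YX tails_subset inside_\<sigma>[OF k(1,3,2)] in auto)
  then show False using k(5) by blast
qed

lemma added_cycle:
  assumes b: "b \<in> H" "low b" "eo b \<in> S" "eo b \<notin> T"
  obtains p where "directed_cycle M (Phi M S) p" "eo b \<in> set p" "set p \<subseteq> eo ` cyc b"
    "b \<in> X" "\<forall>h\<in>cyc b. rk b \<le> rk h \<and> rk b \<le> rk (\<alpha> h)"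
proof -
  have bX: "b \<in> cyc b" "b \<in> X" using cyc_tails[OF b] by (auto simp: cyc_def)
  have "linked (cyc b - {b}) (\<alpha> b) b" using cyc_reach[OF b bX(1)] .
  moreover have "cyc b - {b} \<subseteq> X" using cyc_tails[OF b] by blast
  ultimately obtain p where p: "directed_cycle M (Phi M S) p" "eo b \<in> set p"
    "set p \<subseteq> insert (eo b) (eo ` (cyc b - {b}))" using directed_cycleI[OF Phi_orientation bX(2)] by blast
  have "rk b \<le> rk h \<and> rk b \<le> rk (\<alpha> h)" if "h \<in> cyc b" for h
    using that
  proof (unfold cyc_def, elim insertE CollectE exE conjE)
    fix k assume k: "h = \<alpha> k" "k \<in> H" "low k" "eo k \<in> T" "cross k b"
    then show "rk b \<le> rk h \<and> rk b \<le> rk (\<alpha> h)"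
      using added_cross[OF b k(2-5)] by simp
  qed (use b in \<open>simp add: low_def\<close>)
  moreover have "eo b \<in> eo ` cyc b" using bX(1) by blast
  ultimately show thesis using that p bX by blast
qed

definition min_tail_cycle :: "'h set list \<Rightarrow> bool" where
  "min_tail_cycle p \<longleftrightarrow> directed_cycle M (Phi M S) p \<and>
    (\<exists>h\<in>X. eo h \<in> set p \<and> (\<forall>x\<in>H. eo x \<in> set p \<longrightarrow> rk h \<le> rk x))"

text \<open>An added \<open>b\<close> is the smallest half-edge of its own cycle and a tail.
  Conversely, without added edges every flipped external edge crosses a removed edge, whose directed
  cut no directed cycle can cross. A cycle whose smallest half-edge \<open>h\<close> is a tail
  contains such an edge: the edge of \<open>h\<close> if it is external, otherwise the edge by which
  the cycle leaves the inside of \<open>h\<close>.\<close>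

lemma no_min_tail_cycle_iff: "(\<nexists>p. min_tail_cycle p) \<longleftrightarrow> S \<subseteq> T"
proof
  assume none: "\<nexists>p. min_tail_cycle p"
  show "S \<subseteq> T"
  proof (rule ccontr)
    assume "\<not> S \<subseteq> T"
    then obtain b where b: "b \<in> H" "low b" "eo b \<in> S" "eo b \<notin> T" by (rule ex_added)
    obtain p where p: "directed_cycle M (Phi M S) p" "eo b \<in> set p" "set p \<subseteq> eo ` cyc b"
      "b \<in> X" "\<forall>h\<in>cyc b. rk b \<le> rk h \<and> rk b \<le> rk (\<alpha> h)" using added_cycle[OF b] .
    have "rk b \<le> rk x" if x: "x \<in> H" "eo x \<in> set p" for x
    proof -
      obtain h where h: "h \<in> cyc b" "eo x = eo h" using x(2) p(3) by blast
      then have "x = h \<or> x = \<alpha> h" using eo_eq_iff cyc_in_H[OF b(1)] by blast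
      then show ?thesis using p(5) h(1) by blast
    qed
    then show False using none p(1,2,4) unfolding min_tail_cycle_def by blast
  qed
next
  assume ST: "S \<subseteq> T"
  show "\<nexists>p. min_tail_cycle p"
  proof
    assume "\<exists>p. min_tail_cycle p"
    then obtain p h where p: "directed_cycle M (Phi M S) p" "h \<in> X" "eo h \<in> set p"
      "\<And>x. x \<in> H \<Longrightarrow> eo x \<in> set p \<Longrightarrow> rk h \<le> rk x" unfolding min_tail_cycle_def by blast
    have hH: "h \<in> H" using p(2) by (rule tails_in_H)
    have "rk h \<le> rk (\<alpha> h)" using p(3,4) hH by simp
    then have lowh: "low h" using \<alpha>_neq[OF hH] hH by (auto simp: low_def le_less)
    show False
    proof (cases "eo h \<in> T")
      case hT: True
      have ins: "inside h (\<alpha> h)" "\<not> inside h h" using inside_self[OF hH hT lowh] by blast+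
      obtain f where f: "f \<in> X" "eo f \<in> set p" "inside h f" "\<not> inside h (\<alpha> f)"
        using cycle_leaves[OF p(1-3) hH lowh hT ins] .
      have fH: "f \<in> H" using f(1) by (rule tails_in_H)
      have "rk h \<le> rk (\<alpha> f)" using p(4)[of "\<alpha> f"] f(2) fH by simp
      moreover have "f \<noteq> \<alpha> h" using X_\<alpha>[OF hH] f(1) p(2) by blast
      then have "\<alpha> f \<noteq> h" using fH by auto
      ultimately have lt: "rk h < rk (\<alpha> f)" using fH hH by (auto simp: le_less)
      then have rkf: "rk h < rk f" "rk f \<le> rk (\<alpha> h)" "rk (\<alpha> h) < rk (\<alpha> f)" using f(3,4) by (auto simp: inside_def)
      then have lowf: "low f" by (simp add: low_def)
      have "eo f \<noteq> eo h" using \<open>f \<noteq> \<alpha> h\<close> rkf hH by (auto simp: eo_eq_iff)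
      then have nT: "eo f \<notin> T" using inside_\<alpha>[OF hH hT lowh fH] f(3,4) by blast
      have "flip (eo f)" using low_tail_iff[OF fH lowf] f(1) nT by blast
      then obtain a where a: "a \<in> H" "low a" "eo a \<in> T" "eo a \<notin> S" "cross a f"
        using flip_external[OF fH lowf nT] ST nT by blast
      have "eo f \<noteq> eo a" using a(3) nT by metis
      then have "inside a f \<noteq> inside a (\<alpha> f)" using cross_iff_inside[OF a(1,2) fH lowf] a(5) by blast
      then show False using cycle_not_cut[OF p(1) f(1,2) a(1-4)] by blast
    next
      case nT: False
      have "flip (eo h)" using low_tail_iff[OF hH lowh] p(2) nT by blast
      then obtain a where a: "a \<in> H" "low a" "eo a \<in> T" "eo a \<notin> S" "cross a h"
        using flip_external[OF hH lowh nT] ST nT by blast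
      have "eo h \<noteq> eo a" using a(3) nT by metis
      then have "inside a h \<noteq> inside a (\<alpha> h)" using cross_iff_inside[OF a(1,2) hH lowh] a(5) by blast
      then show False using cycle_not_cut[OF p(1-3) a(1-4)] by blast
    qed
  qed
qed

text \<open>If nothing is added, an active external edge is unflipped, since a removed edge across
  it would be smaller; it closes a directed cycle with the tree path between its ends. In the other
  direction, the smallest half-edge \<open>h\<close> of a cycle is not a tail. If internal, its edge
  is then removed and the cycle crosses its directed cut. If external and not active, it enters the
  inside of a smaller \<open>k\<close>, and by the choice of \<open>h\<close> the cycle can only
  leave by a flipped external edge, again crossing a directed cut.\<close>

lemma acyclic_iff: "acyclic_or M (Phi M S) \<longleftrightarrow> S \<subseteq> T \<and> external_active M T = {}"
proof
  assume ac: "acyclic_or M (Phi M S)"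
  then have ST: "S \<subseteq> T"
    using no_min_tail_cycle_iff unfolding acyclic_or_def min_tail_cycle_def by blast
  have "external_active M T = {}"
  proof (rule ccontr)
    assume "external_active M T \<noteq> {}"
    then obtain f where f: "f \<in> H" "low f" "eo f \<in> external_active M T"
      using external_active_sub low_cases by (metis DiffD1 ex_in_conv subset_iff)
    then have act: "eo f \<notin> T" "\<And>k. k \<in> H \<Longrightarrow> low k \<Longrightarrow> eo k \<in> T \<Longrightarrow> cross k f \<Longrightarrow> rk f < rk k"
      using external_active_iff[OF f(1,2)] by blast+
    have kS: "eo k \<in> S" if k: "k \<in> H" "low k" "eo k \<in> T" "cross k f" for k
      using removed_cross(1)[OF k(1-3) _ f(1,2) act(1) k(4)] act(2)[OF k] by fastforce
    have "\<not> flip (eo f)" using flip_external[OF f(1,2) act(1)] kS act(1) ST by blast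
    then have "f \<notin> X" using low_tail_iff[OF f(1,2)] act(1) by blast
    then have fX: "\<alpha> f \<in> X" using X_\<alpha>[OF f(1)] by blast
    have "linked X f (\<alpha> f)"
    proof (rule chord_path[OF f(1,2) act(1)])
      fix k assume k: "k \<in> H" "low k" "eo k \<in> T" "cross k f"
      show "linked X k (\<alpha> k)" using reach_down[OF k(1-3) kS[OF k]] .
      show "linked X (\<alpha> k) k" if "rk k < rk f" using act(2)[OF k] that by simp
    qed
    then have "linked X (\<alpha> (\<alpha> f)) (\<alpha> f)" using f(1) by simp
    then obtain p where "directed_cycle M (Phi M S) p" by (rule directed_cycleI[OF Phi_orientation fX order_refl])
    then show False using ac unfolding acyclic_or_def by blast
  qed
  then show "S \<subseteq> T \<and> external_active M T = {}" using ST by blast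
next
  assume *: "S \<subseteq> T \<and> external_active M T = {}"
  then have ST: "S \<subseteq> T" by blast
  show "acyclic_or M (Phi M S)" unfolding acyclic_or_def
  proof
    assume "\<exists>p. directed_cycle M (Phi M S) p"
    then obtain p where p: "directed_cycle M (Phi M S) p" by blast
    interpret wf_digraph "oriented_graph M (Phi M S)" by (rule wf_oriented[OF Phi_orientation])
    have "p \<noteq> []" using p unfolding directed_cycle_def cycle_def by blast
    then have pE: "set p \<subseteq> E" using directed_cycle_reach(2)[OF Phi_orientation p] by (cases p) auto
    define C where "C = {x \<in> H. eo x \<in> set p}"
    obtain e where "e \<in> set p" using \<open>p \<noteq> []\<close> by (cases p) auto
    then obtain x where "x \<in> C" using pE E_E unfolding C_def by blast
    then obtain h where h: "h \<in> C" "\<And>x. x \<in> C \<Longrightarrow> rk h \<le> rk x"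
      using ex_has_least_nat[of "\<lambda>x. x \<in> C" x rk] by blast
    have hH: "h \<in> H" "eo h \<in> set p" using h(1) by (simp_all add: C_def)
    have min: "rk h \<le> rk x" if "x \<in> H" "eo x \<in> set p" for x using h(2) that by (simp add: C_def)
    have "rk h \<le> rk (\<alpha> h)" using min hH by simp
    then have lowh: "low h" using \<alpha>_neq[OF hH(1)] hH(1) by (auto simp: low_def le_less)
    have "\<not> min_tail_cycle p" using no_min_tail_cycle_iff ST by blast
    then have "h \<notin> X" using p hH min unfolding min_tail_cycle_def by blast
    then have \<alpha>X: "\<alpha> h \<in> X" using X_\<alpha>[OF hH(1)] by blast
    have p\<alpha>: "eo (\<alpha> h) \<in> set p" using hH by simp
    show False
    proof (cases "eo h \<in> T")
      case hT: True
      have "flip (eo h)" using low_tail_iff[OF hH(1) lowh] \<open>h \<notin> X\<close> hT by blast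
      then have hS: "eo h \<notin> S" using flip_internal[OF hH(1) lowh hT] ST by blast
      then show False
        using cycle_not_cut[OF p \<alpha>X p\<alpha> hH(1) lowh hT hS] inside_self[OF hH(1) hT lowh] hH(1) by simp
    next
      case nT: False
      then have "eo h \<notin> external_active M T" using * by blast
      then obtain k where k: "k \<in> H" "low k" "eo k \<in> T" "cross k h" "\<not> rk h < rk k"
        using external_active_iff[OF hH(1) lowh] nT by blast
      then have cr: "rk k < rk h" "rk h < rk (\<alpha> k)" "rk (\<alpha> k) < rk (\<alpha> h)" unfolding cross_def by linarith+
      have ins: "inside k (\<alpha> (\<alpha> h))" "\<not> inside k (\<alpha> h)" using cr hH(1) by (simp_all add: inside_def)
      obtain f where f: "f \<in> X" "eo f \<in> set p" "inside k f" "\<not> inside k (\<alpha> f)"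
        using cycle_leaves[OF p \<alpha>X p\<alpha> k(1-3) ins] .
      have fH: "f \<in> H" using f(1) by (rule tails_in_H)
      have "rk h \<le> rk (\<alpha> f)" "rk h \<le> rk f" using min fH f(2) by simp_all
      then have rkf: "rk f \<le> rk (\<alpha> k)" "rk (\<alpha> k) < rk (\<alpha> f)" "rk k < rk f"
        using f(3,4) cr by (auto simp: inside_def)
      then have lowf: "low f" by (simp add: low_def)
      have "f \<noteq> k" "f \<noteq> \<alpha> k" using rkf \<open>rk h \<le> rk (\<alpha> f)\<close> cr k(1) by auto
      then have neq: "eo f \<noteq> eo k" using k(1) eo_eq_iff by blast
      then have nT: "eo f \<notin> T" using inside_\<alpha>[OF k(1,3,2) fH] f(3,4) by blast
      have "flip (eo f)" using low_tail_iff[OF fH lowf] f(1) nT by blast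
      then obtain a where a: "a \<in> H" "low a" "eo a \<in> T" "eo a \<notin> S" "cross a f"
        using flip_external[OF fH lowf nT] ST nT by blast
      have "eo f \<noteq> eo a" using a(3) nT by metis
      then have "inside a f \<noteq> inside a (\<alpha> f)" using cross_iff_inside[OF a(1,2) fH lowf] a(5) by blast
      then show False using cycle_not_cut[OF p f(1,2) a(1-4)] by blast
    qed
  qed
qed

end

section \<open>Outdegree sequences\<close>

context rmap
begin

definition orients :: "'h set \<Rightarrow> bool" where
  "orients X \<longleftrightarrow> X \<subseteq> H \<and> (\<forall>h\<in>H. \<alpha> h \<in> X \<longleftrightarrow> h \<notin> X)"

definition same_out :: "'h set \<Rightarrow> 'h set \<Rightarrow> bool" where
  "same_out X X' \<longleftrightarrow> (\<forall>w\<in>V. card {h \<in> X. vt h = w} = card {h \<in> X'. vt h = w})"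

lemma same_out_sym: "same_out X X' \<Longrightarrow> same_out X' X"
  unfolding same_out_def by simp

lemma orients_tails: "Or \<in> orientations M \<Longrightarrow> orients (tails Or)"
  unfolding orients_def using tails_subset tails_\<alpha> by blast

lemma card_out_set:
  assumes "X \<subseteq> H" "Z \<subseteq> V"
  shows "card {h \<in> X. vt h \<in> Z} = (\<Sum>w\<in>Z. card {h \<in> X. vt h = w})"
proof -
  have "{h \<in> X. vt h \<in> Z} = (\<Union>w\<in>Z. {h \<in> X. vt h = w})" by blast
  moreover have "finite Z" "finite X" using assms finite_V finite_H by (auto intro: finite_subset)
  ultimately show ?thesis by (simp only:) (rule card_UN_disjoint, auto)
qed

lemma card_inner:
  assumes "orients X"
  shows "card {h \<in> X. vt h \<in> Z \<and> vt (\<alpha> h) \<in> Z} = card {e \<in> E. \<forall>h\<in>e. vt h \<in> Z}"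
proof -
  have XH: "X \<subseteq> H" and X\<alpha>: "\<And>h. h \<in> H \<Longrightarrow> \<alpha> h \<in> X \<longleftrightarrow> h \<notin> X" using assms unfolding orients_def by blast+
  have "inj_on eo {h \<in> X. vt h \<in> Z \<and> vt (\<alpha> h) \<in> Z}"
  proof (rule inj_onI)
    fix x y assume xy: "x \<in> {h \<in> X. vt h \<in> Z \<and> vt (\<alpha> h) \<in> Z}" "y \<in> {h \<in> X. vt h \<in> Z \<and> vt (\<alpha> h) \<in> Z}" "eo x = eo y"
    then have "y \<in> H" "x = y \<or> x = \<alpha> y" using XH eo_eq_iff by blast+
    then show "x = y" using X\<alpha>[of y] xy(1,2) by auto
  qed
  moreover have "eo ` {h \<in> X. vt h \<in> Z \<and> vt (\<alpha> h) \<in> Z} = {e \<in> E. \<forall>h\<in>e. vt h \<in> Z}"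
  proof (intro equalityI subsetI)
    fix e assume "e \<in> eo ` {h \<in> X. vt h \<in> Z \<and> vt (\<alpha> h) \<in> Z}"
    then obtain h where "h \<in> X" "vt h \<in> Z" "vt (\<alpha> h) \<in> Z" "e = eo h" by blast
    then show "e \<in> {e \<in> E. \<forall>h\<in>e. vt h \<in> Z}" using XH using eo_in_E[of h] by (auto simp: edge_of_def)
  next
    fix e assume "e \<in> {e \<in> E. \<forall>h\<in>e. vt h \<in> Z}"
    then obtain h where h: "h \<in> H" "e = eo h" "\<forall>x\<in>e. vt x \<in> Z" using E_E by blast
    then have Z: "vt h \<in> Z" "vt (\<alpha> h) \<in> Z" by (auto simp: edge_of_def)
    show "e \<in> eo ` {h \<in> X. vt h \<in> Z \<and> vt (\<alpha> h) \<in> Z}"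
    proof (cases "h \<in> X")
      case True
      then show ?thesis using h(2) Z by blast
    next
      case False
      then have "\<alpha> h \<in> X" using X\<alpha>[OF h(1)] by blast
      then show ?thesis using h Z by (intro image_eqI[of _ _ "\<alpha> h"]) simp_all
    qed
  qed
  ultimately show ?thesis using card_image by fastforce
qed

text \<open>The arcs leaving \<open>Z\<close> are the arcs with tail in \<open>Z\<close>, counted by
  the outdegrees, less the edges within \<open>Z\<close>, whose number does not depend on the
  orientation.\<close>

lemma card_leaving:
  assumes "orients X" "orients X'" "same_out X X'" "Z \<subseteq> V"
  shows "card {h \<in> X. vt h \<in> Z \<and> vt (\<alpha> h) \<notin> Z} = card {h \<in> X'. vt h \<in> Z \<and> vt (\<alpha> h) \<notin> Z}"
proof -
  have *: "card {h \<in> X. vt h \<in> Z} = card {h \<in> X. vt h \<in> Z \<and> vt (\<alpha> h) \<notin> Z} + card {e \<in> E. \<forall>h\<in>e. vt h \<in> Z}"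
    if "orients X" for X
  proof -
    have "finite X" using that finite_H unfolding orients_def by (auto intro: finite_subset)
    moreover have "{h \<in> X. vt h \<in> Z} =
      {h \<in> X. vt h \<in> Z \<and> vt (\<alpha> h) \<notin> Z} \<union> {h \<in> X. vt h \<in> Z \<and> vt (\<alpha> h) \<in> Z}" by blast
    ultimately show ?thesis using card_inner[OF that] by (simp only:) (subst card_Un_disjoint, auto)
  qed
  have "card {h \<in> X. vt h \<in> Z} = card {h \<in> X'. vt h \<in> Z}"
    using assms card_out_set unfolding orients_def same_out_def by (simp add: subset_iff)
  then show ?thesis using *[OF assms(1)] *[OF assms(2)] by simp
qed

text \<open>
  Reachability depends on the outdegrees only: if the head of a dart \<open>h\<close> of \<open>X'\<close> were not reachable
  in \<open>X\<close>, then more edges would leave the set of reachable vertices in \<open>X'\<close> than in \<open>X\<close>.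
\<close>

lemma reach_transfer:
  assumes X: "orients X" "orients X'" "same_out X X'" and W: "X \<inter> W = X' \<inter> W" and K: "K \<subseteq> H"
    and r: "(x, y) \<in> reach ((X' - W) \<union> K)"
  shows "(x, y) \<in> reach ((X - W) \<union> K)"
proof (rule reach_subst[OF r])
  fix h assume h: "h \<in> (X' - W) \<union> K"
  let ?Y = "(X - W) \<union> K"
  have XH: "X \<subseteq> H" "X' \<subseteq> H" "finite X'" using X finite_H unfolding orients_def by (auto intro: finite_subset)
  show "linked ?Y h (\<alpha> h)"
  proof (rule ccontr)
    assume no: "\<not> linked ?Y h (\<alpha> h)"
    then have hX': "h \<in> X' - W" using h reach_step[of h ?Y] by blast
    then have hH: "h \<in> H" using XH by blast
    \<comment> \<open>In the application \<open>W\<close> holds the decided half-edges and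
      \<open>K\<close> the contracted ones. An arc of \<open>X\<close> can leave \<open>Z\<close>
      only through \<open>W\<close>, so it belongs to \<open>X'\<close> too, while \<open>h\<close>
      leaves \<open>Z\<close> in \<open>X'\<close> alone.\<close>
    define Z where "Z = {w \<in> V. (vt h, w) \<in> reach ?Y}"
    let ?L = "\<lambda>X. {h \<in> X. vt h \<in> Z \<and> vt (\<alpha> h) \<notin> Z}"
    have "x \<in> W" if "x \<in> ?L X" for x
    proof (rule ccontr)
      assume "x \<notin> W"
      then have "linked ?Y x (\<alpha> x)" "x \<in> H" using that reach_step[of x ?Y] XH by auto
      then have "vt (\<alpha> x) \<in> Z" using that unfolding Z_def by (auto intro: reach_trans)
      then show False using that by blast
    qed
    then have "?L X \<subseteq> ?L X'" using W by blast
    moreover have "h \<in> ?L X'" "h \<notin> ?L X" using hX' hH no \<open>\<And>x. x \<in> ?L X \<Longrightarrow> x \<in> W\<close> unfolding Z_def by auto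
    ultimately have "?L X \<subset> ?L X'" by blast
    then have "card (?L X) < card (?L X')" using XH by (intro psubset_card_mono) simp_all
    then show False using card_leaving[OF X, of Z] unfolding Z_def by simp
  qed
qed

lemma reach_same_out:
  assumes "orients X" "orients X'" "same_out X X'" shows "reach X = reach X'"
proof (intro equalityI subrelI)
  show "(x, y) \<in> reach X'" if "(x, y) \<in> reach X" for x y
    using reach_transfer[OF assms(2,1) same_out_sym[OF assms(3)], of "{}" "{}"] that by simp
  show "(x, y) \<in> reach X" if "(x, y) \<in> reach X'" for x y
    using reach_transfer[OF assms, of "{}" "{}"] that by simp
qed

section \<open>Comparing the tours of two orientations with equal outdegrees\<close>

lemma tree_intI: "S \<subseteq> E \<Longrightarrow> tree_int M (tree_of M S) S"
  using tree_of_span tree_of_interval by unfold_locales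

text \<open>
  For an edge that is not active, membership in the tree can be read off the orientation: it is
  equivalent to \<open>g\<close> being a tail if and only if there is no directed path from the vertex of \<open>g\<close> to
  the other end of the edge in the minor. By \<open>reach_transfer\<close> the existence of such a path depends
  only on the outdegrees and on the orientation of the edges visited before.
\<close>

lemma tours_agree_aux:
  assumes T: "tree_int M T S" and T': "tree_int M T' S'"
    and out: "same_out (tails (Phi M S)) (tails (Phi M S'))"
    and agree: "agree T T' m" and g: "g \<in> H" "eo g \<in> T" "eo g \<notin> T'"
    and rk: "rank M T (\<alpha> g) = m" "rank M T' g = m" and tops: "tour.top M T (\<alpha> g)" "tour.top M T' g"
    and or_above: "\<And>h. h \<in> H \<Longrightarrow> m < rank M T h \<Longrightarrow> Phi M S (eo h) = Phi M S' (eo h)"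
    and or_g: "Phi M S (eo g) = Phi M S' (eo g)"
  shows False
proof -
  interpret T: tree_int M T S by fact
  interpret T': tree_int M T' S' by fact
  have \<alpha>g: "\<alpha> g \<in> H" using g(1) by simp
  have nact: "\<not> T.act (eo (\<alpha> g))" "\<not> T'.act (eo g)"
    using not_act_agree[OF T.tree T'.tree agree \<alpha>g rk(1) tops(1)]
      not_act_agree[OF T'.tree T.tree agree_sym[OF agree] g(1) rk(2) tops(2)] g by simp_all
  have ab: "T.above (\<alpha> g) = T'.above g"
  proof -
    have "m < T.rk h \<longleftrightarrow> m < T'.rk h" if "h \<in> H" for h using agree that unfolding agree_def by metis
    then show ?thesis unfolding T.above_def T'.above_def rk by auto
  qed
  \<comment> \<open>The two halves of the edge of \<open>g\<close> are included because the minors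
    leave this edge out; \<open>or_g\<close> makes the orientations agree on it.\<close>
  define W where "W = T.above (\<alpha> g) \<union> {g, \<alpha> g}"
  define K where "K = T.above (\<alpha> g) \<inter> darts T"
  have aboveD: "Phi M S (eo h) = Phi M S' (eo h) \<and> (eo h \<in> T \<longleftrightarrow> eo h \<in> T')" if "h \<in> T.above (\<alpha> g)" for h
  proof -
    have hH: "h \<in> H" "m < T.rk h \<or> m < T.rk (\<alpha> h)" using that unfolding T.above_def rk by auto
    then show ?thesis
    proof (elim disjE)
      assume "m < T.rk h"
      then show ?thesis using or_above[of h] agree hH(1) unfolding agree_def by blast
    next
      assume *: "m < T.rk (\<alpha> h)"
      have "\<alpha> h \<in> H" using hH(1) by simp
      then have "Phi M S (eo (\<alpha> h)) = Phi M S' (eo (\<alpha> h)) \<and> (eo (\<alpha> h) \<in> T \<longleftrightarrow> eo (\<alpha> h) \<in> T')"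
        using * or_above[of "\<alpha> h"] agree unfolding agree_def by blast
      then show ?thesis using hH(1) by simp
    qed
  qed
  have "Phi M S (eo h) = Phi M S' (eo h)" if "h \<in> W" for h
    using that aboveD or_g g(1) unfolding W_def by auto
  then have XW: "T.X \<inter> W = T'.X \<inter> W" unfolding tails_def by auto
  have K': "K = T'.above g \<inter> darts T'" unfolding K_def ab[symmetric] using aboveD by (auto simp: in_darts)
  have eo_g: "h \<notin> {g, \<alpha> g} \<longleftrightarrow> eo h \<noteq> eo g" for h using eo_eq_iff[OF g(1)] by blast
  have minor: "T.minor (\<alpha> g) = (T.X - W) \<union> K" "T'.minor g = (T'.X - W) \<union> K"
    unfolding T.minor_def T'.minor_def K_def[symmetric] K'[symmetric] unfolding W_def ab
    using eo_g g(1) by auto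
  have KH: "K \<subseteq> H" unfolding K_def by (auto simp: in_darts)
  note or = orients_tails[OF T.Phi_orientation] orients_tails[OF T'.Phi_orientation]
  have eq: "linked (T.minor (\<alpha> g)) g (\<alpha> g) \<longleftrightarrow> linked (T'.minor g) g (\<alpha> g)"
    unfolding minor
    using reach_transfer[OF or out XW KH] reach_transfer[OF or(2,1) same_out_sym[OF out] XW[symmetric] KH] by blast
  \<comment> \<open>Equal orientations of the edge mean equal flips, although it is internal for one
    tree and external for the other. So in both cases the lemmas on minors contradict
    \<open>eq\<close>.\<close>
  have fl: "g \<in> T.X \<longleftrightarrow> \<not> T.flip (eo g)" "g \<in> T'.X \<longleftrightarrow> \<not> T'.flip (eo g)"
    using T.top_tail_iff[OF \<alpha>g tops(1)] T'.top_tail_iff[OF g(1) tops(2)] g by simp_all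
  have "g \<in> T.X \<longleftrightarrow> g \<in> T'.X" using or_g unfolding tails_def by simp
  then show False
  proof (cases "g \<in> T.X")
    case True
    then show False
      using T.minor_internal_unflipped[OF \<alpha>g tops(1)] T'.minor_external_unflipped[OF g(1) tops(2)]
        eq fl g \<open>g \<in> T.X \<longleftrightarrow> g \<in> T'.X\<close> by simp
  next
    case False
    then show False
      using T.minor_internal_flipped[OF \<alpha>g tops(1)] T'.minor_external_flipped[OF g(1) tops(2)]
        eq fl g nact \<open>g \<in> T.X \<longleftrightarrow> g \<in> T'.X\<close> by simp
  qed
qed

lemma tours_agree:
  assumes T: "tree_int M T S" and T': "tree_int M T' S'"
    and out: "same_out (tails (Phi M S)) (tails (Phi M S'))"
    and agree: "agree T T' m" and g: "g \<in> H"
    and u: "u = (if eo g \<in> T then \<alpha> g else g)" "u' = (if eo g \<in> T' then \<alpha> g else g)"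
    and rk: "rank M T u = m" "rank M T' u' = m" and tops: "tour.top M T u" "tour.top M T' u'"
    and or_above: "\<And>h. h \<in> H \<Longrightarrow> m < rank M T h \<Longrightarrow> Phi M S (eo h) = Phi M S' (eo h)"
    and or_g: "Phi M S (eo g) = Phi M S' (eo g)"
  shows "eo g \<in> T \<longleftrightarrow> eo g \<in> T'"
proof (rule ccontr)
  assume neq: "(eo g \<in> T) \<noteq> (eo g \<in> T')"
  show False
  proof (cases "eo g \<in> T")
    case True
    then show False
      using tours_agree_aux[OF T T' out agree g] neq u rk tops or_above or_g by simp
  next
    case False
    have "Phi M S' (eo h) = Phi M S (eo h)" if "h \<in> H" "m < rank M T' h" for h
    proof -
      have "rank M T h = rank M T' h" using agree that unfolding agree_def by blast
      then show ?thesis using or_above[OF that(1)] that(2) by simp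
    qed
    then show False
      using tours_agree_aux[OF T' T same_out_sym[OF out] agree_sym[OF agree] g] False neq u rk tops or_g by simp
  qed
qed

text \<open>Differences of the trees and of the orientations are collected in one set. By
  \<open>tours_agree\<close>, equal orientations at its first edge would force equal decisions, so
  there the orientations differ.\<close>

lemma first_disagreement:
  assumes S: "S \<subseteq> E" and S': "S' \<subseteq> E"
    and out: "same_out (tails (Phi M S)) (tails (Phi M S'))"
    and neq: "tree_of M S \<noteq> tree_of M S' \<or> Phi M S \<noteq> Phi M S'"
  obtains g m u u' where "g \<in> H" "agree (tree_of M S) (tree_of M S') m"
    "u = (if eo g \<in> tree_of M S then \<alpha> g else g)" "u' = (if eo g \<in> tree_of M S' then \<alpha> g else g)"
    "rank M (tree_of M S) u = m" "rank M (tree_of M S') u' = m"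
    "tour.top M (tree_of M S) u" "tour.top M (tree_of M S') u'"
    "\<forall>h\<in>H. m < rank M (tree_of M S) h \<longrightarrow> Phi M S (eo h) = Phi M S' (eo h)"
    "g \<in> tails (Phi M S) \<longleftrightarrow> g \<notin> tails (Phi M S')"
proof -
  let ?T = "tree_of M S" and ?T' = "tree_of M S'"
  interpret T: tree_int M ?T S using S by (rule tree_intI)
  interpret T': tree_int M ?T' S' using S' by (rule tree_intI)
  define \<Delta> where "\<Delta> = {e. (e \<in> ?T) \<noteq> (e \<in> ?T') \<or> Phi M S e \<noteq> Phi M S' e}"
  have sub: "e \<in> ?T \<longleftrightarrow> e \<in> ?T'" if "e \<notin> \<Delta>" for e using that by (simp add: \<Delta>_def)
  have ex: "\<exists>e\<in>E. e \<in> \<Delta>"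
  proof (rule ccontr)
    assume "\<not> ?thesis"
    then have *: "e \<in> ?T \<longleftrightarrow> e \<in> ?T'" "Phi M S e = Phi M S' e" if "e \<in> E" for e using that by (auto simp: \<Delta>_def)
    have "?T = ?T'" using *(1) T.T_E T'.T_E by blast
    moreover have "Phi M S = Phi M S'"
      using *(2) T.Phi_orientation T'.Phi_orientation unfolding orientations_def by (rule PiE_ext[rotated 2])
    ultimately show False using neq by blast
  qed
  obtain g m u u' where *: "g \<in> H" "eo g \<in> \<Delta>" "agree ?T ?T' m"
    "u = (if eo g \<in> ?T then \<alpha> g else g)" "u' = (if eo g \<in> ?T' then \<alpha> g else g)"
    "T.rk u = m" "T'.rk u' = m" "T.top u" "T'.top u'" "\<forall>h\<in>H. m < T.rk h \<longrightarrow> eo h \<notin> \<Delta>"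
    by (rule first_diff[OF T.tree T'.tree sub ex])
  have or_above: "Phi M S (eo h) = Phi M S' (eo h)" if "h \<in> H" "m < T.rk h" for h
    using *(10) that by (simp add: \<Delta>_def)
  have "Phi M S (eo g) \<noteq> Phi M S' (eo g)"
    using tours_agree[OF T.tree_int_axioms T'.tree_int_axioms out *(3,1,4-9) or_above] *(2) unfolding \<Delta>_def by blast
  then have "g \<in> T.X \<longleftrightarrow> g \<notin> T'.X"
    using orientation_cases[OF T.Phi_orientation *(1)] orientation_cases[OF T'.Phi_orientation *(1)]
      \<alpha>_neq[OF *(1)] *(1) unfolding tails_def by auto
  then show thesis using that[OF *(1,3-9)] or_above by blast
qed

end

section \<open>Bijectivity of \<open>Phi\<close>\<close>

context tree_int
begin

text \<open>By \<open>removed_cross\<close> and \<open>added_cross\<close>, only the edge itself can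
  cause the flip of an active edge. So its orientation records its membership in
  \<open>S\<close>.\<close>

lemma active_tail_iff:
  assumes h: "h \<in> H" "low h" "act (eo h)" shows "h \<in> X \<longleftrightarrow> eo h \<in> S"
proof (cases "eo h \<in> T")
  case True
  then have ia: "eo h \<in> internal_active M T" using h(3) external_active_sub unfolding act_def by blast
  have "\<not> (b \<in> H \<and> low b \<and> eo b \<in> S \<and> eo b \<notin> T \<and> cross h b)" for b
    using added_cross(1)[of b h] internal_active_iff[OF h(1,2)] ia h True by fastforce
  then show ?thesis using low_tail_iff[OF h(1,2)] flip_internal[OF h(1,2) True] True by blast
next
  case False
  then have ea: "eo h \<in> external_active M T" using h(3) internal_active_sub unfolding act_def by blast
  have "\<not> (a \<in> H \<and> low a \<and> eo a \<in> T \<and> eo a \<notin> S \<and> cross a h)" for a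
    using removed_cross(1)[of a h] external_active_iff[OF h(1,2)] ea h False by fastforce
  then show ?thesis using low_tail_iff[OF h(1,2)] flip_external[OF h(1,2) False] False by blast
qed

end

context rmap
begin

lemma Phi_in_orientations: "S \<subseteq> E \<Longrightarrow> Phi M S \<in> orientations M"
  using tree_int.Phi_orientation[OF tree_intI] .

text \<open>Equal orientations leave no room for the edge that \<open>first_disagreement\<close>
  exhibits, so the trees are equal. Then \<open>active_tail_iff\<close> recovers \<open>S\<close> on
  the active edges, and the tree does on the others.\<close>

lemma inj_Phi: "inj_on (Phi M) (subgraphs M)"
proof (rule inj_onI)
  fix S S' assume "S \<in> subgraphs M" "S' \<in> subgraphs M" and eq: "Phi M S = Phi M S'"
  then have S: "S \<subseteq> E" "S' \<subseteq> E" unfolding subgraphs_def by auto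
  have trees: "tree_of M S = tree_of M S'"
  proof (rule ccontr)
    assume "tree_of M S \<noteq> tree_of M S'"
    then have neq: "tree_of M S \<noteq> tree_of M S' \<or> Phi M S \<noteq> Phi M S'" by blast
    have out: "same_out (tails (Phi M S)) (tails (Phi M S'))" using eq by (simp add: same_out_def)
    show False by (rule first_disagreement[OF S out neq]) (use eq in simp)
  qed
  interpret T: tree_int M "tree_of M S" S using S(1) by (rule tree_intI)
  interpret T': tree_int M "tree_of M S" S' using tree_intI[OF S(2)] trees by simp
  have "e \<in> S \<longleftrightarrow> e \<in> S'" if e: "e \<in> E" for e
  proof (cases "T.act e")
    case True
    obtain h where h: "h \<in> H" "e = eo h" "T.low h" using e T.low_cases by blast
    then show ?thesis using T.active_tail_iff[OF h(1,3)] T'.active_tail_iff[OF h(1,3)] True eq by simp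
  next
    case False
    then show ?thesis using T.not_act_mem[OF e] T'.not_act_mem[OF e] by blast
  qed
  then show "S = S'" using S by blast
qed

lemma card_orientations: "card (orientations M) = 2 ^ card E"
proof -
  have "card {(h, \<alpha> h) | h. h \<in> e} = 2" if e: "e \<in> E" for e
  proof -
    obtain h where h: "h \<in> H" "e = eo h" using e E_E by blast
    have "{(h, \<alpha> h) | h. h \<in> e} = {(h, \<alpha> h), (\<alpha> h, h)}" using h by (auto simp: edge_of_def)
    then show ?thesis using \<alpha>_neq[OF h(1)] by (simp add: card_insert_if)
  qed
  then show ?thesis unfolding orientations_def by (simp add: card_PiE)
qed

lemma bij_Phi: "bij_betw (Phi M) (subgraphs M) (orientations M)"
proof (rule bij_betw_imageI[OF inj_Phi])
  have sub: "Phi M ` subgraphs M \<subseteq> orientations M" using Phi_in_orientations unfolding subgraphs_def by blast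
  have "finite (orientations M)" using card_orientations by (intro card_ge_0_finite) simp
  moreover have "card (Phi M ` subgraphs M) = card (orientations M)"
    using card_image[OF inj_Phi] by (simp add: card_orientations subgraphs_def card_Pow)
  ultimately show "Phi M ` subgraphs M = orientations M" using sub card_subset_eq by blast
qed

section \<open>Minimal orientations and outdegree sequences\<close>

lemma outdegree_same_out:
  "Or \<in> orientations M \<Longrightarrow> Or' \<in> orientations M \<Longrightarrow> outdegree M Or = outdegree M Or' \<longleftrightarrow> same_out (tails Or) (tails Or')"
  unfolding same_out_def by (rule outdegree_eq_iff)

lemma outdegree_inj_aux:
  assumes S: "S \<subseteq> tree_of M S" "S \<subseteq> E" and S': "S' \<subseteq> E"
    and out: "same_out (tails (Phi M S)) (tails (Phi M S'))"
    and g: "g \<in> H" "g \<notin> tails (Phi M S)" "g \<in> tails (Phi M S')"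
    and u: "u = (if eo g \<in> tree_of M S then \<alpha> g else g)" "tour.top M (tree_of M S) u"
  shows False
proof -
  interpret T: tree_int M "tree_of M S" S using S(2) by (rule tree_intI)
  let ?T = "tree_of M S"
  have uH: "u \<in> H" "eo u = eo g" using u g by auto
  have l: "\<alpha> u \<in> H" "T.low (\<alpha> u)" "eo (\<alpha> u) = eo g" using uH u(2) T.top_iff by simp_all
  have "(if eo u \<in> ?T then \<alpha> u else u) = g" using u(1) uH g(1) by simp
  then have flip: "T.flip (eo g)" using T.top_tail_iff[OF uH(1) u(2)] g(2) uH(2) by simp
  \<comment> \<open>Nothing is added, so the flip can only come from a removed edge: the edge itself
    if it is internal, otherwise one that crosses it. Its directed cut keeps \<open>g\<close> from
    reaching its other end, although \<open>g\<close> is an arc of the other orientation.\<close>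
  obtain a where a: "a \<in> H" "T.low a" "eo a \<in> ?T" "eo a \<notin> S" "T.inside a (\<alpha> u) \<noteq> T.inside a u"
  proof (cases "eo g \<in> ?T")
    case True
    then have "eo (\<alpha> u) \<in> ?T" using l by simp
    moreover have "eo (\<alpha> u) \<notin> S" using T.flip_internal[OF l(1,2)] flip True l(3) S(1) by auto
    moreover have "T.inside (\<alpha> u) (\<alpha> u) \<noteq> T.inside (\<alpha> u) u"
      using T.inside_self[OF l(1) \<open>eo (\<alpha> u) \<in> ?T\<close> l(2)] uH(1) by simp
    ultimately show thesis using that l by blast
  next
    case False
    then have nT: "eo (\<alpha> u) \<notin> ?T" using l by simp
    then obtain a where a: "a \<in> H" "T.low a" "eo a \<in> ?T" "eo a \<notin> S" "T.cross a (\<alpha> u)"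
      using T.flip_external[OF l(1,2)] flip l(3) S(1) by auto
    have "eo (\<alpha> u) \<noteq> eo a" using a(3) nT by metis
    then have "T.inside a (\<alpha> u) \<noteq> T.inside a u"
      using T.cross_iff_inside[OF a(1,2) l(1,2)] a(5) uH(1) by simp
    then show thesis using that a by blast
  qed
  have neq: "T.inside a g \<noteq> T.inside a (\<alpha> g)" using a(5) u(1) g(1) by (auto split: if_splits)
  have "\<alpha> g \<in> T.X" using T.X_\<alpha>[OF g(1)] g(2) by blast
  then have "\<not> T.inside a (\<alpha> g) \<Longrightarrow> \<not> T.inside a (\<alpha> (\<alpha> g))" using T.removed_cut[OF a(1-4)] by blast
  then have "\<not> T.inside a g" "T.inside a (\<alpha> g)" using neq g(1) by auto
  then have "\<not> linked T.X g (\<alpha> g)" using T.cut_unreachable[OF a(1-4) g(1)] g(1) by simp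
  moreover have "linked (tails (Phi M S')) g (\<alpha> g)" using g(3) by (rule reach_step)
  ultimately show False
    using reach_same_out[OF orients_tails orients_tails out] Phi_in_orientations S(2) S' by simp
qed

lemma outdegree_inj:
  assumes S: "S \<subseteq> tree_of M S" "S \<subseteq> E" and S': "S' \<subseteq> tree_of M S'" "S' \<subseteq> E"
    and out: "outdegree M (Phi M S) = outdegree M (Phi M S')"
  shows "Phi M S = Phi M S'"
proof (rule ccontr)
  assume neq: "Phi M S \<noteq> Phi M S'"
  have out': "same_out (tails (Phi M S)) (tails (Phi M S'))"
    using out outdegree_same_out Phi_in_orientations S(2) S'(2) by blast
  obtain g m u u' where *: "g \<in> H" "agree (tree_of M S) (tree_of M S') m"
    "u = (if eo g \<in> tree_of M S then \<alpha> g else g)" "u' = (if eo g \<in> tree_of M S' then \<alpha> g else g)"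
    "rank M (tree_of M S) u = m" "rank M (tree_of M S') u' = m"
    "tour.top M (tree_of M S) u" "tour.top M (tree_of M S') u'"
    "\<forall>h\<in>H. m < rank M (tree_of M S) h \<longrightarrow> Phi M S (eo h) = Phi M S' (eo h)"
    "g \<in> tails (Phi M S) \<longleftrightarrow> g \<notin> tails (Phi M S')"
    by (rule first_disagreement[OF S(2) S'(2) out' disjI2[OF neq]])
  show False
  proof (cases "g \<in> tails (Phi M S)")
    case True
    then show False
      using outdegree_inj_aux[OF S' S(2) same_out_sym[OF out'] *(1) _ _ *(4,8)] *(10) by blast
  next
    case False
    then show False using outdegree_inj_aux[OF S S'(2) out' *(1) _ _ *(3,7)] *(10) by blast
  qed
qed

section \<open>Reversing a directed cycle\<close>

lemma cas_balance:
  assumes "pre_digraph.cas G u p w"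
  shows "length (filter (\<lambda>e. tail G e = x) p) + (if w = x then 1 else 0) =
    length (filter (\<lambda>e. head G e = x) p) + (if u = x then 1 else 0)"
  using assms by (induction p arbitrary: u) (auto simp: pre_digraph.cas.simps)

definition reverse_on :: "'h set set \<Rightarrow> ('h set \<Rightarrow> 'h \<times> 'h) \<Rightarrow> ('h set \<Rightarrow> 'h \<times> 'h)" where
  "reverse_on P Or = (\<lambda>e\<in>E. if e \<in> P then prod.swap (Or e) else Or e)"

lemma reverse_on_orientation:
  assumes "Or \<in> orientations M" shows "reverse_on P Or \<in> orientations M"
  unfolding orientations_def
proof (rule PiE_I)
  fix e assume "e \<in> E"
  then obtain h where h: "h \<in> H" "e = eo h" using E_E by blast
  then show "reverse_on P Or e \<in> {(h, \<alpha> h) |h. h \<in> e}"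
    using orientation_cases[OF assms h(1)] \<open>e \<in> E\<close> unfolding reverse_on_def by (auto simp: edge_of_def)
qed (simp add: reverse_on_def)

lemma tails_reverse_on:
  assumes "Or \<in> orientations M" "h \<in> H"
  shows "h \<in> tails (reverse_on P Or) \<longleftrightarrow> (h \<in> tails Or) \<noteq> (eo h \<in> P)"
  using orientation_cases[OF assms] assms(2) \<alpha>_neq[OF assms(2)]
  unfolding tails_def reverse_on_def by auto

text \<open>By \<open>cas_balance\<close> the cycle has as many outgoing as incoming arcs at every
  vertex, and reversal swaps the two.\<close>

lemma reverse_cycle_outdegree:
  assumes Or: "Or \<in> orientations M" and p: "directed_cycle M Or p"
  shows "same_out (tails Or) (tails (reverse_on (set p) Or))"
  unfolding same_out_def
proof
  fix w assume "w \<in> V"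
  let ?G = "oriented_graph M Or" and ?X = "tails Or"
  interpret wf_digraph ?G by (rule wf_oriented[OF Or])
  obtain u where u: "awalk u p u" "distinct (tl (awalk_verts u p))" "p \<noteq> []"
    using p unfolding directed_cycle_def cycle_def by blast
  have pE: "set p \<subseteq> E" using directed_cycle_reach(2)[OF Or p] u(3) by (cases p) auto
  have dist: "distinct p" using distinct_tl_verts_imp_distinct[OF u(1,2)] .
  have "length (filter (\<lambda>e. tail ?G e = w) p) = length (filter (\<lambda>e. head ?G e = w) p)"
    using cas_balance[of ?G u p u w] u(1) unfolding awalk_def by simp
  then have "card {e \<in> set p. tail ?G e = w} = card {e \<in> set p. head ?G e = w}"
    using dist by (simp add: distinct_length_filter Int_def conj_commute)
  moreover have "card {e \<in> set p. tail ?G e = w} = card {h \<in> ?X. eo h \<in> set p \<and> vt h = w}"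
    "card {e \<in> set p. head ?G e = w} = card {h \<in> ?X. eo h \<in> set p \<and> vt (\<alpha> h) = w}"
  proof -
    have *: "card {e \<in> set p. Q (fst (Or e))} = card {h \<in> ?X. eo h \<in> set p \<and> Q h}" for Q
    proof -
      have "inj_on eo {h \<in> ?X. eo h \<in> set p \<and> Q h}"
        by (rule inj_on_inverseI[where g = "\<lambda>e. fst (Or e)"]) (simp add: fst_orientation_eo)
      moreover have "eo ` {h \<in> ?X. eo h \<in> set p \<and> Q h} = {e \<in> set p. Q (fst (Or e))}"
      proof (intro equalityI subsetI)
        fix e assume e: "e \<in> {e \<in> set p. Q (fst (Or e))}"
        then have "e \<in> E" using pE by blast
        then show "e \<in> eo ` {h \<in> ?X. eo h \<in> set p \<and> Q h}"
          using fst_orientation[OF Or, of e] e by (intro image_eqI[of _ _ "fst (Or e)"]) simp_all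
      qed (use fst_orientation_eo in auto)
      ultimately show ?thesis using card_image by fastforce
    qed
    have "head ?G e = vt (\<alpha> (fst (Or e)))" if "e \<in> set p" for e
      using that pE fst_orientation(3)[OF Or, of e] by (auto simp: oriented_graph_def)
    then have "{e \<in> set p. head ?G e = w} = {e \<in> set p. vt (\<alpha> (fst (Or e))) = w}" by auto
    then show "card {e \<in> set p. head ?G e = w} = card {h \<in> ?X. eo h \<in> set p \<and> vt (\<alpha> h) = w}"
      using *[of "\<lambda>h. vt (\<alpha> h) = w"] by simp
    show "card {e \<in> set p. tail ?G e = w} = card {h \<in> ?X. eo h \<in> set p \<and> vt h = w}"
      using *[of "\<lambda>h. vt h = w"] by (simp add: oriented_graph_def)
  qed
  moreover have "{h \<in> tails (reverse_on (set p) Or). vt h = w} =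
      {h \<in> ?X. eo h \<notin> set p \<and> vt h = w} \<union> \<alpha> ` {h \<in> ?X. eo h \<in> set p \<and> vt (\<alpha> h) = w}" (is "?L = ?A \<union> \<alpha> ` ?B")
  proof (intro equalityI subsetI)
    fix h assume h: "h \<in> ?L"
    then have hH: "h \<in> H" using tails_in_H by blast
    show "h \<in> ?A \<union> \<alpha> ` ?B"
    proof (cases "eo h \<in> set p")
      case True
      then have "\<alpha> h \<in> ?B" using h tails_reverse_on[OF Or hH] tails_\<alpha>[OF Or hH] hH by simp
      then have "\<alpha> (\<alpha> h) \<in> \<alpha> ` ?B" by (rule imageI)
      then show ?thesis using hH by simp
    next
      case False
      then show ?thesis using h tails_reverse_on[OF Or hH] by simp
    qed
  next
    fix h assume "h \<in> ?A \<union> \<alpha> ` ?B"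
    then show "h \<in> ?L"
    proof
      assume "h \<in> ?A"
      then show ?thesis using tails_reverse_on[OF Or, of h] tails_in_H[of h Or] by simp
    next
      assume "h \<in> \<alpha> ` ?B"
      then obtain x where x: "x \<in> ?B" "h = \<alpha> x" by blast
      then have "x \<in> H" using tails_in_H by blast
      then show ?thesis using x tails_reverse_on[OF Or, of h] tails_\<alpha>[OF Or, of x] by simp
    qed
  qed
  moreover have "card (?A \<union> \<alpha> ` ?B) = card ?A + card ?B"
  proof -
    have fin: "finite ?X" using finite_subset[OF tails_subset finite_H] .
    have "inj_on \<alpha> ?B" using permutes_inj[OF perm_\<alpha>] by (rule inj_on_subset) simp
    moreover have "?A \<inter> \<alpha> ` ?B = {}"
    proof -
      have "\<alpha> x \<notin> ?A" if "x \<in> ?B" for x using that tails_in_H[of x Or] by simp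
      then show ?thesis by blast
    qed
    ultimately show ?thesis using fin by (simp add: card_Un_disjoint card_image)
  qed
  moreover have "card {h \<in> ?X. vt h = w} = card ?A + card {h \<in> ?X. eo h \<in> set p \<and> vt h = w}"
  proof -
    have fin: "finite ?X" using finite_subset[OF tails_subset finite_H] .
    have "{h \<in> ?X. vt h = w} = ?A \<union> {h \<in> ?X. eo h \<in> set p \<and> vt h = w}" by blast
    then show ?thesis using fin by (simp only:) (rule card_Un_disjoint, auto)
  qed
  ultimately show "card {h \<in> ?X. vt h = w} = card {h \<in> tails (reverse_on (set p) Or). vt h = w}" by simp
qed

text \<open>Makes the highest changed bit of a weight outweigh all lower ones.\<close>

lemma sum_power2_less:
  fixes f :: "'b \<Rightarrow> nat"
  assumes "finite F" "inj_on f F" "\<And>x. x \<in> F \<Longrightarrow> f x < m"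
  shows "(\<Sum>x\<in>F. 2 ^ f x :: nat) < 2 ^ m"
proof -
  have "(\<Sum>x\<in>F. 2 ^ f x :: nat) = (\<Sum>i\<in>f ` F. 2 ^ i)" using assms(2) by (simp add: sum.reindex)
  also have "\<dots> \<le> (\<Sum>i<m. 2 ^ i)" using assms(3) by (intro sum_mono2) auto
  also have "\<dots> < (2::nat) ^ m" by (induction m) auto
  finally show ?thesis .
qed

definition flipped :: "'h set set \<Rightarrow> 'h set" where
  "flipped S = {u \<in> H. tour.top M (tree_of M S) u \<and> tree_int.flip M (tree_of M S) S (eo u)}"

text \<open>
  The orientations with given outdegrees are compared by listing their flipped edges in the order of
  the reverse tour; the weight turns this lexicographic order into an order on numbers.
\<close>

definition weight :: "'h set set \<Rightarrow> nat" where
  "weight S = (\<Sum>u\<in>flipped S. 2 ^ rank M (tree_of M S) u)"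

text \<open>The reversed cycle belongs to an added edge, so all its edges are flipped. The first
  edge where the two orientations disagree lies on it and loses its flip. Below its position the
  tours may be entirely different, hence the comparison by powers of two.\<close>

lemma reverse_cycle_decreases:
  assumes S: "S \<subseteq> E" "\<not> S \<subseteq> tree_of M S"
  obtains S' where "S' \<subseteq> E" "same_out (tails (Phi M S)) (tails (Phi M S'))" "weight S' < weight S"
proof -
  let ?T = "tree_of M S"
  interpret T: tree_int M ?T S using S(1) by (rule tree_intI)
  obtain b where b: "b \<in> H" "T.low b" "eo b \<in> S" "eo b \<notin> ?T" using T.ex_added[OF S(2)] .
  obtain p where p: "directed_cycle M (Phi M S) p" "eo b \<in> set p" "set p \<subseteq> eo ` T.cyc b"
    "b \<in> T.X" "\<forall>h\<in>T.cyc b. T.rk b \<le> T.rk h \<and> T.rk b \<le> T.rk (\<alpha> h)" using T.added_cycle[OF b] .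
  define Or where "Or = reverse_on (set p) (Phi M S)"
  have "Or \<in> orientations M" unfolding Or_def using T.Phi_orientation by (rule reverse_on_orientation)
  then have "Or \<in> Phi M ` subgraphs M" using bij_betw_imp_surj_on[OF bij_Phi] by simp
  then obtain S' where S': "S' \<subseteq> E" "Phi M S' = Or" unfolding subgraphs_def by (auto elim: imageE)
  have out: "same_out T.X (tails (Phi M S'))"
    unfolding S'(2) Or_def by (rule reverse_cycle_outdegree[OF T.Phi_orientation p(1)])
  let ?T' = "tree_of M S'"
  interpret T': tree_int M ?T' S' using S'(1) by (rule tree_intI)
  have X': "h \<in> T'.X \<longleftrightarrow> (h \<in> T.X) \<noteq> (eo h \<in> set p)" if "h \<in> H" for h
    unfolding S'(2) Or_def using tails_reverse_on[OF T.Phi_orientation that] .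
  have "b \<notin> T'.X" using X'[OF b(1)] p(2,4) by blast
  then have "Phi M S \<noteq> Phi M S'" using p(4) by metis
  then have neq: "?T \<noteq> ?T' \<or> Phi M S \<noteq> Phi M S'" by blast
  obtain g m u u' where *: "g \<in> H" "agree ?T ?T' m"
    "u = (if eo g \<in> ?T then \<alpha> g else g)" "u' = (if eo g \<in> ?T' then \<alpha> g else g)"
    "T.rk u = m" "T'.rk u' = m" "T.top u" "T'.top u'"
    "\<forall>h\<in>H. m < T.rk h \<longrightarrow> Phi M S (eo h) = Phi M S' (eo h)"
    "g \<in> T.X \<longleftrightarrow> g \<notin> T'.X"
    by (rule first_disagreement[OF S(1) S'(1) out neq])
  have uH: "u \<in> H" "u' \<in> H" "eo u = eo g" "eo u' = eo g" using *(1,3,4) by auto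
  have gu: "(if eo u \<in> ?T then \<alpha> u else u) = g" "(if eo u' \<in> ?T' then \<alpha> u' else u') = g"
    using *(1,3,4) uH by simp_all
  have "eo g \<in> set p" using X'[OF *(1)] *(10) by blast
  then obtain h where h: "h \<in> T.cyc b" "eo g = eo h" using p(3) by blast
  have "T.flip (eo h)"
    using h(1)
  proof (unfold T.cyc_def, elim insertE CollectE exE conjE)
    show "h = b \<Longrightarrow> T.flip (eo h)" using T.flip_external[OF b(1,2,4)] b(3) by simp
    fix k assume k: "h = \<alpha> k" "k \<in> H" "T.low k" "eo k \<in> ?T" "T.cross k b"
    then show "T.flip (eo h)" using T.flip_internal[OF k(2-4)] b by auto
  qed
  then have flip: "T.flip (eo u)" using h(2) uH by simp
  then have "g \<notin> T.X" using T.top_tail_iff[OF uH(1) *(7)] gu(1) by simp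
  then have noflip: "\<not> T'.flip (eo u')" using T'.top_tail_iff[OF uH(2) *(8)] gu(2) *(10) by simp
  have ag: "m < T.rk h \<longleftrightarrow> m < T'.rk h" "m < T.rk h \<Longrightarrow> T.rk h = T'.rk h" if "h \<in> H" for h
    using *(2) that unfolding agree_def by metis+
  have same: "h \<in> flipped S \<longleftrightarrow> h \<in> flipped S'" if h: "h \<in> H" "m < T.rk h" for h
  proof -
    have top: "T.top h \<longleftrightarrow> T'.top h"
      using agree_top[OF T.tree T'.tree *(2) h(1,2)] agree_top[OF T'.tree T.tree agree_sym[OF *(2)] h(1)] h ag(1)[OF h(1)] by blast
    have "eo h \<in> ?T \<longleftrightarrow> eo h \<in> ?T'" using *(2) h unfolding agree_def by blast
    moreover have "x \<in> T.X \<longleftrightarrow> x \<in> T'.X" if "eo x = eo h" for x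
      using *(9) h that unfolding tails_def by simp
    moreover have "eo (\<alpha> h) = eo h" using h(1) by simp
    ultimately have "T.flip (eo h) \<longleftrightarrow> T'.flip (eo h)" if "T.top h"
      using T.top_tail_iff[OF h(1) that] T'.top_tail_iff[OF h(1)] top that by auto
    then show ?thesis using top unfolding flipped_def by blast
  qed
  \<comment> \<open>\<open>A\<close> is the part above \<open>m\<close>, which both tours share.
    \<open>B\<close> lies strictly below \<open>m\<close>, since \<open>u'\<close> at position
    \<open>m\<close> is not flipped; so it weighs less than \<open>2 ^ m\<close>, the contribution
    of \<open>u\<close> to the weight of \<open>S\<close>.\<close>
  define A where "A = {h \<in> flipped S'. m < T'.rk h}"
  define B where "B = {h \<in> flipped S'. \<not> m < T'.rk h}"
  have fl_H: "flipped Q \<subseteq> H" for Q unfolding flipped_def by blast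
  then have fin: "finite (flipped Q)" for Q using finite_subset finite_H by blast
  have AB: "flipped S' = A \<union> B" "A \<inter> B = {}" "finite A" "finite B" using fin unfolding A_def B_def by auto
  have AH: "h \<in> H" if "h \<in> A" for h using that fl_H unfolding A_def by blast
  have "weight S' = (\<Sum>h\<in>A. 2 ^ T'.rk h) + (\<Sum>h\<in>B. 2 ^ T'.rk h)"
    unfolding weight_def AB(1) using AB by (intro sum.union_disjoint) auto
  also have "(\<Sum>h\<in>A. 2 ^ T'.rk h :: nat) = (\<Sum>h\<in>A. 2 ^ T.rk h)"
  proof (rule sum.cong[OF refl])
    fix h assume h: "h \<in> A"
    then have "m < T.rk h" using ag(1)[OF AH[OF h]] unfolding A_def by blast
    then show "2 ^ T'.rk h = (2 ^ T.rk h :: nat)" using ag(2)[OF AH[OF h]] by simp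
  qed
  also have "(\<Sum>h\<in>B. 2 ^ T'.rk h :: nat) < 2 ^ m"
  proof (rule sum_power2_less[OF AB(4)])
    have "B \<subseteq> H" using fl_H unfolding B_def by blast
    then show "inj_on T'.rk B" by (intro inj_onI) (simp add: subset_iff)
    fix x assume x: "x \<in> B"
    then have xH: "x \<in> H" "T'.flip (eo x)" unfolding B_def flipped_def by auto
    have "x \<noteq> u'" using xH(2) noflip by blast
    then have "T'.rk x \<noteq> m" using *(6) xH(1) uH(2) by auto
    then show "T'.rk x < m" using x unfolding B_def by auto
  qed
  also have "(\<Sum>h\<in>A. 2 ^ T.rk h) + 2 ^ m = (\<Sum>h\<in>insert u A. 2 ^ T.rk h)"
  proof -
    have "u \<notin> A" using *(5) uH(1) ag(1)[OF uH(1)] unfolding A_def by auto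
    then show ?thesis using AB(3) *(5) by (simp add: add.commute)
  qed
  also have "\<dots> \<le> weight S" unfolding weight_def
  proof (rule sum_mono2[OF fin])
    have "u \<in> flipped S" using uH(1) *(7) flip unfolding flipped_def by blast
    moreover have "A \<subseteq> flipped S" using same ag(1) AH unfolding A_def by blast
    ultimately show "insert u A \<subseteq> flipped S" by blast
  qed simp
  finally show thesis using that S'(1) out by simp
qed

lemma outdegree_surj:
  assumes "S \<subseteq> E"
  obtains S' where "S' \<subseteq> E" "S' \<subseteq> tree_of M S'" "outdegree M (Phi M S') = outdegree M (Phi M S)"
proof -
  define P where "P S' \<longleftrightarrow> S' \<subseteq> E \<and> outdegree M (Phi M S') = outdegree M (Phi M S)" for S'
  have "P S" using assms by (simp add: P_def)
  then obtain S' where S': "P S'" "\<And>Q. P Q \<Longrightarrow> weight S' \<le> weight Q"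
    using ex_has_least_nat[of P S weight] by blast
  have "S' \<subseteq> tree_of M S'"
  proof (rule ccontr)
    assume "\<not> S' \<subseteq> tree_of M S'"
    moreover have "S' \<subseteq> E" using S'(1) by (simp add: P_def)
    ultimately obtain Q where Q: "Q \<subseteq> E" "same_out (tails (Phi M S')) (tails (Phi M Q))" "weight Q < weight S'"
      using reverse_cycle_decreases by blast
    have "outdegree M (Phi M S') = outdegree M (Phi M Q)"
      using Q(1,2) \<open>S' \<subseteq> E\<close> outdegree_same_out Phi_in_orientations by blast
    then have "P Q" using S'(1) Q(1) unfolding P_def by simp
    then show False using S'(2) Q(3) by fastforce
  qed
  then show thesis using that S'(1) unfolding P_def by blast
qed

end

section \<open>The Tutte polynomial\<close>

context tree_int
begin

text \<open>Removed and added edges do not cross, so the tree path between the ends of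
  \<open>b\<close> consists of kept edges.\<close>

lemma added_reach:
  assumes b: "b \<in> H" "low b" "eo b \<in> S" "eo b \<notin> T"
  shows "linked (darts (T - (T - S))) b (\<alpha> b)"
proof -
  have "k \<in> darts (T - (T - S)) \<and> \<alpha> k \<in> darts (T - (T - S))"
    if k: "k \<in> H" "low k" "eo k \<in> T" "cross k b" for k
  proof -
    have "rk b < rk k" using added_cross(1)[OF b k] .
    then have "eo k \<in> S" using removed_cross(1)[OF k(1-3) _ b(1,2,4) k(4)] by fastforce
    then show ?thesis using k by (simp add: in_darts)
  qed
  then show ?thesis using reach_step reach_darts_sym by (intro chord_path[OF b(1,2,4)]) blast+
qed

text \<open>Added edges join nothing new by \<open>added_reach\<close>, and each removed tree edge
  splits off one component. Together with \<open>nullity_S\<close> this turns the exponents of the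
  Tutte sum into the numbers of removed and of added edges.\<close>

lemma num_components_S: "num_components M S = Suc (card (T - S))"
proof -
  have "num_components M ((T - (T - S)) \<union> (S - T)) = num_components M (T - (T - S))"
  proof (rule num_components_Un_same)
    fix h assume "h \<in> darts (S - T)"
    then have h: "h \<in> H" "eo h \<in> S" "eo h \<notin> T" by (auto simp: in_darts)
    show "linked (darts (T - (T - S))) h (\<alpha> h)"
    proof (cases "low h")
      case True
      then show ?thesis using added_reach h by blast
    next
      case False
      then have "low (\<alpha> h)" using low_\<alpha> h(1) by blast
      then show ?thesis using added_reach[of "\<alpha> h"] h reach_darts_sym by simp
    qed
  qed (use S_E in blast)
  moreover have "(T - (T - S)) \<union> (S - T) = S" by blast
  moreover have "num_components M (T - (T - S)) = num_components M T + card (T - S)"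
    using num_components_Diff_acyc[OF T_E T_acyc] by blast
  moreover have "num_components M T = 1" using T_conn conn_iff_num_components by blast
  ultimately show ?thesis by simp
qed

lemma nullity_S: "card S + num_components M S = card V + card (S - T)"
proof -
  have fin: "finite S" "finite T" using S_E T_E by simp_all
  have "card S = card (S \<inter> T) + card (S - T)" "card T = card (T \<inter> S) + card (T - S)"
    using fin by (simp_all add: card_Int_Diff)
  moreover have "Suc (card T) = card V" using tree unfolding span_tree_iff_card by blast
  ultimately show ?thesis unfolding num_components_S by (simp add: Int_commute)
qed

lemma connected_iff: "connected_subgraph M S \<longleftrightarrow> T \<subseteq> S"
  using S_E T_E finite_subgraph[of "T - S"]
  unfolding connected_subgraph_iff conn_iff_num_components num_components_S by auto

lemma forest_iff: "forest_subgraph M S \<longleftrightarrow> S \<subseteq> T"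
  using S_E finite_subgraph[of "S - T"] nullity_S
  unfolding forest_subgraph_iff by (auto simp: acyc_iff_rank[OF S_E] add.commute)

lemma minimal_iff:
  assumes "inv_into (subgraphs M) (Phi M) (Phi M S) = S"
  shows "minimal_or M (Phi M S) \<longleftrightarrow> S \<subseteq> T"
proof -
  have "directed_cycle M (Phi M S) p \<and>
      smallest_half_edge M T (\<Union>(set p)) \<in> (\<lambda>e. fst (Phi M S e)) ` set p \<longleftrightarrow> min_tail_cycle p" for p
  proof (cases "directed_cycle M (Phi M S) p")
    case p: True
    interpret wf_digraph "oriented_graph M (Phi M S)" by (rule wf_oriented[OF Phi_orientation])
    have "p \<noteq> []" using p unfolding directed_cycle_def cycle_def by blast
    then have pE: "set p \<subseteq> E" using directed_cycle_reach(2)[OF Phi_orientation p] by (cases p) auto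
    have U: "x \<in> \<Union>(set p) \<longleftrightarrow> x \<in> H \<and> eo x \<in> set p" for x
    proof
      assume "x \<in> \<Union>(set p)"
      then obtain e where "e \<in> set p" "x \<in> e" by blast
      then show "x \<in> H \<and> eo x \<in> set p" using E_half[of e x] pE by auto
    qed (auto simp: edge_of_def)
    have sub: "\<Union>(set p) \<subseteq> H" using U by blast
    have fin: "finite (\<Union>(set p))" using sub finite_H by (rule finite_subset)
    obtain e where "e \<in> set p" using \<open>p \<noteq> []\<close> by (cases p) auto
    then obtain x where "x \<in> H" "eo x \<in> set p" using pE E_E by blast
    then have ne: "\<Union>(set p) \<noteq> {}" using U by blast
    let ?z = "smallest_half_edge M T (\<Union>(set p))"
    have z: "?z \<in> H" "eo ?z \<in> set p" "\<And>x. x \<in> H \<Longrightarrow> eo x \<in> set p \<Longrightarrow> rk ?z \<le> rk x"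
      using arg_min_if_finite[OF fin ne, of rk] U unfolding smallest_half_edge_def by (auto simp: not_less)
    have "?z \<in> (\<lambda>e. fst (Phi M S e)) ` set p \<longleftrightarrow> ?z \<in> X"
    proof
      assume "?z \<in> (\<lambda>e. fst (Phi M S e)) ` set p"
      then show "?z \<in> X" using pE fst_orientation(1)[OF Phi_orientation] by auto
    next
      assume "?z \<in> X"
      then show "?z \<in> (\<lambda>e. fst (Phi M S e)) ` set p"
        using z(2) fst_orientation_eo[of ?z] by (intro image_eqI[of _ _ "eo ?z"]) simp_all
    qed
    also have "\<dots> \<longleftrightarrow> (\<exists>h\<in>X. eo h \<in> set p \<and> (\<forall>x\<in>H. eo x \<in> set p \<longrightarrow> rk h \<le> rk x))"
    proof
      assume "?z \<in> X"
      then show "\<exists>h\<in>X. eo h \<in> set p \<and> (\<forall>x\<in>H. eo x \<in> set p \<longrightarrow> rk h \<le> rk x)" using z by blast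
    next
      assume "\<exists>h\<in>X. eo h \<in> set p \<and> (\<forall>x\<in>H. eo x \<in> set p \<longrightarrow> rk h \<le> rk x)"
      then obtain h where h: "h \<in> X" "eo h \<in> set p" "\<And>x. x \<in> H \<Longrightarrow> eo x \<in> set p \<Longrightarrow> rk h \<le> rk x" by blast
      have hH: "h \<in> H" using h(1) by (rule tails_in_H)
      have "rk h = rk ?z" using h(3)[OF z(1,2)] z(3)[OF hH h(2)] by simp
      then have "h = ?z" using rk_eq_iff[OF hH z(1)] by blast
      then show "?z \<in> X" using h(1) by simp
    qed
    finally show ?thesis using p unfolding min_tail_cycle_def by blast
  qed (simp add: min_tail_cycle_def)
  then show ?thesis
    unfolding minimal_or_def Let_def assms tree_of_S no_min_tail_cycle_iff[symmetric] by blast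
qed

end

section \<open>Expansion of the Tutte polynomial by activities\<close>

lemma sum_Pow_power:
  fixes c :: "'b :: comm_semiring_1"
  assumes "finite I" shows "(\<Sum>A\<in>Pow I. c ^ card A) = (c + 1) ^ card I"
  using assms
proof (induction I rule: finite_induct)
  case empty
  then show ?case by simp
next
  case (insert a I)
  have inj: "inj_on (insert a) (Pow I)" using insert.hyps by (auto simp: inj_on_def)
  have "(\<Sum>A\<in>Pow (insert a I). c ^ card A) = (\<Sum>A\<in>Pow I. c ^ card A) + (\<Sum>A\<in>insert a ` Pow I. c ^ card A)"
    unfolding Pow_insert using insert.hyps by (intro sum.union_disjoint) auto
  also have "(\<Sum>A\<in>insert a ` Pow I. c ^ card A) = (\<Sum>A\<in>Pow I. c * c ^ card A)"
    unfolding sum.reindex[OF inj]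
  proof (rule sum.cong[OF refl])
    fix A assume "A \<in> Pow I"
    then have "finite A" "a \<notin> A" using insert.hyps finite_subset by blast+
    then show "((\<lambda>A. c ^ card A) \<circ> insert a) A = c * c ^ card A" by simp
  qed
  finally show ?case using insert by (simp add: sum_distrib_left[symmetric] algebra_simps)
qed

context rmap
begin

lemma finite_active:
  assumes "span_tree M T"
  shows "finite (internal_active M T)" "finite (external_active M T)"
proof -
  interpret tour M T using assms by (rule tourI)
  show "finite (internal_active M T)" "finite (external_active M T)"
    using T_E internal_active_sub external_active_sub finite_E by (meson Diff_subset finite_subset)+
qed

lemma finite_trees: "finite {T. span_tree M T}"
  by (rule finite_subset[of _ "Pow E"]) (auto simp: span_tree_iff)

text \<open>The intervals partition the subgraphs, and within the interval of \<open>T\<close> a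
  subgraph is a free choice of removed and added active edges.\<close>

lemma sum_intervals:
  "(\<Sum>S\<in>subgraphs M. F (tree_of M S) (tree_of M S - S) (S - tree_of M S)) =
   (\<Sum>T | span_tree M T. \<Sum>A\<in>Pow (internal_active M T). \<Sum>B\<in>Pow (external_active M T). F T A B)"
proof -
  let ?I = "SIGMA T:{T. span_tree M T}. Pow (internal_active M T) \<times> Pow (external_active M T)"
  have "(\<Sum>S\<in>subgraphs M. F (tree_of M S) (tree_of M S - S) (S - tree_of M S)) =
    (\<Sum>(T, A, B)\<in>?I. F T A B)"
  proof (rule sum.reindex_bij_witness[where i = "\<lambda>(T, A, B). T - A \<union> B"
        and j = "\<lambda>S. (tree_of M S, tree_of M S - S, S - tree_of M S)"])
    fix S assume "S \<in> subgraphs M"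
    then interpret tree_int M "tree_of M S" S unfolding subgraphs_def by (intro tree_intI) simp
    show "(tree_of M S, tree_of M S - S, S - tree_of M S) \<in> ?I"
      using tree removed_active added_active by blast
  next
    fix x assume "x \<in> ?I"
    then obtain T A B where x: "x = (T, A, B)" "span_tree M T" "A \<subseteq> internal_active M T" "B \<subseteq> external_active M T"
      by blast
    interpret tour M T using x(2) by (rule tourI)
    have int: "T - A \<union> B \<in> tree_interval M T" unfolding tree_interval_def using x by blast
    then have "tree_of M (T - A \<union> B) = T" using tree_of_eq x(2) by blast
    moreover have "T - (T - A \<union> B) = A" "T - A \<union> B - T = B"
      using x internal_active_sub external_active_sub by blast+
    ultimately show "(case (case x of (T, A, B) \<Rightarrow> T - A \<union> B) of
        S \<Rightarrow> (tree_of M S, tree_of M S - S, S - tree_of M S)) = x"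
      using x(1) by simp
    show "(case x of (T, A, B) \<Rightarrow> T - A \<union> B) \<in> subgraphs M"
      using int x(1) mem_tree_interval_iff unfolding subgraphs_def by auto
  qed auto
  also have "\<dots> = (\<Sum>T | span_tree M T. \<Sum>(A, B)\<in>Pow (internal_active M T) \<times> Pow (external_active M T). F T A B)"
    using finite_trees finite_active by (subst sum.Sigma) auto
  also have "\<dots> = (\<Sum>T | span_tree M T. \<Sum>A\<in>Pow (internal_active M T). \<Sum>B\<in>Pow (external_active M T). F T A B)"
    by (simp add: sum.cartesian_product)
  finally show ?thesis .
qed

text \<open>The activity expansion of the Tutte polynomial, for the activities of the tour: over
  each interval the powers of \<open>x - 1\<close> and \<open>y - 1\<close> sum up by the binomial
  formula \<open>sum_Pow_power\<close>.\<close>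

lemma tutte_activities:
  "(tutte M x y :: 'b :: comm_ring_1) =
   (\<Sum>T | span_tree M T. x ^ card (internal_active M T) * y ^ card (external_active M T))"
proof -
  have "(tutte M x y :: 'b) =
    (\<Sum>S\<in>subgraphs M. (x - 1) ^ card (tree_of M S - S) * (y - 1) ^ card (S - tree_of M S))"
    unfolding tutte_def
  proof (rule sum.cong[OF refl])
    fix S assume "S \<in> subgraphs M"
    then interpret tree_int M "tree_of M S" S unfolding subgraphs_def by (intro tree_intI) simp
    show "(x - 1) ^ (num_components M S - 1) * (y - 1) ^ (card S + num_components M S - card V) =
      (x - 1) ^ card (tree_of M S - S) * (y - 1) ^ card (S - tree_of M S)"
      using num_components_S nullity_S by simp
  qed
  also have "\<dots> = (\<Sum>T | span_tree M T. \<Sum>A\<in>Pow (internal_active M T). \<Sum>B\<in>Pow (external_active M T).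
      (x - 1) ^ card A * (y - 1) ^ card B)"
    by (rule sum_intervals)
  also have "\<dots> = (\<Sum>T | span_tree M T. x ^ card (internal_active M T) * y ^ card (external_active M T))"
    using finite_active by (intro sum.cong) (simp_all add: sum_Pow_power sum_product[symmetric])
  finally show ?thesis .
qed

text \<open>The common form of all seven classes: \<open>R\<close> restricts the tree,
  \<open>c\<close> forbids removals (as for connected subgraphs) and \<open>d\<close> forbids
  additions (as for forests). Forbidding replaces a factor 2 per active edge by 1.\<close>

lemma card_subgraphs:
  "int (card {S \<in> subgraphs M. R (tree_of M S) \<and> (c \<longrightarrow> tree_of M S \<subseteq> S) \<and> (d \<longrightarrow> S \<subseteq> tree_of M S)}) =
   (\<Sum>T | span_tree M T. if R T then (if c then 1 else 2 ^ card (internal_active M T)) *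
      (if d then 1 else 2 ^ card (external_active M T)) else 0)"
proof -
  have sum_if: "(\<Sum>A\<in>Pow I. if c \<longrightarrow> A = {} then 1 else 0 :: int) = (if c then 1 else 2 ^ card I)"
    if "finite I" for I :: "'h set set" and c
    using that by (cases c) (simp_all add: card_Pow sum.delta)
  have "finite (subgraphs M)" unfolding subgraphs_def by simp
  then have "int (card {S \<in> subgraphs M. R (tree_of M S) \<and> (c \<longrightarrow> tree_of M S \<subseteq> S) \<and> (d \<longrightarrow> S \<subseteq> tree_of M S)}) =
    (\<Sum>S\<in>subgraphs M. if R (tree_of M S) \<and> (c \<longrightarrow> tree_of M S \<subseteq> S) \<and> (d \<longrightarrow> S \<subseteq> tree_of M S) then 1 else 0)"
    by (simp add: sum.If_cases Int_def)
  also have "\<dots> = (\<Sum>S\<in>subgraphs M. (\<lambda>T A B. if R T then (if c \<longrightarrow> A = {} then 1 else 0) *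
      (if d \<longrightarrow> B = {} then 1 else 0) else 0) (tree_of M S) (tree_of M S - S) (S - tree_of M S))"
    by (intro sum.cong) auto
  also have "\<dots> = (\<Sum>T | span_tree M T. \<Sum>A\<in>Pow (internal_active M T). \<Sum>B\<in>Pow (external_active M T).
      if R T then (if c \<longrightarrow> A = {} then 1 else 0) * (if d \<longrightarrow> B = {} then 1 else 0) else 0)"
    by (rule sum_intervals)
  also have "\<dots> = (\<Sum>T | span_tree M T. if R T then (if c then 1 else 2 ^ card (internal_active M T)) *
      (if d then 1 else 2 ^ card (external_active M T)) else 0)"
  proof (rule sum.cong[OF refl])
    fix T assume "T \<in> {T. span_tree M T}"
    then have fin: "finite (internal_active M T)" "finite (external_active M T)" using finite_active by blast+
    show "(\<Sum>A\<in>Pow (internal_active M T). \<Sum>B\<in>Pow (external_active M T).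
      if R T then (if c \<longrightarrow> A = {} then 1 else 0) * (if d \<longrightarrow> B = {} then 1 else 0) else (0::int)) =
      (if R T then (if c then 1 else 2 ^ card (internal_active M T)) *
      (if d then 1 else 2 ^ card (external_active M T)) else 0)"
      using sum_if[OF fin(1), of c] sum_if[OF fin(2), of d]
      by (cases "R T") (simp_all only: if_True if_False sum_product[symmetric] sum.neutral_const)
  qed
  finally show ?thesis .
qed

text \<open>The evaluation points: 2 counts free choices at the active edges, 1 stands for a forced
  choice, and 0 admits only trees without active edges of that kind, because \<open>0 ^ n\<close> is
  1 for \<open>n = 0\<close> and 0 otherwise.\<close>

lemma card_subgraphs_tutte:
  assumes "\<And>T. span_tree M T \<Longrightarrow> (if R T then (if c then 1 else 2 ^ card (internal_active M T)) *
      (if d then 1 else 2 ^ card (external_active M T)) else 0) =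
      x ^ card (internal_active M T) * y ^ card (external_active M T)"
    and "\<And>S. P S \<longleftrightarrow> S \<in> subgraphs M \<and> R (tree_of M S) \<and> (c \<longrightarrow> tree_of M S \<subseteq> S) \<and> (d \<longrightarrow> S \<subseteq> tree_of M S)"
  shows "int (card {S. P S}) = tutte M x y"
  unfolding assms(2) card_subgraphs tutte_activities using assms(1) by (intro sum.cong) auto

section \<open>Classes of subgraphs and orientations in terms of the tree of a subgraph\<close>

lemma connected_subgraph_tree_of: "connected_subgraph M S \<longleftrightarrow> S \<in> subgraphs M \<and> tree_of M S \<subseteq> S"
  using tree_int.connected_iff[OF tree_intI] unfolding subgraphs_def
  by (auto simp: connected_subgraph_iff)

lemma forest_subgraph_tree_of: "forest_subgraph M S \<longleftrightarrow> S \<in> subgraphs M \<and> S \<subseteq> tree_of M S"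
  using tree_int.forest_iff[OF tree_intI] unfolding subgraphs_def
  by (auto simp: forest_subgraph_iff)

lemma span_tree_tree_of: "span_tree M S \<longleftrightarrow> S \<in> subgraphs M \<and> tree_of M S \<subseteq> S \<and> S \<subseteq> tree_of M S"
  unfolding span_tree_def connected_subgraph_tree_of forest_subgraph_tree_of by blast

lemma external_subgraph_tree_of:
  "external_subgraph M S \<longleftrightarrow> S \<in> subgraphs M \<and> internal_active M (tree_of M S) = {}"
  using tree_of_span unfolding external_subgraph_def external_tree_def subgraphs_def by auto

lemma internal_subgraph_tree_of:
  "internal_subgraph M S \<longleftrightarrow> S \<in> subgraphs M \<and> external_active M (tree_of M S) = {}"
  using tree_of_span unfolding internal_subgraph_def internal_tree_def subgraphs_def by auto

lemma external_tree_tree_of: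
  "external_tree M S \<longleftrightarrow> S \<in> subgraphs M \<and> internal_active M (tree_of M S) = {} \<and> tree_of M S \<subseteq> S \<and> S \<subseteq> tree_of M S"
proof -
  have "tree_of M S = S" if "tree_of M S \<subseteq> S \<and> S \<subseteq> tree_of M S" using that by blast
  then show ?thesis unfolding external_tree_def span_tree_tree_of by auto
qed

lemma internal_tree_tree_of:
  "internal_tree M S \<longleftrightarrow> S \<in> subgraphs M \<and> external_active M (tree_of M S) = {} \<and> tree_of M S \<subseteq> S \<and> S \<subseteq> tree_of M S"
proof -
  have "tree_of M S = S" if "tree_of M S \<subseteq> S \<and> S \<subseteq> tree_of M S" using that by blast
  then show ?thesis unfolding internal_tree_def span_tree_tree_of by auto
qed

lemma Phi_properties:
  assumes "S \<in> subgraphs M"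
  shows "root_connected M (Phi M S) \<longleftrightarrow> tree_of M S \<subseteq> S"
    and "strongly_connected_or M (Phi M S) \<longleftrightarrow> internal_active M (tree_of M S) = {}"
    and "minimal_or M (Phi M S) \<longleftrightarrow> S \<subseteq> tree_of M S"
    and "acyclic_or M (Phi M S) \<longleftrightarrow> S \<subseteq> tree_of M S \<and> external_active M (tree_of M S) = {}"
    and "internal_active M (tree_of M S) = {} \<Longrightarrow> tree_of M S \<subseteq> S"
proof -
  interpret tree_int M "tree_of M S" S using assms unfolding subgraphs_def by (intro tree_intI) simp
  show "root_connected M (Phi M S) \<longleftrightarrow> tree_of M S \<subseteq> S" by (rule root_connected_iff_subset)
  show "strongly_connected_or M (Phi M S) \<longleftrightarrow> internal_active M (tree_of M S) = {}"
    by (rule strongly_connected_iff_active)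
  show "minimal_or M (Phi M S) \<longleftrightarrow> S \<subseteq> tree_of M S"
    by (rule minimal_iff[OF inv_into_f_f[OF inj_Phi assms]])
  show "acyclic_or M (Phi M S) \<longleftrightarrow> S \<subseteq> tree_of M S \<and> external_active M (tree_of M S) = {}"
    by (rule acyclic_iff)
  show "internal_active M (tree_of M S) = {} \<Longrightarrow> tree_of M S \<subseteq> S" using removed_active by blast
qed

lemma bij_Phi_restrict:
  assumes "\<And>S. P S \<longleftrightarrow> S \<in> subgraphs M \<and> Q (Phi M S)"
  shows "bij_betw (Phi M) {S. P S} {Or \<in> orientations M. Q Or}"
proof (rule bij_betw_imageI)
  show "inj_on (Phi M) {S. P S}" using inj_Phi by (rule inj_on_subset) (use assms in blast)
  have "orientations M = Phi M ` subgraphs M" using bij_betw_imp_surj_on[OF bij_Phi] by simp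
  then show "Phi M ` {S. P S} = {Or \<in> orientations M. Q Or}" unfolding assms by auto
qed

text \<open>One statement for three properties \<open>C\<close>: truth, root-connectedness and
  strong connectedness, all determined by the outdegrees. The quantifier over the orientations with
  outdegrees \<open>d\<close> then amounts to \<open>C\<close> at the minimal one.\<close>

lemma bij_outdegree:
  assumes "\<And>Or Or'. Or \<in> orientations M \<Longrightarrow> Or' \<in> orientations M \<Longrightarrow> outdegree M Or = outdegree M Or' \<Longrightarrow> C Or \<longleftrightarrow> C Or'"
  shows "bij_betw (outdegree M) {Or \<in> orientations M. minimal_or M Or \<and> C Or}
    {d \<in> outdegree_seqs M. \<forall>Or\<in>orientations M. outdegree M Or = d \<longrightarrow> C Or}"
proof -
  have orient: "orientations M = Phi M ` subgraphs M" using bij_betw_imp_surj_on[OF bij_Phi] by simp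
  have inj: "inj_on (outdegree M) {Or \<in> orientations M. minimal_or M Or}"
  proof (rule inj_onI)
    fix Or Or' assume *: "Or \<in> {Or \<in> orientations M. minimal_or M Or}" "Or' \<in> {Or \<in> orientations M. minimal_or M Or}"
      and eq: "outdegree M Or = outdegree M Or'"
    then obtain S S' where S: "S \<in> subgraphs M" "Or = Phi M S" "S' \<in> subgraphs M" "Or' = Phi M S'"
      unfolding orient by blast
    then have "S \<subseteq> tree_of M S" "S' \<subseteq> tree_of M S'" using * Phi_properties(3) by blast+
    then show "Or = Or'" using outdegree_inj[of S S'] S eq unfolding subgraphs_def by simp
  qed
  have ex: "\<exists>Or'\<in>orientations M. minimal_or M Or' \<and> outdegree M Or' = outdegree M Or" if "Or \<in> orientations M" for Or
  proof -
    obtain S where S: "S \<subseteq> E" "Or = Phi M S" using \<open>Or \<in> orientations M\<close> unfolding orient subgraphs_def by blast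
    obtain S' where S': "S' \<subseteq> E" "S' \<subseteq> tree_of M S'" "outdegree M (Phi M S') = outdegree M (Phi M S)"
      using outdegree_surj[OF S(1)] .
    have "S' \<in> subgraphs M" using S'(1) unfolding subgraphs_def by simp
    then show ?thesis using Phi_properties(3) S' S(2) Phi_in_orientations by metis
  qed
  show ?thesis
  proof (rule bij_betw_imageI)
    show "inj_on (outdegree M) {Or \<in> orientations M. minimal_or M Or \<and> C Or}"
      using inj by (rule inj_on_subset) blast
    show "outdegree M ` {Or \<in> orientations M. minimal_or M Or \<and> C Or} =
      {d \<in> outdegree_seqs M. \<forall>Or\<in>orientations M. outdegree M Or = d \<longrightarrow> C Or}"
    proof (intro equalityI subsetI)
      fix d assume "d \<in> outdegree M ` {Or \<in> orientations M. minimal_or M Or \<and> C Or}"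
      then obtain Or where Or: "Or \<in> orientations M" "C Or" "d = outdegree M Or" by blast
      have "C Or'" if "Or' \<in> orientations M" "outdegree M Or' = d" for Or'
        using assms[OF that(1) Or(1)] that(2) Or(2,3) by blast
      then show "d \<in> {d \<in> outdegree_seqs M. \<forall>Or\<in>orientations M. outdegree M Or = d \<longrightarrow> C Or}"
        using Or unfolding outdegree_seqs_def by blast
    next
      fix d assume d: "d \<in> {d \<in> outdegree_seqs M. \<forall>Or\<in>orientations M. outdegree M Or = d \<longrightarrow> C Or}"
      then obtain Or where "Or \<in> orientations M" "d = outdegree M Or" unfolding outdegree_seqs_def by blast
      then obtain Or' where Or': "Or' \<in> orientations M" "minimal_or M Or'" "outdegree M Or' = d" using ex by metis
      then have "C Or'" using d by blast
      then show "d \<in> outdegree M ` {Or \<in> orientations M. minimal_or M Or \<and> C Or}" using Or' by blast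
    qed
  qed
qed

lemma outdegree_reach:
  "Or \<in> orientations M \<Longrightarrow> Or' \<in> orientations M \<Longrightarrow> outdegree M Or = outdegree M Or' \<Longrightarrow> reach (tails Or) = reach (tails Or')"
  using reach_same_out[OF orients_tails orients_tails] outdegree_same_out by blast

end

theorem theorem46:
  fixes M :: "'h rooted_map"
  assumes map: "is_rooted_map M"
    and nonempty: "edges M \<noteq> {}"
  shows
    "(bij_betw (Phi M) {S. connected_subgraph M S} {Or \<in> orientations M. root_connected M Or} \<and>
      int (card {S. connected_subgraph M S}) = tutte M 1 2) \<and>

     (bij_betw (Phi M) {S. external_subgraph M S}
        {Or \<in> orientations M. strongly_connected_or M Or} \<and>
      int (card {S. external_subgraph M S}) = tutte M 0 2) \<and>

     (bij_betw (outdegree M) {Or \<in> orientations M. minimal_or M Or} (outdegree_seqs M) \<and>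
      bij_betw (Phi M) {S. forest_subgraph M S} {Or \<in> orientations M. minimal_or M Or} \<and>
      int (card {S. forest_subgraph M S}) = tutte M 2 1) \<and>

     (bij_betw (Phi M) {S. forest_subgraph M S \<and> internal_subgraph M S}
        {Or \<in> orientations M. acyclic_or M Or} \<and>
      int (card {S. forest_subgraph M S \<and> internal_subgraph M S}) = tutte M 2 0) \<and>

     (bij_betw (outdegree M) {Or \<in> orientations M. minimal_or M Or \<and> root_connected M Or}
        {d. root_connected_seq M d} \<and>
      bij_betw (Phi M) {T. span_tree M T}
        {Or \<in> orientations M. minimal_or M Or \<and> root_connected M Or} \<and>
      int (card {T. span_tree M T}) = tutte M 1 1) \<and>

     (bij_betw (outdegree M) {Or \<in> orientations M. minimal_or M Or \<and> strongly_connected_or M Or}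
        {d. strongly_connected_seq M d} \<and>
      bij_betw (Phi M) {T. external_tree M T}
        {Or \<in> orientations M. minimal_or M Or \<and> strongly_connected_or M Or} \<and>
      int (card {T. external_tree M T}) = tutte M 0 1) \<and>

     (bij_betw (Phi M) {T. internal_tree M T}
        {Or \<in> orientations M. root_connected M Or \<and> acyclic_or M Or} \<and>
      int (card {T. internal_tree M T}) = tutte M 1 0)"
proof -
  interpret rmap M by unfold_locales (rule map)
  note defs = connected_subgraph_tree_of forest_subgraph_tree_of span_tree_tree_of external_subgraph_tree_of
    internal_subgraph_tree_of external_tree_tree_of internal_tree_tree_of
  have active: "card (internal_active M T) = 0 \<longleftrightarrow> internal_active M T = {}"
    "card (external_active M T) = 0 \<longleftrightarrow> external_active M T = {}" if "span_tree M T" for T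
    using finite_active[OF that] by simp_all
  have rc: "root_connected M Or \<longleftrightarrow> root_connected M Or'"
    if "Or \<in> orientations M" "Or' \<in> orientations M" "outdegree M Or = outdegree M Or'" for Or Or'
    using root_connected_iff that outdegree_reach[OF that] by simp
  have sc: "strongly_connected_or M Or \<longleftrightarrow> strongly_connected_or M Or'"
    if "Or \<in> orientations M" "Or' \<in> orientations M" "outdegree M Or = outdegree M Or'" for Or Or'
    using strongly_connected_iff that outdegree_reach[OF that] by simp
  have Phi:
    "bij_betw (Phi M) {S. connected_subgraph M S} {Or \<in> orientations M. root_connected M Or}"
    "bij_betw (Phi M) {S. external_subgraph M S} {Or \<in> orientations M. strongly_connected_or M Or}"
    "bij_betw (Phi M) {S. forest_subgraph M S} {Or \<in> orientations M. minimal_or M Or}"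
    "bij_betw (Phi M) {S. forest_subgraph M S \<and> internal_subgraph M S} {Or \<in> orientations M. acyclic_or M Or}"
    "bij_betw (Phi M) {T. span_tree M T} {Or \<in> orientations M. minimal_or M Or \<and> root_connected M Or}"
    "bij_betw (Phi M) {T. external_tree M T} {Or \<in> orientations M. minimal_or M Or \<and> strongly_connected_or M Or}"
    "bij_betw (Phi M) {T. internal_tree M T} {Or \<in> orientations M. root_connected M Or \<and> acyclic_or M Or}"
    \<comment> \<open>For the external trees, \<open>Phi_properties(5)\<close> supplies
      \<open>tree_of M S \<subseteq> S\<close>, since minimality yields only the other
      inclusion.\<close>
    by (rule bij_Phi_restrict; use Phi_properties(1-4) in \<open>auto simp: defs intro: subsetD[OF Phi_properties(5)]\<close>)+
  have count:
    "int (card {S. connected_subgraph M S}) = tutte M 1 2"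
    "int (card {S. external_subgraph M S}) = tutte M 0 2"
    "int (card {S. forest_subgraph M S}) = tutte M 2 1"
    "int (card {S. forest_subgraph M S \<and> internal_subgraph M S}) = tutte M 2 0"
    "int (card {T. span_tree M T}) = tutte M 1 1"
    "int (card {T. external_tree M T}) = tutte M 0 1"
    "int (card {T. internal_tree M T}) = tutte M 1 0"
    subgoal by (rule card_subgraphs_tutte[where R = "\<lambda>_. True" and c = True and d = False])
        (use active in \<open>auto simp: defs power_0_left\<close>)
    subgoal by (rule card_subgraphs_tutte[where R = "\<lambda>T. internal_active M T = {}" and c = False and d = False])
        (use active in \<open>auto simp: defs power_0_left\<close>)
    subgoal by (rule card_subgraphs_tutte[where R = "\<lambda>_. True" and c = False and d = True])
        (use active in \<open>auto simp: defs power_0_left\<close>)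
    subgoal by (rule card_subgraphs_tutte[where R = "\<lambda>T. external_active M T = {}" and c = False and d = True])
        (use active in \<open>auto simp: defs power_0_left\<close>)
    subgoal by (rule card_subgraphs_tutte[where R = "\<lambda>_. True" and c = True and d = True])
        (use active in \<open>auto simp: defs power_0_left\<close>)
    subgoal by (rule card_subgraphs_tutte[where R = "\<lambda>T. internal_active M T = {}" and c = True and d = True])
        (use active in \<open>auto simp: defs power_0_left\<close>)
    subgoal by (rule card_subgraphs_tutte[where R = "\<lambda>T. external_active M T = {}" and c = True and d = True])
        (use active in \<open>auto simp: defs power_0_left\<close>)
    done
  have out:
    "bij_betw (outdegree M) {Or \<in> orientations M. minimal_or M Or} (outdegree_seqs M)"
    "bij_betw (outdegree M) {Or \<in> orientations M. minimal_or M Or \<and> root_connected M Or} {d. root_connected_seq M d}"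
    "bij_betw (outdegree M) {Or \<in> orientations M. minimal_or M Or \<and> strongly_connected_or M Or} {d. strongly_connected_seq M d}"
    subgoal using bij_outdegree[of "\<lambda>_. True"] by simp
    subgoal unfolding root_connected_seq_def by (rule bij_outdegree[OF rc])
    subgoal unfolding strongly_connected_seq_def by (rule bij_outdegree[OF sc])
    done
  show ?thesis using Phi count out by blast
qed

end
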